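(* For all small contextual categories $\mathcal A,\mathcal B,\mathcal C$, the following two contextual functors $\mathcal A\otimes(\mathcal B\otimes\mathcal C)\to(\mathcal C\otimes\mathcal A)\otimes\mathcal B$ are equal: $$(\beta_{\mathcal A,\mathcal C}\otimes\mathrm{Id}_{\mathcal B})\circ\alpha_{\mathcal A,\mathcal C,\mathcal B}\circ(\mathrm{Id}_{\mathcal A}\otimes\beta_{\mathcal B,\mathcal C})\;=\;\alpha_{\mathcal C,\mathcal A,\mathcal B}\circ\beta_{\mathcal A\otimes\mathcal B,\mathcal C}\circ\alpha_{\mathcal A,\mathcal B,\mathcal C}.$$
   Context: A precontextual category $\mathcal C$ consists of: a category $|\mathcal C|$ (with a set of objects); a length function $\ell$ from objects to $\mathbb N$; a function $\partial$ from objects to objects with $\ell(\partial a)=\ell(a)-1$ if $\ell(a)\ge 1$ and $\partial a=a$ if $\ell(a)=0$; for each object $a$ with $\ell(a)\ge1$ a morphism $\mathbf p_a:a\to\partial a$; and a set $\mathbf Q$ of commutative squares in $|\mathcal C|$ having left side some $\mathbf p_a$ and right side some $\mathbf p_b$. A display map (written $\twoheadrightarrow$) is a finite, possibly empty, composite of maps $\mathbf p_a$; its length is $\ell(\text{domain})-\ell(\text{codomain})$. A distinguished square is a finite vertical composite of elements of $\mathbf Q$; length-1 distinguished squares are the elements of $\mathbf Q$. $\mathcal C$ is a contextual category if moreover: there is a unique object $1_{\mathcal C}$ of length $0$, and it is terminal; every element of $\mathbf Q$ is a pullback; $\mathbf Q$ contains the identity square of every $\mathbf p_a$ and is closed under horizontal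 composition; for every $a$ with $\ell(a)\ge 1$ and $f:b\to\partial a$ there is a unique element of $\mathbf Q$ with right side $\mathbf p_a$ and bottom $f$ (hence any display map has a unique distinguished pullback along any map into its codomain). A morphism (contextual functor) is a functor strictly preserving $\ell,\partial,\mathbf p$ and sending $\mathbf Q$ into $\mathbf Q$. Gap maps. In a contextual category, let $S$ be a commutative square with top $f':b'\to b$, bottom $f:a'\to a$, left side $b'\twoheadrightarrow a'$ and right side $p:b\twoheadrightarrow a$ display maps. Let $c$ be the top-left corner of the distinguished square with right side $p$ and bottom $f$. The induced map $b'\to c$ is the gap map of $S$; $S$ is a relative length-1 display map if its gap map is a length-1 display map. Bimorphisms. A bimorphism from $(\mathcal A,\mathcal B)$ to a contextual category $\mathcal C$ is a functor $H:|\mathcal A|\times|\mathcal B|\to|\mathcal C|$ such that: (i) for each $b$, $H(-,b)$ preserves display maps (not necessarily their lengths) and sends length-0 objects to $1_{\mathcal C}$, and it is constant at $1_{\mathcal C}$ if $\ell(b)=0$; (ii) for $a,b$ of length $\ge1$ the square with top $H(id_a,\mathbf p_b):H(a,b)\to H(a,\partial b)$, bottom $H(id_{\partial a},\mathbf p_b)$ and vertical sides $H(\mathbf p_a,id)$ is a relative length-1 display map; write $\mathrm{gap}_H(a,b)$ for its gap map, whose codomain is thus a pullback $H(\partial a,b)\times_{H(\partial a,\partial b)}H(a,\partial b)$; (iii) for $b$ of length $\ge1$ and a square in $\mathbf Q$ of $\mathcal A$ with top $f':a_1\to a_2$, the square with sides $\mathrm{gap}_H(a_1,b)$, $\mathrm{gap}_H(a_2,b)$,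 top $H(f',id_b)$ and bottom the induced map is distinguished; (iv) for $a$ of length $\ge1$ and a square in $\mathbf Q$ of $\mathcal B$ with top $f':b_1\to b_2$, the square with sides $\mathrm{gap}_H(a,b_1)$, $\mathrm{gap}_H(a,b_2)$, top $H(id_a,f')$ and bottom the induced map is distinguished. Tensor product. $\otimes_{\mathcal A,\mathcal B}:\mathcal A\times\mathcal B\to\mathcal A\otimes\mathcal B$, $(f,g)\mapsto f\otimes g$, is a chosen universal bimorphism to a small contextual category (it exists): every bimorphism from $(\mathcal A,\mathcal B)$ to a small contextual category factors through it by a unique contextual functor. For contextual functors $F,G$, $F\otimes G$ is the unique contextual functor with $(F\otimes G)(f\otimes g)=F(f)\otimes G(g)$. The associator $\alpha_{\mathcal A,\mathcal B,\mathcal C}:\mathcal A\otimes(\mathcal B\otimes\mathcal C)\to(\mathcal A\otimes\mathcal B)\otimes\mathcal C$ is the unique contextual functor with $f\otimes(g\otimes h)\mapsto(f\otimes g)\otimes h$ for all morphisms $f,g,h$ (the paper shows existence and uniqueness). Symmetry. Let $\sigma:|\mathcal A|\times|\mathcal B|\to|\mathcal B|\times|\mathcal A|$ be the swap. For each bimorphism $F:\mathcal B\times\mathcal A\to\mathcal C$ there is a unique pair $(F',\phi)$ with $F':\mathcal A\times\mathcal B\to\mathcal C$ a bimorphism and $\phi:F'\Rightarrow F\circ\sigma$ a natural isomorphism such that, for all $a,b$ of length $\ge 1$, the square with top $\phi_{a,b}:F'(a,b)\to F(b,a)$, vertical sides $\mathrm{gap}_{F'}(a,b)$ and $\mathrm{gap}_F(b,a)$,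 and bottom the map of pullbacks induced by $\phi$, is distinguished. $\beta_{\mathcal A,\mathcal B}:\mathcal A\otimes\mathcal B\to\mathcal B\otimes\mathcal A$ is the unique contextual functor such that $\beta_{\mathcal A,\mathcal B}\circ\otimes_{\mathcal A,\mathcal B}=F'$ for $F=\otimes_{\mathcal B,\mathcal A}$. *)

theory Defs
  imports "HOL-Library.FuncSet"
begin

text \<open>
  Small structures are those whose objects and morphisms are elements of one type \<open>'u\<close>, which is
  arbitrary and plays the role of the universe of small sets.  Functions on a structure are only
  constrained on its objects and morphisms; functors are moreover extensional (as in
  \<open>HOL-Library.FuncSet\<close>), so that equality of functors is equality in HOL.
\<close>

section \<open>Categories and functors\<close>

record ('o, 'm) category =
  ob  :: "'o set"
  arr :: "'m set"
  src :: "'m \<Rightarrow> 'o"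
  tgt :: "'m \<Rightarrow> 'o"
  idm :: "'o \<Rightarrow> 'm"
  cmp :: "'m \<Rightarrow> 'm \<Rightarrow> 'm"  (infixr "\<odot>\<index>" 70)

definition hom_set :: "('o, 'm, 'x) category_scheme \<Rightarrow> 'o \<Rightarrow> 'o \<Rightarrow> 'm set" where
  "hom_set A x y = {f \<in> arr A. src A f = x \<and> tgt A f = y}"

definition is_category :: "('o, 'm, 'x) category_scheme \<Rightarrow> bool" where
  "is_category A \<longleftrightarrow>
     (\<forall>f\<in>arr A. src A f \<in> ob A \<and> tgt A f \<in> ob A) \<and>
     (\<forall>x\<in>ob A. idm A x \<in> hom_set A x x) \<and>
     (\<forall>f\<in>arr A. \<forall>g\<in>arr A. src A g = tgt A f \<longrightarrow> g \<odot>\<^bsub>A\<^esub> f \<in> hom_set A (src A f) (tgt A g)) \<and>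
     (\<forall>f\<in>arr A. idm A (tgt A f) \<odot>\<^bsub>A\<^esub> f = f \<and> f \<odot>\<^bsub>A\<^esub> idm A (src A f) = f) \<and>
     (\<forall>f\<in>arr A. \<forall>g\<in>arr A. \<forall>h\<in>arr A. src A g = tgt A f \<longrightarrow> src A h = tgt A g \<longrightarrow>
        h \<odot>\<^bsub>A\<^esub> (g \<odot>\<^bsub>A\<^esub> f) = (h \<odot>\<^bsub>A\<^esub> g) \<odot>\<^bsub>A\<^esub> f)"

definition prod_cat ::
  "('o1, 'm1, 'x) category_scheme \<Rightarrow> ('o2, 'm2, 'y) category_scheme \<Rightarrow>
   ('o1 \<times> 'o2, 'm1 \<times> 'm2) category" where
  "prod_cat A B =
     \<lparr>ob = ob A \<times> ob B, arr = arr A \<times> arr B,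
      src = (\<lambda>(f, g). (src A f, src B g)), tgt = (\<lambda>(f, g). (tgt A f, tgt B g)),
      idm = (\<lambda>(x, y). (idm A x, idm B y)),
      cmp = (\<lambda>(f', g') (f, g). (f' \<odot>\<^bsub>A\<^esub> f, g' \<odot>\<^bsub>B\<^esub> g))\<rparr>"

record ('o1, 'm1, 'o2, 'm2) fctr =
  fob  :: "'o1 \<Rightarrow> 'o2"
  farr :: "'m1 \<Rightarrow> 'm2"

definition is_functor ::
  "('o1, 'm1, 'x) category_scheme \<Rightarrow> ('o2, 'm2, 'y) category_scheme \<Rightarrow>
   ('o1, 'm1, 'o2, 'm2) fctr \<Rightarrow> bool" where
  "is_functor A B F \<longleftrightarrow>
     fob F \<in> ob A \<rightarrow>\<^sub>E ob B \<and> farr F \<in> arr A \<rightarrow>\<^sub>E arr B \<and>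
     (\<forall>f\<in>arr A. src B (farr F f) = fob F (src A f) \<and> tgt B (farr F f) = fob F (tgt A f)) \<and>
     (\<forall>x\<in>ob A. farr F (idm A x) = idm B (fob F x)) \<and>
     (\<forall>f\<in>arr A. \<forall>g\<in>arr A. src A g = tgt A f \<longrightarrow>
        farr F (g \<odot>\<^bsub>A\<^esub> f) = farr F g \<odot>\<^bsub>B\<^esub> farr F f)"

definition id_fctr :: "('o, 'm, 'x) category_scheme \<Rightarrow> ('o, 'm, 'o, 'm) fctr" where
  "id_fctr A = \<lparr>fob = (\<lambda>x\<in>ob A. x), farr = (\<lambda>f\<in>arr A. f)\<rparr>"

text \<open>\<open>comp_fctr A G F\<close> is \<open>G \<circ> F\<close>, where \<open>A\<close> is the domain of \<open>F\<close>.\<close>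

definition comp_fctr ::
  "('o1, 'm1, 'x) category_scheme \<Rightarrow> ('o2, 'm2, 'o3, 'm3) fctr \<Rightarrow> ('o1, 'm1, 'o2, 'm2) fctr \<Rightarrow>
   ('o1, 'm1, 'o3, 'm3) fctr" where
  "comp_fctr A G F =
     \<lparr>fob = compose (ob A) (fob G) (fob F), farr = compose (arr A) (farr G) (farr F)\<rparr>"

definition swap_fctr ::
  "('o1, 'm1, 'x) category_scheme \<Rightarrow> ('o2, 'm2, 'y) category_scheme \<Rightarrow>
   ('o1 \<times> 'o2, 'm1 \<times> 'm2, 'o2 \<times> 'o1, 'm2 \<times> 'm1) fctr" where
  "swap_fctr A B =
     \<lparr>fob = (\<lambda>(x, y)\<in>ob A \<times> ob B. (y, x)), farr = (\<lambda>(f, g)\<in>arr A \<times> arr B. (g, f))\<rparr>"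

definition is_iso :: "('o, 'm, 'x) category_scheme \<Rightarrow> 'm \<Rightarrow> bool" where
  "is_iso A f \<longleftrightarrow> f \<in> arr A \<and>
     (\<exists>g\<in>hom_set A (tgt A f) (src A f).
        g \<odot>\<^bsub>A\<^esub> f = idm A (src A f) \<and> f \<odot>\<^bsub>A\<^esub> g = idm A (tgt A f))"

definition natural_iso ::
  "('o1, 'm1, 'x) category_scheme \<Rightarrow> ('o2, 'm2, 'y) category_scheme \<Rightarrow>
   ('o1, 'm1, 'o2, 'm2) fctr \<Rightarrow> ('o1, 'm1, 'o2, 'm2) fctr \<Rightarrow> ('o1 \<Rightarrow> 'm2) \<Rightarrow> bool" where
  "natural_iso A B F G \<phi> \<longleftrightarrow>
     (\<forall>x\<in>ob A. \<phi> x \<in> hom_set B (fob F x) (fob G x) \<and> is_iso B (\<phi> x)) \<and>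
     (\<forall>f\<in>arr A. \<phi> (tgt A f) \<odot>\<^bsub>B\<^esub> farr F f = farr G f \<odot>\<^bsub>B\<^esub> \<phi> (src A f))"


section \<open>Squares\<close>

record 'm square =
  top_side    :: 'm
  left_side   :: 'm
  right_side  :: 'm
  bottom_side :: 'm

definition commutative_square :: "('o, 'm, 'x) category_scheme \<Rightarrow> 'm square \<Rightarrow> bool" where
  "commutative_square A S \<longleftrightarrow>
     {top_side S, left_side S, right_side S, bottom_side S} \<subseteq> arr A \<and>
     src A (top_side S) = src A (left_side S) \<and> tgt A (top_side S) = src A (right_side S) \<and>
     tgt A (left_side S) = src A (bottom_side S) \<and> tgt A (right_side S) = tgt A (bottom_side S) \<and>
     right_side S \<odot>\<^bsub>A\<^esub> top_side S = bottom_side S \<odot>\<^bsub>A\<^esub> left_side S"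

definition corner :: "('o, 'm, 'x) category_scheme \<Rightarrow> 'm square \<Rightarrow> 'o" where
  "corner A S = src A (top_side S)"

definition pullback_square :: "('o, 'm, 'x) category_scheme \<Rightarrow> 'm square \<Rightarrow> bool" where
  "pullback_square A S \<longleftrightarrow> commutative_square A S \<and>
     (\<forall>u\<in>arr A. \<forall>v\<in>arr A. src A u = src A v \<longrightarrow>
        tgt A u = src A (bottom_side S) \<longrightarrow> tgt A v = src A (right_side S) \<longrightarrow>
        bottom_side S \<odot>\<^bsub>A\<^esub> u = right_side S \<odot>\<^bsub>A\<^esub> v \<longrightarrow>
        (\<exists>!m. m \<in> hom_set A (src A u) (corner A S) \<and>
              left_side S \<odot>\<^bsub>A\<^esub> m = u \<and> top_side S \<odot>\<^bsub>A\<^esub> m = v))"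

text \<open>The map into the corner of the pullback square \<open>S\<close> with components \<open>u\<close> (along the left side)
  and \<open>v\<close> (along the top).\<close>

definition pullback_map :: "('o, 'm, 'x) category_scheme \<Rightarrow> 'm square \<Rightarrow> 'm \<Rightarrow> 'm \<Rightarrow> 'm" where
  "pullback_map A S u v =
     (THE m. m \<in> hom_set A (src A u) (corner A S) \<and>
             left_side S \<odot>\<^bsub>A\<^esub> m = u \<and> top_side S \<odot>\<^bsub>A\<^esub> m = v)"

text \<open>\<open>hcomp A R S\<close> places \<open>S\<close> to the left of \<open>R\<close>; \<open>vcomp A S R\<close> places \<open>S\<close> on top of \<open>R\<close>.\<close>

definition hcomp :: "('o, 'm, 'x) category_scheme \<Rightarrow> 'm square \<Rightarrow> 'm square \<Rightarrow> 'm square" where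
  "hcomp A R S =
     \<lparr>top_side = top_side R \<odot>\<^bsub>A\<^esub> top_side S, left_side = left_side S,
      right_side = right_side R, bottom_side = bottom_side R \<odot>\<^bsub>A\<^esub> bottom_side S\<rparr>"

definition vcomp :: "('o, 'm, 'x) category_scheme \<Rightarrow> 'm square \<Rightarrow> 'm square \<Rightarrow> 'm square" where
  "vcomp A S R =
     \<lparr>top_side = top_side S, left_side = left_side R \<odot>\<^bsub>A\<^esub> left_side S,
      right_side = right_side R \<odot>\<^bsub>A\<^esub> right_side S, bottom_side = bottom_side R\<rparr>"

definition map_square :: "('o1, 'm1, 'o2, 'm2) fctr \<Rightarrow> 'm1 square \<Rightarrow> 'm2 square" where
  "map_square F S =
     \<lparr>top_side = farr F (top_side S), left_side = farr F (left_side S),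
      right_side = farr F (right_side S), bottom_side = farr F (bottom_side S)\<rparr>"


section \<open>Contextual categories\<close>

text \<open>\<open>ft\<close> (``father'') is the function written \<open>\<partial>\<close>, and \<open>pr a\<close> is the morphism from \<open>a\<close> to \<open>ft a\<close>.\<close>

record 'u contextual = "('u, 'u) category" +
  len :: "'u \<Rightarrow> nat"
  ft  :: "'u \<Rightarrow> 'u"
  pr  :: "'u \<Rightarrow> 'u"
  sqs :: "'u square set"

definition precontextual_category :: "'u contextual \<Rightarrow> bool" where
  "precontextual_category A \<longleftrightarrow> is_category A \<and>
     (\<forall>a\<in>ob A. ft A a \<in> ob A \<and>
        (1 \<le> len A a \<longrightarrow> len A (ft A a) = len A a - 1) \<and>
        (len A a = 0 \<longrightarrow> ft A a = a) \<and>
        (1 \<le> len A a \<longrightarrow> pr A a \<in> hom_set A a (ft A a))) \<and>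
     (\<forall>S\<in>sqs A. commutative_square A S \<and>
        (\<exists>a\<in>ob A. 1 \<le> len A a \<and> left_side S = pr A a) \<and>
        (\<exists>b\<in>ob A. 1 \<le> len A b \<and> right_side S = pr A b))"

definition contextual_category :: "'u contextual \<Rightarrow> bool" where
  "contextual_category A \<longleftrightarrow> precontextual_category A \<and>
     (\<exists>!t. t \<in> ob A \<and> len A t = 0) \<and>
     (\<forall>t\<in>ob A. len A t = 0 \<longrightarrow> (\<forall>a\<in>ob A. \<exists>!f. f \<in> hom_set A a t)) \<and>
     (\<forall>S\<in>sqs A. pullback_square A S) \<and>
     (\<forall>a\<in>ob A. 1 \<le> len A a \<longrightarrow>
        \<lparr>top_side = idm A a, left_side = pr A a, right_side = pr A a,
         bottom_side = idm A (ft A a)\<rparr> \<in> sqs A) \<and>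
     (\<forall>S\<in>sqs A. \<forall>R\<in>sqs A. right_side S = left_side R \<longrightarrow> hcomp A R S \<in> sqs A) \<and>
     (\<forall>a\<in>ob A. \<forall>f\<in>arr A. 1 \<le> len A a \<longrightarrow> tgt A f = ft A a \<longrightarrow>
        (\<exists>!S. S \<in> sqs A \<and> right_side S = pr A a \<and> bottom_side S = f))"

definition one_ob :: "'u contextual \<Rightarrow> 'u" where
  "one_ob A = (THE t. t \<in> ob A \<and> len A t = 0)"

definition contextual_functor ::
  "'u contextual \<Rightarrow> 'u contextual \<Rightarrow> ('u, 'u, 'u, 'u) fctr \<Rightarrow> bool" where
  "contextual_functor A B F \<longleftrightarrow> is_functor A B F \<and>
     (\<forall>a\<in>ob A. len B (fob F a) = len A a \<and> fob F (ft A a) = ft B (fob F a) \<and>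
        (1 \<le> len A a \<longrightarrow> farr F (pr A a) = pr B (fob F a))) \<and>
     (\<forall>S\<in>sqs A. map_square F S \<in> sqs B)"

inductive display_map :: "'u contextual \<Rightarrow> 'u \<Rightarrow> bool" for A where
  display_id: "a \<in> ob A \<Longrightarrow> display_map A (idm A a)"
| display_step: "display_map A g \<Longrightarrow> a \<in> ob A \<Longrightarrow> 1 \<le> len A a \<Longrightarrow> src A g = ft A a \<Longrightarrow>
    display_map A (g \<odot>\<^bsub>A\<^esub> pr A a)"

definition display_map_of_length :: "'u contextual \<Rightarrow> nat \<Rightarrow> 'u \<Rightarrow> bool" where
  "display_map_of_length A n f \<longleftrightarrow>
     display_map A f \<and> len A (src A f) = len A (tgt A f) + n"

text \<open>The empty vertical composites are the squares with identity vertical sides.\<close>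

inductive distinguished :: "'u contextual \<Rightarrow> 'u square \<Rightarrow> bool" for A where
  distinguished_empty: "f \<in> arr A \<Longrightarrow>
    distinguished A \<lparr>top_side = f, left_side = idm A (src A f), right_side = idm A (tgt A f),
                     bottom_side = f\<rparr>"
| distinguished_step: "S \<in> sqs A \<Longrightarrow> distinguished A R \<Longrightarrow> bottom_side S = top_side R \<Longrightarrow>
    distinguished A (vcomp A S R)"

definition dist_pullback :: "'u contextual \<Rightarrow> 'u \<Rightarrow> 'u \<Rightarrow> 'u square" where
  "dist_pullback A p f = (THE R. distinguished A R \<and> right_side R = p \<and> bottom_side R = f)"

definition gap_map :: "'u contextual \<Rightarrow> 'u square \<Rightarrow> 'u" where
  "gap_map A S =
     pullback_map A (dist_pullback A (right_side S) (bottom_side S)) (left_side S) (top_side S)"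

definition relative_length1_display :: "'u contextual \<Rightarrow> 'u square \<Rightarrow> bool" where
  "relative_length1_display A S \<longleftrightarrow> commutative_square A S \<and>
     display_map A (left_side S) \<and> display_map A (right_side S) \<and>
     display_map_of_length A 1 (gap_map A S)"


section \<open>Bimorphisms\<close>

type_synonym 'u bifctr = "('u \<times> 'u, 'u \<times> 'u, 'u, 'u) fctr"

definition bi_square ::
  "'u contextual \<Rightarrow> 'u contextual \<Rightarrow> 'u bifctr \<Rightarrow> 'u \<Rightarrow> 'u \<Rightarrow> 'u square" where
  "bi_square A B H a b =
     \<lparr>top_side = farr H (idm A a, pr B b), left_side = farr H (pr A a, idm B b),
      right_side = farr H (pr A a, idm B (ft B b)),
      bottom_side = farr H (idm A (ft A a), pr B b)\<rparr>"

text \<open>The pullback \<open>H (\<partial>a, b) \<times> H (a, \<partial>b)\<close> over \<open>H (\<partial>a, \<partial>b)\<close>: the left side is the projection to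
  \<open>H (\<partial>a, b)\<close> and the top is the projection to \<open>H (a, \<partial>b)\<close>.\<close>

definition bi_pullback ::
  "'u contextual \<Rightarrow> 'u contextual \<Rightarrow> 'u contextual \<Rightarrow> 'u bifctr \<Rightarrow> 'u \<Rightarrow> 'u \<Rightarrow> 'u square" where
  "bi_pullback A B C H a b =
     dist_pullback C (right_side (bi_square A B H a b)) (bottom_side (bi_square A B H a b))"

definition bi_gap ::
  "'u contextual \<Rightarrow> 'u contextual \<Rightarrow> 'u contextual \<Rightarrow> 'u bifctr \<Rightarrow> 'u \<Rightarrow> 'u \<Rightarrow> 'u" where
  "bi_gap A B C H a b = gap_map C (bi_square A B H a b)"

definition bimorphism ::
  "'u contextual \<Rightarrow> 'u contextual \<Rightarrow> 'u contextual \<Rightarrow> 'u bifctr \<Rightarrow> bool" where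
  "bimorphism A B C H \<longleftrightarrow> is_functor (prod_cat A B) C H \<and>
     (\<forall>b\<in>ob B.
        (\<forall>f. display_map A f \<longrightarrow> display_map C (farr H (f, idm B b))) \<and>
        (\<forall>a\<in>ob A. len A a = 0 \<longrightarrow> fob H (a, b) = one_ob C) \<and>
        (len B b = 0 \<longrightarrow>
           (\<forall>a\<in>ob A. fob H (a, b) = one_ob C) \<and>
           (\<forall>f\<in>arr A. farr H (f, idm B b) = idm C (one_ob C)))) \<and>
     (\<forall>a\<in>ob A. \<forall>b\<in>ob B. 1 \<le> len A a \<longrightarrow> 1 \<le> len B b \<longrightarrow>
        relative_length1_display C (bi_square A B H a b)) \<and>
     (\<forall>b\<in>ob B. \<forall>S\<in>sqs A. 1 \<le> len B b \<longrightarrow>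
        (let f' = top_side S; f = bottom_side S; a\<^sub>1 = src A f'; a\<^sub>2 = tgt A f';
             P\<^sub>1 = bi_pullback A B C H a\<^sub>1 b; P\<^sub>2 = bi_pullback A B C H a\<^sub>2 b
         in distinguished C
              \<lparr>top_side = farr H (f', idm B b),
               left_side = bi_gap A B C H a\<^sub>1 b, right_side = bi_gap A B C H a\<^sub>2 b,
               bottom_side = pullback_map C P\<^sub>2
                 (farr H (f, idm B b) \<odot>\<^bsub>C\<^esub> left_side P\<^sub>1)
                 (farr H (f', idm B (ft B b)) \<odot>\<^bsub>C\<^esub> top_side P\<^sub>1)\<rparr>)) \<and>
     (\<forall>a\<in>ob A. \<forall>S\<in>sqs B. 1 \<le> len A a \<longrightarrow>
        (let f' = top_side S; f = bottom_side S; b\<^sub>1 = src B f'; b\<^sub>2 = tgt B f';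
             P\<^sub>1 = bi_pullback A B C H a b\<^sub>1; P\<^sub>2 = bi_pullback A B C H a b\<^sub>2
         in distinguished C
              \<lparr>top_side = farr H (idm A a, f'),
               left_side = bi_gap A B C H a b\<^sub>1, right_side = bi_gap A B C H a b\<^sub>2,
               bottom_side = pullback_map C P\<^sub>2
                 (farr H (idm A (ft A a), f') \<odot>\<^bsub>C\<^esub> left_side P\<^sub>1)
                 (farr H (idm A a, f) \<odot>\<^bsub>C\<^esub> top_side P\<^sub>1)\<rparr>))"


section \<open>Tensor products\<close>

definition universal_bimorphism ::
  "'u contextual \<Rightarrow> 'u contextual \<Rightarrow> 'u contextual \<Rightarrow> 'u bifctr \<Rightarrow> bool" where
  "universal_bimorphism A B T H \<longleftrightarrow> contextual_category T \<and> bimorphism A B T H \<and>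
     (\<forall>D K. contextual_category D \<longrightarrow> bimorphism A B D K \<longrightarrow>
        (\<exists>!N. contextual_functor T D N \<and> comp_fctr (prod_cat A B) N H = K))"

record 'u tensor =
  tobj :: "'u contextual \<Rightarrow> 'u contextual \<Rightarrow> 'u contextual"  (infixr "\<otimes>\<index>" 75)
  tmap :: "'u contextual \<Rightarrow> 'u contextual \<Rightarrow> 'u bifctr"

definition tensor_choice :: "'u tensor \<Rightarrow> bool" where
  "tensor_choice t \<longleftrightarrow>
     (\<forall>A B. contextual_category A \<longrightarrow> contextual_category B \<longrightarrow>
        universal_bimorphism A B (A \<otimes>\<^bsub>t\<^esub> B) (tmap t A B))"

abbreviation tensor_arr ::
  "'u tensor \<Rightarrow> 'u contextual \<Rightarrow> 'u contextual \<Rightarrow> 'u \<Rightarrow> 'u \<Rightarrow> 'u" where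
  "tensor_arr t A B f g \<equiv> farr (tmap t A B) (f, g)"

text \<open>\<open>tensor_fctr t A B A' B' F G\<close> is \<open>F \<otimes> G\<close> for contextual functors \<open>F\<close> from \<open>A\<close> to \<open>A'\<close> and \<open>G\<close>
  from \<open>B\<close> to \<open>B'\<close>.\<close>

definition tensor_fctr ::
  "'u tensor \<Rightarrow> 'u contextual \<Rightarrow> 'u contextual \<Rightarrow> 'u contextual \<Rightarrow> 'u contextual \<Rightarrow>
   ('u, 'u, 'u, 'u) fctr \<Rightarrow> ('u, 'u, 'u, 'u) fctr \<Rightarrow> ('u, 'u, 'u, 'u) fctr" where
  "tensor_fctr t A B A' B' F G =
     (THE N. contextual_functor (A \<otimes>\<^bsub>t\<^esub> B) (A' \<otimes>\<^bsub>t\<^esub> B') N \<and>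
        (\<forall>f\<in>arr A. \<forall>g\<in>arr B.
           farr N (tensor_arr t A B f g) = tensor_arr t A' B' (farr F f) (farr G g)))"

definition is_associator ::
  "'u tensor \<Rightarrow> 'u contextual \<Rightarrow> 'u contextual \<Rightarrow> 'u contextual \<Rightarrow>
   ('u, 'u, 'u, 'u) fctr \<Rightarrow> bool" where
  "is_associator t A B C \<alpha> \<longleftrightarrow>
     contextual_functor (A \<otimes>\<^bsub>t\<^esub> (B \<otimes>\<^bsub>t\<^esub> C)) ((A \<otimes>\<^bsub>t\<^esub> B) \<otimes>\<^bsub>t\<^esub> C) \<alpha> \<and>
     (\<forall>f\<in>arr A. \<forall>g\<in>arr B. \<forall>h\<in>arr C.
        farr \<alpha> (tensor_arr t A (B \<otimes>\<^bsub>t\<^esub> C) f (tensor_arr t B C g h)) =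
        tensor_arr t (A \<otimes>\<^bsub>t\<^esub> B) C (tensor_arr t A B f g) h)"


section \<open>Symmetry\<close>

text \<open>\<open>F\<close> is a bimorphism from \<open>(B, A)\<close> to \<open>C\<close>, and \<open>(F', \<phi>)\<close> is the associated pair with \<open>F'\<close> a
  bimorphism from \<open>(A, B)\<close> to \<open>C\<close>.  In the bottom map of pullbacks the two projections are
  interchanged, since \<open>\<phi>\<close> maps \<open>F' (\<partial>a, b)\<close> to \<open>F (b, \<partial>a)\<close> and \<open>F' (a, \<partial>b)\<close> to \<open>F (\<partial>b, a)\<close>.\<close>

definition is_swapped_bimorphism ::
  "'u contextual \<Rightarrow> 'u contextual \<Rightarrow> 'u contextual \<Rightarrow> 'u bifctr \<Rightarrow> 'u bifctr \<Rightarrow>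
   ('u \<times> 'u \<Rightarrow> 'u) \<Rightarrow> bool" where
  "is_swapped_bimorphism A B C F F' \<phi> \<longleftrightarrow> bimorphism A B C F' \<and>
     natural_iso (prod_cat A B) C F' (comp_fctr (prod_cat A B) F (swap_fctr A B)) \<phi> \<and>
     (\<forall>a\<in>ob A. \<forall>b\<in>ob B. 1 \<le> len A a \<longrightarrow> 1 \<le> len B b \<longrightarrow>
        (let P' = bi_pullback A B C F' a b; P = bi_pullback B A C F b a
         in distinguished C
              \<lparr>top_side = \<phi> (a, b),
               left_side = bi_gap A B C F' a b, right_side = bi_gap B A C F b a,
               bottom_side = pullback_map C P
                 (\<phi> (a, ft B b) \<odot>\<^bsub>C\<^esub> top_side P')
                 (\<phi> (ft A a, b) \<odot>\<^bsub>C\<^esub> left_side P')\<rparr>))"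

definition is_symmetry ::
  "'u tensor \<Rightarrow> 'u contextual \<Rightarrow> 'u contextual \<Rightarrow> ('u, 'u, 'u, 'u) fctr \<Rightarrow> bool" where
  "is_symmetry t A B \<beta> \<longleftrightarrow>
     contextual_functor (A \<otimes>\<^bsub>t\<^esub> B) (B \<otimes>\<^bsub>t\<^esub> A) \<beta> \<and>
     (\<exists>\<phi>. is_swapped_bimorphism A B (B \<otimes>\<^bsub>t\<^esub> A) (tmap t B A)
            (comp_fctr (prod_cat A B) \<beta> (tmap t A B)) \<phi>)"

end

theory Submission
  imports Defs
begin

text \<open>
  Pure tensors \<open>f \<otimes> (g \<otimes> h)\<close> generate \<open>A \<otimes> (B \<otimes> C)\<close>: the arrows on which two contextual functors agree are
  closed under composition, distinguished pullbacks and induced maps, and by universality a contextual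
  subcategory containing all pure tensors is everything.  So it suffices to compare both sides
  of the hexagon on pure tensors.  Each side carries a natural isomorphism \<open>\<psi>\<close> to \<open>(c \<otimes> a) \<otimes> b\<close>, and by
  the definition of the symmetry the naturality square of \<open>\<psi>\<close> over \<open>\<partial>((c \<otimes> a) \<otimes> b)\<close> is
  distinguished.  Here \<open>\<partial>((c \<otimes> a) \<otimes> b)\<close> is the limit of a punctured cube, so the bottom side is
  determined by \<open>\<psi>\<close> at smaller triples; since distinguished squares are determined by their right and bottom sides,
  induction on the lengths of \<open>a\<close>, \<open>b\<close>, \<open>c\<close> shows that both functors and both isomorphisms coincide.
  The associators enter because the projections from this limit, computed in \<open>a \<otimes> (b \<otimes> c)\<close> or in
  \<open>(a \<otimes> b) \<otimes> c\<close>, are given by the same iterated distinguished pullback.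
\<close>

section \<open>Contextual categories\<close>

text \<open>A bimorphism treats its variables differently: \<open>H(-, b)\<close> preserves display
  maps and distinguished squares, whereas \<open>H(a, pr b)\<close> is \<open>pr\<close> followed by
  the second projection of a pullback, which need not be a display map. So the limit of the
  punctured cube is easy to describe for \<open>(a \<otimes> b) \<otimes> c\<close> and laborious
  for \<open>a \<otimes> (b \<otimes> c)\<close>: there \<open>H(a, -)\<close> gives a distinguished
  square only after the vertical sides have been replaced by gap maps relative to
  \<open>pr a\<close> (\<open>gen_gap\<close>). For the same reason the generation argument works
  with joint monicity of the image of a square (\<open>qsq_Ha_right_mono\<close>). The isomorphism
  \<psi> has to be carried along because a composite functor is known on objects only up to
  isomorphism. Its values on arrows follow from \<psi> by naturality and left cancellation, so the
  induction has just one unknown, namely \<psi>. Gap maps are eliminated from the outset: a length-1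
  gap map can only be the projection \<open>pr\<close> of its source, so the conditions on a
  bimorphism become statements about elements of \<open>sqs\<close> and two projections.\<close>

lemma commutative_squareD:
  assumes "commutative_square A S"
  shows "top_side S \<in> arr A" "left_side S \<in> arr A" "right_side S \<in> arr A" "bottom_side S \<in> arr A"
    "src A (top_side S) = src A (left_side S)" "tgt A (top_side S) = src A (right_side S)"
    "tgt A (left_side S) = src A (bottom_side S)" "tgt A (right_side S) = tgt A (bottom_side S)"
    "right_side S \<odot>\<^bsub>A\<^esub> top_side S = bottom_side S \<odot>\<^bsub>A\<^esub> left_side S"
  using assms by (auto simp: commutative_square_def)

locale contextual_cat =
  fixes D :: "'u contextual" (structure)
  assumes contextual: "contextual_category D"
begin

lemma precontextual: "precontextual_category D"
  using contextual by (simp add: contextual_category_def)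

lemma category: "is_category D"
  using precontextual by (simp add: precontextual_category_def)

lemma src_ob [simp, intro]: "f \<in> arr D \<Longrightarrow> src D f \<in> ob D"
  and tgt_ob [simp, intro]: "f \<in> arr D \<Longrightarrow> tgt D f \<in> ob D"
  and idm_arr [simp, intro]: "x \<in> ob D \<Longrightarrow> idm D x \<in> arr D"
  and src_idm [simp]: "x \<in> ob D \<Longrightarrow> src D (idm D x) = x"
  and tgt_idm [simp]: "x \<in> ob D \<Longrightarrow> tgt D (idm D x) = x"
  using category by (auto simp: is_category_def hom_set_def)

lemma comp_arr [simp, intro]: "f \<in> arr D \<Longrightarrow> g \<in> arr D \<Longrightarrow> src D g = tgt D f \<Longrightarrow> g \<odot> f \<in> arr D"
  and src_comp [simp]: "f \<in> arr D \<Longrightarrow> g \<in> arr D \<Longrightarrow> src D g = tgt D f \<Longrightarrow> src D (g \<odot> f) = src D f"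
  and tgt_comp [simp]: "f \<in> arr D \<Longrightarrow> g \<in> arr D \<Longrightarrow> src D g = tgt D f \<Longrightarrow> tgt D (g \<odot> f) = tgt D g"
  using category by (auto simp: is_category_def hom_set_def)

lemma idm_left [simp]: "f \<in> arr D \<Longrightarrow> tgt D f = x \<Longrightarrow> idm D x \<odot> f = f"
  and idm_right [simp]: "f \<in> arr D \<Longrightarrow> src D f = x \<Longrightarrow> f \<odot> idm D x = f"
  and comp_assoc [simp]: "f \<in> arr D \<Longrightarrow> g \<in> arr D \<Longrightarrow> h \<in> arr D \<Longrightarrow> src D g = tgt D f \<Longrightarrow>
    src D h = tgt D g \<Longrightarrow> (h \<odot> g) \<odot> f = h \<odot> (g \<odot> f)"
  using category by (auto simp: is_category_def hom_set_def)

text \<open>Composites are normalised to the right by \<open>comp_assoc\<close>, so an equation for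
  \<open>g \<odot> f\<close> no longer matches once a further arrow \<open>k\<close> precedes; this
  form still rewrites.\<close>

lemma comp_eq:
  assumes "g \<odot> f = h" "f \<in> arr D" "g \<in> arr D" "k \<in> arr D" "src D g = tgt D f" "tgt D k = src D f"
  shows "g \<odot> (f \<odot> k) = h \<odot> k"
  using assms comp_assoc[of k f g] by simp

lemma ft_ob [simp, intro]: "a \<in> ob D \<Longrightarrow> ft D a \<in> ob D"
  and len_ft: "a \<in> ob D \<Longrightarrow> 1 \<le> len D a \<Longrightarrow> len D (ft D a) = len D a - 1"
  and ft_zero: "a \<in> ob D \<Longrightarrow> len D a = 0 \<Longrightarrow> ft D a = a"
  and pr_arr [simp, intro]: "a \<in> ob D \<Longrightarrow> 1 \<le> len D a \<Longrightarrow> pr D a \<in> arr D"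
  and src_pr [simp]: "a \<in> ob D \<Longrightarrow> 1 \<le> len D a \<Longrightarrow> src D (pr D a) = a"
  and tgt_pr [simp]: "a \<in> ob D \<Longrightarrow> 1 \<le> len D a \<Longrightarrow> tgt D (pr D a) = ft D a"
  using precontextual by (auto simp: precontextual_category_def hom_set_def)

lemma square_commutative: "S \<in> sqs D \<Longrightarrow> commutative_square D S"
  using precontextual by (auto simp: precontextual_category_def)

lemma square_sides:
  assumes "S \<in> sqs D"
  shows "1 \<le> len D (src D (top_side S))" "1 \<le> len D (tgt D (top_side S))"
    "left_side S = pr D (src D (top_side S))" "right_side S = pr D (tgt D (top_side S))"
    "src D (bottom_side S) = ft D (src D (top_side S))"
    "tgt D (bottom_side S) = ft D (tgt D (top_side S))"
proof -
  note cs = commutative_squareD[OF square_commutative[OF assms]]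
  obtain a b where a: "a \<in> ob D" "1 \<le> len D a" "left_side S = pr D a"
    and b: "b \<in> ob D" "1 \<le> len D b" "right_side S = pr D b"
    using precontextual assms by (meson precontextual_category_def)
  have e: "src D (top_side S) = a" "tgt D (top_side S) = b"
    using cs(5,6) a b by simp_all
  show "1 \<le> len D (src D (top_side S))" "1 \<le> len D (tgt D (top_side S))"
    "left_side S = pr D (src D (top_side S))" "right_side S = pr D (tgt D (top_side S))"
    using a b e by simp_all
  show "src D (bottom_side S) = ft D (src D (top_side S))"
    "tgt D (bottom_side S) = ft D (tgt D (top_side S))"
    using a b e cs(7,8) tgt_pr by metis+
qed

lemma square_pullback: "S \<in> sqs D \<Longrightarrow> pullback_square D S"
  using contextual by (simp add: contextual_category_def)

lemma square_hcomp: "S \<in> sqs D \<Longrightarrow> R \<in> sqs D \<Longrightarrow> right_side S = left_side R \<Longrightarrow> hcomp D R S \<in> sqs D"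
  using contextual by (simp add: contextual_category_def)

lemma square_idm: "a \<in> ob D \<Longrightarrow> 1 \<le> len D a \<Longrightarrow>
    \<lparr>top_side = idm D a, left_side = pr D a, right_side = pr D a, bottom_side = idm D (ft D a)\<rparr> \<in> sqs D"
  using contextual by (simp add: contextual_category_def)

lemma square_ex1: "a \<in> ob D \<Longrightarrow> f \<in> arr D \<Longrightarrow> 1 \<le> len D a \<Longrightarrow> tgt D f = ft D a \<Longrightarrow>
    \<exists>!S. S \<in> sqs D \<and> right_side S = pr D a \<and> bottom_side S = f"
  using contextual by (simp add: contextual_category_def)

lemma one_ob_ex1: "\<exists>!t. t \<in> ob D \<and> len D t = 0"
  using contextual by (simp add: contextual_category_def)

lemma one_ob [simp]: "one_ob D \<in> ob D" "len D (one_ob D) = 0"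
  using theI'[OF one_ob_ex1] by (simp_all add: one_ob_def)

lemma one_ob_unique: "a \<in> ob D \<Longrightarrow> len D a = 0 \<Longrightarrow> a = one_ob D"
  using one_ob_ex1 one_ob by blast

lemma terminal: "f \<in> arr D \<Longrightarrow> g \<in> arr D \<Longrightarrow> src D f = src D g \<Longrightarrow> tgt D f = one_ob D \<Longrightarrow>
    tgt D g = one_ob D \<Longrightarrow> f = g"
proof -
  assume a: "f \<in> arr D" "g \<in> arr D" "src D f = src D g" "tgt D f = one_ob D" "tgt D g = one_ob D"
  have "\<exists>!h. h \<in> hom_set D (src D f) (one_ob D)"
    using contextual a one_ob by (simp add: contextual_category_def)
  with a show "f = g" by (auto simp: hom_set_def)
qed

section \<open>Display maps and their lengths\<close>

lemma display_arr [simp, intro]: "display_map D f \<Longrightarrow> f \<in> arr D"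
  by (induction rule: display_map.induct) auto

lemma display_len: "display_map D f \<Longrightarrow> len D (tgt D f) \<le> len D (src D f)"
proof (induction rule: display_map.induct)
  case (display_step g a)
  then show ?case using len_ft[of a] by (simp add: display_arr)
qed simp

text \<open>The strict drop in length in the \<open>step\<close> case is what later tells nonempty
  composites from identities.\<close>

lemma display_cases:
  assumes "display_map D f"
  obtains (id) x where "x \<in> ob D" "f = idm D x"
  | (step) g a where "display_map D g" "a \<in> ob D" "1 \<le> len D a" "src D g = ft D a"
     "f = g \<odot> pr D a" "src D f = a" "tgt D f = tgt D g" "len D (tgt D g) < len D a"
  using assms
proof cases
  case (display_id a)
  then show ?thesis using id by simp
next
  case (display_step g a)
  then have "len D (tgt D g) < len D a" using display_len[of g] len_ft[of a] by simp
  then show ?thesis using step[of g a] display_step by (simp add: display_arr)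
qed

text \<open>A display map follows the chain of fathers from its source, and lengths strictly drop
  along this chain, so the target says where it stops.\<close>

lemma display_unique:
  "display_map D f \<Longrightarrow> display_map D g \<Longrightarrow> src D f = src D g \<Longrightarrow> tgt D f = tgt D g \<Longrightarrow> f = g"
proof (induction arbitrary: g rule: display_map.induct)
  case (display_id a)
  from display_id(2) show ?case
  proof (cases rule: display_cases)
    case (id x)
    then show ?thesis using display_id(1,3) by simp
  next
    case (step k b)
    have "b = a" "tgt D k = a" using step(6,7) display_id(1,3,4) by simp_all
    then show ?thesis using step(8) by simp
  qed
next
  case (display_step h a)
  have h: "h \<in> arr D" using display_step(1) by simp
  have e: "src D g = a" "tgt D g = tgt D h" using display_step(2-4,7,8) h by simp_all
  from display_step(6) show ?case
  proof (cases rule: display_cases)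
    case (id x)
    then show ?thesis using display_len[OF display_step(1)] len_ft[of a] display_step(2-4) e by auto
  next
    case (step k b)
    have "b = a" using step(6) e by simp
    moreover have "h = k" using display_step(4,8) step(1,4,5,7) \<open>b = a\<close> e by (intro display_step.IH) simp_all
    ultimately show ?thesis using step by simp
  qed
qed

lemma display_pr [simp]: assumes "a \<in> ob D" "1 \<le> len D a" shows "display_map D (pr D a)"
  using display_map.display_step[OF display_map.display_id[of "ft D a"] assms] assms by simp

lemma display_comp: "display_map D g \<Longrightarrow> display_map D f \<Longrightarrow> src D f = tgt D g \<Longrightarrow> display_map D (f \<odot> g)"
proof (induction rule: display_map.induct)
  case (display_id a)
  then show ?case by (simp add: display_arr)
next
  case (display_step g a)
  have "display_map D ((f \<odot> g) \<odot> pr D a)"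
    using display_step by (intro display_map.display_step) (simp_all add: display_arr)
  then show ?case using display_step by (simp add: display_arr)
qed

text \<open>A composite of two or more projections lowers the length by at least two, and an empty
  one does not lower it.\<close>

lemma display_length1:
  assumes "display_map_of_length D 1 f"
  shows "f = pr D (src D f)" "1 \<le> len D (src D f)"
proof -
  have d: "display_map D f" and l: "len D (src D f) = len D (tgt D f) + 1"
    using assms by (simp_all add: display_map_of_length_def)
  show "1 \<le> len D (src D f)" using l by simp
  show "f = pr D (src D f)" using d
  proof (cases rule: display_cases)
    case (id x)
    then show ?thesis using l by simp
  next
    case (step g a)
    from step(1) show ?thesis
    proof (cases rule: display_cases)
      case id': (id x)
      then show ?thesis using step by simp
    next
      case step': (step k b)
      then show ?thesis using l step(3-7) len_ft[OF step(2,3)] by simp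
    qed
  qed
qed

lemma display_length1_pr:
  assumes "a \<in> ob D" "1 \<le> len D a" shows "display_map_of_length D 1 (pr D a)"
  using assms len_ft[of a] by (simp add: display_map_of_length_def)

end

section \<open>Distinguished squares: universal property, uniqueness, existence, pasting and
  cancellation\<close>

abbreviation sq :: "'m \<Rightarrow> 'm \<Rightarrow> 'm \<Rightarrow> 'm \<Rightarrow> 'm square" where
  "sq t l r b \<equiv> \<lparr>top_side = t, left_side = l, right_side = r, bottom_side = b\<rparr>"

abbreviation dsq :: "'u contextual \<Rightarrow> 'u \<Rightarrow> 'u \<Rightarrow> 'u \<Rightarrow> 'u \<Rightarrow> bool" where
  "dsq D t l r b \<equiv> distinguished D (sq t l r b)"

lemma pullback_squareD:
  assumes "pullback_square A (sq t l r b)" "u \<in> arr A" "v \<in> arr A" "src A u = src A v"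
    "tgt A u = src A b" "tgt A v = src A r" "b \<odot>\<^bsub>A\<^esub> u = r \<odot>\<^bsub>A\<^esub> v"
  shows "\<exists>!m. m \<in> arr A \<and> src A m = src A u \<and> tgt A m = src A t \<and> l \<odot>\<^bsub>A\<^esub> m = u \<and> t \<odot>\<^bsub>A\<^esub> m = v"
proof -
  have "\<exists>!m. m \<in> hom_set A (src A u) (src A t) \<and> l \<odot>\<^bsub>A\<^esub> m = u \<and> t \<odot>\<^bsub>A\<^esub> m = v"
    using conjunct2[OF assms(1)[unfolded pullback_square_def corner_def square.select_convs], rule_format, OF assms(2-7)] .
  then show ?thesis by (simp only: hom_set_def mem_Collect_eq conj_assoc)
qed

text \<open>The vertical sides of an element of \<open>sqs\<close> are forced by the ends of its top
  side, so these squares are handled as a binary relation between top and bottom.\<close>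

definition qsq :: "'u contextual \<Rightarrow> 'u \<Rightarrow> 'u \<Rightarrow> bool" where
  "qsq D f g \<longleftrightarrow> sq f (pr D (src D f)) (pr D (tgt D f)) g \<in> sqs D"

context contextual_cat
begin

lemma qsqD:
  assumes "qsq D f g"
  shows "f \<in> arr D" "g \<in> arr D" "1 \<le> len D (src D f)" "1 \<le> len D (tgt D f)"
    "src D g = ft D (src D f)" "tgt D g = ft D (tgt D f)"
    "pr D (tgt D f) \<odot> f = g \<odot> pr D (src D f)"
  using square_sides[OF assms[unfolded qsq_def]]
    commutative_squareD[OF square_commutative[OF assms[unfolded qsq_def]]] by simp_all

lemma qsq_sides:
  assumes "qsq D f g" "src D f = x" "tgt D f = y"
  shows "x \<in> ob D" "y \<in> ob D" "1 \<le> len D x" "1 \<le> len D y"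
    "pr D x \<in> arr D" "src D (pr D x) = x" "tgt D (pr D x) = ft D x"
    "pr D y \<in> arr D" "src D (pr D y) = y" "tgt D (pr D y) = ft D y" "src D g = ft D x" "tgt D g = ft D y"
    "f \<in> arr D" "g \<in> arr D" "pr D y \<odot> f = g \<odot> pr D x"
  using qsqD[OF assms(1)] assms(2,3) by auto

lemma square_qsq:
  assumes "S \<in> sqs D" shows "qsq D (top_side S) (bottom_side S)"
proof -
  have "sq (top_side S) (pr D (src D (top_side S))) (pr D (tgt D (top_side S))) (bottom_side S) = S"
    using square_sides(3,4)[OF assms] by (cases S) simp
  then show ?thesis using assms by (simp add: qsq_def)
qed

lemma square_cases:
  assumes "S \<in> sqs D"
  obtains f g x y where "S = sq f (pr D x) (pr D y) g" "qsq D f g" "src D f = x" "tgt D f = y"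
  using square_sides(3,4)[OF assms] square_qsq[OF assms] that
  by (cases S) simp

lemma qsq_square: "qsq D f g \<Longrightarrow> src D f = x \<Longrightarrow> tgt D f = y \<Longrightarrow> sq f (pr D x) (pr D y) g \<in> sqs D"
  by (auto simp: qsq_def)

lemma commutative_vcomp:
  assumes "commutative_square D (sq t l r m)" "commutative_square D (sq m l' r' b)"
  shows "commutative_square D (sq t (l' \<odot> l) (r' \<odot> r) b)"
proof -
  note s = commutative_squareD[OF assms(1), simplified] and r = commutative_squareD[OF assms(2), simplified]
  have "r' \<odot> (r \<odot> t) = (r' \<odot> m) \<odot> l"
    using s r(1-8) by simp
  also have "\<dots> = b \<odot> (l' \<odot> l)"
    unfolding r(9) using s(1-8) r(1-8) by simp
  finally show ?thesis
    using s r by (simp add: commutative_square_def)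
qed

lemma distinguished_commutative: "distinguished D S \<Longrightarrow> commutative_square D S"
proof (induction rule: distinguished.induct)
  case (distinguished_empty f)
  then show ?case by (simp add: commutative_square_def)
next
  case (distinguished_step S R)
  then show ?case
    using commutative_vcomp[of "top_side S" "left_side S" "right_side S" "bottom_side S"
        "left_side R" "right_side R" "bottom_side R"] square_commutative[of S]
    by (cases S; cases R) (simp add: vcomp_def)
qed

lemma
  assumes "dsq D t l r b"
  shows dsq_arr: "t \<in> arr D" "l \<in> arr D" "r \<in> arr D" "b \<in> arr D"
      "src D t = src D l" "tgt D t = src D r" "tgt D l = src D b" "tgt D r = tgt D b"
    and dsq_comm: "r \<odot> t = b \<odot> l"
  using commutative_squareD[OF distinguished_commutative[OF assms]] by simp_all

lemma dsq_empty: "f \<in> arr D \<Longrightarrow> src D f = x \<Longrightarrow> tgt D f = y \<Longrightarrow> dsq D f (idm D x) (idm D y) f"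
  using distinguished.distinguished_empty[of f D] by simp

lemma dsq_step:
  assumes "qsq D f g" "dsq D g l r b" "src D f = x" "tgt D f = y"
  shows "dsq D f (l \<odot> pr D x) (r \<odot> pr D y) b"
  using distinguished.distinguished_step[OF qsq_square[OF assms(1,3,4)] assms(2)] by (simp add: vcomp_def)

lemma dsq_cases:
  assumes "dsq D t l r b"
  obtains (empty) x y where "t = b" "l = idm D x" "r = idm D y" "x \<in> ob D" "y \<in> ob D"
  | (step) m x y l' r' where "qsq D t m" "src D t = x" "tgt D t = y" "dsq D m l' r' b"
      "l = l' \<odot> pr D x" "r = r' \<odot> pr D y"
  using assms
proof cases
  case (distinguished_empty f)
  then show ?thesis using empty by simp
next
  case (distinguished_step S R)
  obtain f g x y where S: "S = sq f (pr D x) (pr D y) g" "qsq D f g" "src D f = x" "tgt D f = y"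
    using square_cases[OF distinguished_step(2)] .
  have "t = f" "b = bottom_side R" "l = left_side R \<odot> pr D x" "r = right_side R \<odot> pr D y"
    using distinguished_step(1) S(1) by (simp_all add: vcomp_def)
  then show ?thesis using step[of g x y "left_side R" "right_side R"] S distinguished_step(3,4) by (cases R) simp
qed

text \<open>Peels off the topmost layer, like the inductive definition, but in terms of the four
  sides, so that the pasted vertical composites are visible to simplification.\<close>

lemma dsq_induct [consumes 1, case_names empty step]:
  assumes "dsq D t l r b"
    and e: "\<And>f x y. f \<in> arr D \<Longrightarrow> src D f = x \<Longrightarrow> tgt D f = y \<Longrightarrow> P f (idm D x) (idm D y) f"
    and s: "\<And>f g x y l r b. qsq D f g \<Longrightarrow> src D f = x \<Longrightarrow> tgt D f = y \<Longrightarrow> dsq D g l r b \<Longrightarrow>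
      P g l r b \<Longrightarrow> P f (l \<odot> pr D x) (r \<odot> pr D y) b"
  shows "P t l r b"
proof -
  have "P (top_side S) (left_side S) (right_side S) (bottom_side S)" if "distinguished D S" for S
    using that
  proof (induction rule: distinguished.induct)
    case (distinguished_empty f)
    then show ?case using e by simp
  next
    case (distinguished_step S R)
    obtain f g x y where S: "S = sq f (pr D x) (pr D y) g" "qsq D f g" "src D f = x" "tgt D f = y"
      using square_cases[OF distinguished_step(1)] .
    show ?case using s[OF S(2-4), of "left_side R" "right_side R" "bottom_side R"] distinguished_step(2-4) S(1)
      by (cases R) (simp add: vcomp_def)
  qed
  from this[OF assms(1)] show ?thesis by simp
qed

lemma dsq_display: "dsq D t l r b \<Longrightarrow> display_map D l \<and> display_map D r"
proof (induction rule: dsq_induct)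
  case (empty f x y)
  then show ?case by (auto simp: display_map.display_id)
next
  case (step f g x y l r b)
  note q = qsq_sides[OF step(1-3)] and d = dsq_arr[OF step(4)]
  show ?case
    using step(5) q(1-4,11,12) d(5,6) by (intro conjI display_map.display_step) simp_all
qed

lemma dsq_left: "dsq D t l r b \<Longrightarrow> display_map D l"
  and dsq_right: "dsq D t l r b \<Longrightarrow> display_map D r"
  using dsq_display by blast+

lemma qsq_univ:
  assumes "qsq D f g" "src D f = x" "tgt D f = y" "u \<in> arr D" "v \<in> arr D" "src D u = src D v" "tgt D u = src D g"
    "tgt D v = y" "g \<odot> u = pr D y \<odot> v"
  shows "\<exists>!m. m \<in> arr D \<and> src D m = src D u \<and> tgt D m = x \<and> pr D x \<odot> m = u \<and> f \<odot> m = v"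
proof -
  have "pullback_square D (sq f (pr D x) (pr D y) g)"
    using square_pullback[OF qsq_square[OF assms(1-3)]] .
  from pullback_squareD[OF this assms(4-7) _ assms(9)] show ?thesis
    unfolding qsq_sides(9)[OF assms(1-3)] assms(2) using assms(8) by blast
qed

text \<open>Pasting law for pullbacks: a cone on the pasted square factors through the lower
  rectangle, and this factor together with \<open>v\<close> is a cone on the top layer.\<close>

lemma dsq_ex1:
  "dsq D t l r b \<Longrightarrow> u \<in> arr D \<Longrightarrow> v \<in> arr D \<Longrightarrow> src D u = src D v \<Longrightarrow> tgt D u = src D b \<Longrightarrow>
    tgt D v = src D r \<Longrightarrow> b \<odot> u = r \<odot> v \<Longrightarrow>
    \<exists>!m. m \<in> arr D \<and> src D m = src D u \<and> tgt D m = src D t \<and> l \<odot> m = u \<and> t \<odot> m = v"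
proof (induction arbitrary: u v rule: dsq_induct)
  case (empty f x y)
  have x: "x \<in> ob D" "y \<in> ob D" using empty(1-3) by auto
  have "src D (idm D y) = y" using x by simp
  then have "f \<odot> u = v" "tgt D u = x" using empty(2,5,7-9) by simp_all
  then show ?case using x empty(2,4) by (intro ex1I[of _ u]) auto
next
  case (step f g x y l r b)
  note px = qsq_sides[OF step(1-3)] and d = dsq_arr[OF step(4)]
  have v: "pr D y \<odot> v \<in> arr D" "src D (pr D y \<odot> v) = src D v" "tgt D (pr D y \<odot> v) = ft D y"
    "tgt D v = y" "src D r = ft D y"
    using step(7,10) px(8-10,12) d(6) d(3) by simp_all
  then have vr: "b \<odot> u = r \<odot> (pr D y \<odot> v)"
    using step(7,11) px(8-10) d(3) by simp
  have "\<exists>!n. n \<in> arr D \<and> src D n = src D u \<and> tgt D n = src D g \<and> l \<odot> n = u \<and> g \<odot> n = pr D y \<odot> v"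
    using v vr step(6,8,9) d by (intro step.IH) simp_all
  then obtain n where n: "n \<in> arr D" "src D n = src D u" "tgt D n = src D g" "l \<odot> n = u" "g \<odot> n = pr D y \<odot> v"
    and nu: "\<And>n'. n' \<in> arr D \<Longrightarrow> src D n' = src D u \<Longrightarrow> tgt D n' = src D g \<Longrightarrow> l \<odot> n' = u \<Longrightarrow> g \<odot> n' = pr D y \<odot> v \<Longrightarrow> n' = n"
    by blast
  have "\<exists>!m. m \<in> arr D \<and> src D m = src D n \<and> tgt D m = x \<and> pr D x \<odot> m = n \<and> f \<odot> m = v"
    using n v(4) px(11) step(7,8) by (intro qsq_univ[OF step(1-3)]) simp_all
  then obtain m where m: "m \<in> arr D" "src D m = src D n" "tgt D m = x" "pr D x \<odot> m = n" "f \<odot> m = v"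
    and mu: "\<And>m'. m' \<in> arr D \<Longrightarrow> src D m' = src D n \<Longrightarrow> tgt D m' = x \<Longrightarrow> pr D x \<odot> m' = n \<Longrightarrow> f \<odot> m' = v \<Longrightarrow> m' = m"
    by blast
  show ?case
  proof (rule ex1I[of _ m])
    show "m \<in> arr D \<and> src D m = src D u \<and> tgt D m = src D f \<and> (l \<odot> pr D x) \<odot> m = u \<and> f \<odot> m = v"
      using m n px d step(2) by simp
  next
    fix k assume k: "k \<in> arr D \<and> src D k = src D u \<and> tgt D k = src D f \<and> (l \<odot> pr D x) \<odot> k = u \<and> f \<odot> k = v"
    then have k': "k \<in> arr D" "src D k = src D u" "tgt D k = x" using step(2) by auto
    have "g \<odot> (pr D x \<odot> k) = (pr D y \<odot> f) \<odot> k"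
      unfolding px(15) using px(5-8,10-12,14) k' by simp
    also have "\<dots> = pr D y \<odot> v" using k k' px(1-14) step(2,3) by auto
    finally have "g \<odot> (pr D x \<odot> k) = pr D y \<odot> v" .
    moreover have "l \<odot> (pr D x \<odot> k) = u"
      using conjunct1[OF conjunct2[OF conjunct2[OF conjunct2[OF k]]]] k' px(5-7,11) d(2,5) by simp
    ultimately have "pr D x \<odot> k = n" using k' px by (intro nu) simp_all
    then show "k = m" using k k' n by (intro mu) simp_all
  qed
qed

lemma dsq_univ:
  assumes "dsq D t l r b" "u \<in> arr D" "v \<in> arr D" "src D u = src D v" "tgt D u = src D b"
    "tgt D v = src D r" "b \<odot> u = r \<odot> v"
  obtains m where "m \<in> arr D" "src D m = src D u" "tgt D m = src D t" "l \<odot> m = u" "t \<odot> m = v"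
  using dsq_ex1[OF assms] by blast

lemma dsq_cone:
  assumes "dsq D t l r b" "m \<in> arr D" "tgt D m = src D t"
  shows "b \<odot> (l \<odot> m) = r \<odot> (t \<odot> m)"
  using comp_eq[OF dsq_comm[OF assms(1)], of m] dsq_arr[OF assms(1)] assms(2,3) by simp

text \<open>Uniqueness in the universal property, in the form used to compare induced maps: it is
  enough to compare the two projections.\<close>

lemma dsq_mono:
  assumes "dsq D t l r b" "m \<in> arr D" "m' \<in> arr D" "tgt D m = src D t" "tgt D m' = src D t"
    "src D m = src D m'" "l \<odot> m = l \<odot> m'" "t \<odot> m = t \<odot> m'"
  shows "m = m'"
proof -
  note d = dsq_arr[OF assms(1)]
  have "\<exists>!k. k \<in> arr D \<and> src D k = src D (l \<odot> m) \<and> tgt D k = src D t \<and> l \<odot> k = l \<odot> m \<and> t \<odot> k = t \<odot> m"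
    using d dsq_cone[OF assms(1,2,4)] assms(2-6) by (intro dsq_ex1[OF assms(1)]) auto
  moreover have "src D (l \<odot> m) = src D m" using d assms by simp
  ultimately show ?thesis using assms(2-8) by metis
qed

text \<open>\<open>pullback_map\<close> is a definite description and says nothing unless a
  factorisation exists; exhibiting one pins down its value.\<close>

lemma pullback_map_eqI:
  assumes "dsq D t l r b" "m \<in> arr D" "tgt D m = src D t" "l \<odot> m = u" "t \<odot> m = v"
  shows "pullback_map D (sq t l r b) u v = m"
proof -
  note d = dsq_arr[OF assms(1)]
  have u: "src D (l \<odot> m) = src D m" using d assms(2,3) by simp
  have "(THE k. k \<in> hom_set D (src D m) (src D t) \<and> l \<odot> k = l \<odot> m \<and> t \<odot> k = t \<odot> m) = m"
  proof (rule the_equality)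
    fix k assume k: "k \<in> hom_set D (src D m) (src D t) \<and> l \<odot> k = l \<odot> m \<and> t \<odot> k = t \<odot> m"
    then have "k \<in> arr D" "src D k = src D m" "tgt D k = src D t" by (simp_all add: hom_set_def)
    then show "k = m" using k assms(2,3) by - (rule dsq_mono[OF assms(1)]; simp)
  qed (use assms(2,3) in \<open>simp add: hom_set_def\<close>)
  then show ?thesis
    unfolding pullback_map_def corner_def square.select_convs assms(4,5)[symmetric] u .
qed

text \<open>Length decides: the composite starts at \<open>y\<close> and ends at an object of
  smaller length. The alternative \<open>x \<notin> ob D\<close> is there because
  \<open>idm D x\<close> is unspecified off the objects.\<close>

lemma not_display_idm:
  assumes "display_map D r" "y \<in> ob D" "1 \<le> len D y" "src D r = ft D y"
  shows "r \<odot> pr D y \<noteq> idm D x \<or> x \<notin> ob D"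
proof (rule ccontr)
  assume "\<not> ?thesis"
  then have e: "r \<odot> pr D y = idm D x" "x \<in> ob D" by simp_all
  have "src D (r \<odot> pr D y) = y" "tgt D (r \<odot> pr D y) = tgt D r"
    using assms display_arr[OF assms(1)] by simp_all
  then have "y = tgt D r" using e by simp
  then show False using display_len[OF assms(1)] len_ft[OF assms(2,3)] assms(3,4) by simp
qed

lemma qsq_unique:
  assumes "qsq D f g" "qsq D f' g" "tgt D f = tgt D f'"
  shows "f = f'"
proof -
  let ?y = "tgt D f'"
  have a: "?y \<in> ob D" "1 \<le> len D ?y" "g \<in> arr D" "tgt D g = ft D ?y"
    using qsqD[OF assms(2)] by auto
  have "sq f (pr D (src D f)) (pr D ?y) g \<in> sqs D" "sq f' (pr D (src D f')) (pr D ?y) g \<in> sqs D"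
    using qsq_square[OF assms(1) refl assms(3)] qsq_square[OF assms(2) refl refl] by blast+
  then show ?thesis using square_ex1[OF a(1,3,2,4)] by (metis square.select_convs)
qed

text \<open>The right side decomposes into projections \<open>pr\<close> in only one way, so two
  squares over it have matching layers, and uniqueness in each layer applies.\<close>

lemma dsq_unique_aux:
  "dsq D t l r b \<Longrightarrow> dsq D t' l' r b \<Longrightarrow> t' = t \<and> l' = l"
proof (induction arbitrary: t' l' rule: dsq_induct)
  case (empty f x y)
  from empty(4) show ?case
  proof (cases rule: dsq_cases)
    case (empty x' y')
    then show ?thesis using dsq_arr(5,7)[OF \<open>dsq D t' l' (idm D y) f\<close>] \<open>src D f = x\<close> by auto
  next
    case (step m x' y' l'' r'')
    have "r'' \<odot> pr D y' \<noteq> idm D y \<or> y \<notin> ob D"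
      using qsq_sides[OF step(1-3)] dsq_arr[OF step(4)] dsq_right[OF step(4)]
      by (intro not_display_idm) auto
    then show ?thesis using step(6) empty by auto
  qed
next
  case (step f g x y l r b)
  note px = qsq_sides[OF step(1-3)] and d = dsq_arr[OF step(4)]
  have r: "src D (r \<odot> pr D y) = y" "tgt D (r \<odot> pr D y) = tgt D r" using px d by simp_all
  from step(6) show ?case
  proof (cases rule: dsq_cases)
    case (empty x' y')
    have "r \<odot> pr D y \<noteq> idm D y' \<or> y' \<notin> ob D"
      using d px dsq_right[OF step(4)] by (intro not_display_idm) auto
    then show ?thesis using empty by auto
  next
    case s2: (step m x' y' l2 r2)
    note px2 = qsq_sides[OF s2(1-3)] and d2 = dsq_arr[OF s2(4)]
    have r2: "src D (r2 \<odot> pr D y') = y'" "tgt D (r2 \<odot> pr D y') = tgt D r2" using px2 d2 by simp_all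
    have y: "y' = y" and tr: "tgt D r2 = tgt D r"
      using arg_cong[OF s2(6), of "src D", unfolded r r2] arg_cong[OF s2(6), of "tgt D", unfolded r r2] by simp_all
    \<comment> \<open>The remainders of the right side below the top layer are display maps with the
      same ends, hence equal.\<close>
    have "src D r2 = src D r" using d(6) d2(6) px(12) px2(12) y by simp
    then have "r2 = r"
      using display_unique[OF dsq_right[OF s2(4)] dsq_right[OF step(4)]] tr by simp
    then have "m = g" "l2 = l" using step.IH s2(4) by blast+
    moreover have "t' = f"
    proof -
      show ?thesis
        using qsq_unique[of t' g f] s2(1,3) step(1,3) \<open>y' = y\<close> \<open>m = g\<close> by simp
    qed
    ultimately show ?thesis using s2(2,5) step(2) by simp
  qed
qed

lemma dsq_unique:
  assumes "dsq D t l r b" "dsq D t' l' r b" shows "t' = t" "l' = l"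
  using dsq_unique_aux[OF assms] by simp_all

lemma dist_pullback_eq:
  assumes "dsq D t l r b"
  shows "dist_pullback D r b = sq t l r b"
  unfolding dist_pullback_def
proof (rule the_equality)
  show "S = sq t l r b" if "distinguished D S \<and> right_side S = r \<and> bottom_side S = b" for S
    using that dsq_unique_aux[OF assms, of "top_side S" "left_side S"] by (cases S) auto
qed (use assms in simp)

lemma qsq_dsq:
  assumes "qsq D f g"
  shows "dsq D f (pr D (src D f)) (pr D (tgt D f)) g"
proof -
  note q = qsq_sides[OF assms refl refl]
  have "dsq D g (idm D (ft D (src D f))) (idm D (ft D (tgt D f))) g"
    by (rule dsq_empty[OF q(14,11,12)])
  from dsq_step[OF assms this refl refl] show ?thesis
    unfolding idm_left[OF q(5,7)] idm_left[OF q(8,10)] .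
qed

lemma qsq_ex:
  assumes "y \<in> ob D" "1 \<le> len D y" "g \<in> arr D" "tgt D g = ft D y"
  obtains f where "qsq D f g" "tgt D f = y"
proof -
  obtain S where S: "S \<in> sqs D" "right_side S = pr D y" "bottom_side S = g"
    using square_ex1[OF assms(1,3,2,4)] by blast
  obtain f g' x y' where f: "S = sq f (pr D x) (pr D y') g'" "qsq D f g'" "src D f = x" "tgt D f = y'"
    using square_cases[OF S(1)] .
  have "pr D y' = pr D y" "g' = g" using f(1) S(2,3) by simp_all
  moreover from this have "y' = y"
    using src_pr[OF assms(1,2)] qsq_sides(9)[OF f(2-4)] by simp
  ultimately show ?thesis using that[of f] f(2,4) by simp
qed

text \<open>Pull back along the part nearest to the codomain first; the top obtained there is the
  bottom for the layer over \<open>pr D a\<close>.\<close>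

lemma dsq_ex: "display_map D r \<Longrightarrow> b \<in> arr D \<Longrightarrow> tgt D b = tgt D r \<Longrightarrow> \<exists>t l. dsq D t l r b"
proof (induction rule: display_map.induct)
  case (display_id a)
  then show ?case using dsq_empty[of b] by auto
next
  case (display_step g a)
  have g: "g \<in> arr D" using display_step(1) by simp
  then have "tgt D b = tgt D g" using display_step(2-4,7) by simp
  then obtain t l where R: "dsq D t l g b"
    using display_step.IH[OF display_step(6)] by blast
  note d = dsq_arr[OF R]
  obtain f where f: "qsq D f t" "tgt D f = a"
    using qsq_ex[OF display_step(2,3) d(1)] d(6) display_step(4) by auto
  show ?case using dsq_step[OF f(1) R _ f(2)] by blast
qed

lemma dsq_vcomp: "dsq D t l r m \<Longrightarrow> dsq D m l' r' b \<Longrightarrow> dsq D t (l' \<odot> l) (r' \<odot> r) b"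
proof (induction rule: dsq_induct)
  case (empty f x y)
  then show ?case using dsq_arr[OF empty(4)] by simp
next
  case (step f g x y l r m)
  note px = qsq_sides[OF step(1-3)] and d = dsq_arr[OF step(4)] and e = dsq_arr[OF step(6)]
  have "dsq D f ((l' \<odot> l) \<odot> pr D x) ((r' \<odot> r) \<odot> pr D y) b"
    using dsq_step[OF step(1) step.IH[OF step(6)] step(2,3)] .
  then show ?case using px(5-12) d e by simp
qed

lemma qsq_comp:
  assumes "qsq D f g" "qsq D f' g'" "src D f' = tgt D f"
  shows "qsq D (f' \<odot> f) (g' \<odot> g)"
  using square_hcomp[OF qsq_square[OF assms(1) refl refl] qsq_square[OF assms(2) refl refl]]
    qsqD(1)[OF assms(1)] qsqD(1)[OF assms(2)] assms(3)
  by (simp add: hcomp_def qsq_def)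

text \<open>Two squares sharing the side \<open>m\<close> have the same number of layers, so they
  compose layer by layer; the mixed cases are excluded by length.\<close>

lemma dsq_hcomp:
  "dsq D t l m b \<Longrightarrow> dsq D t' m r b' \<Longrightarrow> dsq D (t' \<odot> t) l r (b' \<odot> b)"
proof (induction arbitrary: t' r b' rule: dsq_induct)
  case (empty f x y)
  note e = dsq_arr[OF empty(4)]
  from empty(4) show ?case
  proof (cases rule: dsq_cases)
    case e2: (empty x' y')
    have y: "y \<in> ob D" using empty(1,3) by auto
    have "src D b' = y" using e(7) tgt_idm[OF y] by simp
    moreover have "tgt D b' = y'" using e(6,8) e2(1,3,5) by simp
    ultimately have "dsq D (b' \<odot> f) (idm D x) (idm D y') (b' \<odot> f)"
      using e(4) empty(1-3) by (intro dsq_empty) simp_all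
    then show ?thesis using e2(1,3) by simp
  next
    case (step m x' y' l'' r'')
    have "l'' \<odot> pr D x' \<noteq> idm D y \<or> y \<notin> ob D"
      using qsq_sides[OF step(1-3)] dsq_arr[OF step(4)] dsq_left[OF step(4)]
      by (intro not_display_idm) auto
    then show ?thesis using step(5) empty by auto
  qed
next
  case (step f g x y l m b)
  note px = qsq_sides[OF step(1-3)] and d = dsq_arr[OF step(4)]
  have r: "src D (m \<odot> pr D y) = y" "tgt D (m \<odot> pr D y) = tgt D m" using px d by simp_all
  from step(6) show ?case
  proof (cases rule: dsq_cases)
    case (empty x' y')
    have "m \<odot> pr D y \<noteq> idm D x' \<or> x' \<notin> ob D"
      using d px dsq_right[OF step(4)] by (intro not_display_idm) auto
    then show ?thesis using empty by auto
  next
    case s2: (step g2 x' y' l2 r2)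
    note px2 = qsq_sides[OF s2(1-3)] and d2 = dsq_arr[OF s2(4)]
    have r2: "src D (l2 \<odot> pr D x') = x'" "tgt D (l2 \<odot> pr D x') = tgt D l2" using px2 d2 by simp_all
    have xy: "x' = y" and tr: "tgt D l2 = tgt D m"
      using arg_cong[OF s2(5), of "src D", unfolded r r2] arg_cong[OF s2(5), of "tgt D", unfolded r r2] by simp_all
    have "src D l2 = src D m" using d(6) d2(5) px(12) px2(11) xy by simp
    then have "l2 = m"
      using display_unique[OF dsq_left[OF s2(4)] dsq_right[OF step(4)]] tr by simp
    then have H: "dsq D (g2 \<odot> g) l r2 (b' \<odot> b)" using step.IH[of g2 r2 b'] s2(4) by simp
    have "qsq D (t' \<odot> f) (g2 \<odot> g)"
      using qsq_comp[OF step(1) s2(1)] s2(2) xy step(3) by simp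
    from dsq_step[OF this H, of x y'] show ?thesis using s2(2,3,6) xy step(2,3) px(13) px2(13) by simp
  qed
qed

text \<open>The element of \<open>sqs\<close> over \<open>pr D y\<close> and \<open>g\<close> is
  itself distinguished, so uniqueness of distinguished squares identifies it with the given
  one.\<close>

lemma dsq_qsq:
  assumes "dsq D f l (pr D y) g" "y \<in> ob D" "1 \<le> len D y"
  shows "qsq D f g" "l = pr D (src D f)"
proof -
  note d = dsq_arr[OF assms(1)]
  obtain f' where f: "qsq D f' g" "tgt D f' = y"
    using qsq_ex[OF assms(2,3) d(4)] d(8) assms(2,3) by auto
  have "f' = f" "pr D (src D f') = l"
    by (rule dsq_unique[OF assms(1) qsq_dsq[OF f(1), unfolded f(2)]])+
  then show "qsq D f g" "l = pr D (src D f)" using f(1) by simp_all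
qed

lemma dsq_idm: "display_map D p \<Longrightarrow> src D p = x \<Longrightarrow> tgt D p = y \<Longrightarrow> dsq D (idm D x) p p (idm D y)"
proof (induction arbitrary: x rule: display_map.induct)
  case (display_id a)
  then show ?case using dsq_empty[of "idm D a"] by auto
next
  case (display_step g a)
  have g: "g \<in> arr D" using display_step(1) by simp
  have q: "qsq D (idm D a) (idm D (ft D a))"
    using square_idm[OF display_step(2,3)] display_step(2) by (simp add: qsq_def)
  have e: "x = a" "tgt D g = y" using g display_step(2-4,6,7) by simp_all
  have "dsq D (idm D (ft D a)) g g (idm D y)" by (rule display_step.IH[OF display_step(4) e(2)])
  from dsq_step[OF q this, of a a] show ?case using display_step(2) e(1) by simp
qed

text \<open>Complete \<open>m\<close> and \<open>b\<close> to a distinguished square and paste it to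
  the given right-hand one: uniqueness of the outer square yields the left side, joint monicity the
  top.\<close>

lemma dsq_hcancel:
  assumes "dsq D (t' \<odot> t) l r (b' \<odot> b)" "dsq D t' m r b'"
    "t \<in> arr D" "b \<in> arr D" "src D t = src D l" "tgt D t = src D m" "tgt D b = src D b'" "m \<odot> t = b \<odot> l"
  shows "dsq D t l m b"
proof -
  note R = dsq_arr[OF assms(2)]
  obtain t2 l2 where S: "dsq D t2 l2 m b"
    using dsq_ex[OF dsq_left[OF assms(2)], of b] R assms by auto
  note d = dsq_arr[OF S]
  have e: "t' \<odot> t2 = t' \<odot> t" "l2 = l" using dsq_unique[OF assms(1) dsq_hcomp[OF S assms(2)]] by simp_all
  have "t2 = t"
    using e R d assms dsq_comm[OF S] by - (rule dsq_mono[OF assms(2)]; simp)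
  then show ?thesis using S e by simp
qed

end

section \<open>Contextual functors\<close>

locale contextual_fun = D: contextual_cat D + E: contextual_cat E for D E :: "'u contextual" +
  fixes N :: "('u, 'u, 'u, 'u) fctr"
  assumes contextual_functor: "contextual_functor D E N"
begin

lemma is_functor: "is_functor D E N"
  using contextual_functor by (simp add: contextual_functor_def)

lemma map_arr [simp, intro]: "f \<in> arr D \<Longrightarrow> farr N f \<in> arr E"
  and src_map [simp]: "f \<in> arr D \<Longrightarrow> src E (farr N f) = fob N (src D f)"
  and tgt_map [simp]: "f \<in> arr D \<Longrightarrow> tgt E (farr N f) = fob N (tgt D f)"
  and map_ob [simp, intro]: "x \<in> ob D \<Longrightarrow> fob N x \<in> ob E"
  and map_idm [simp]: "x \<in> ob D \<Longrightarrow> farr N (idm D x) = idm E (fob N x)"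
  and map_comp [simp]: "f \<in> arr D \<Longrightarrow> g \<in> arr D \<Longrightarrow> src D g = tgt D f \<Longrightarrow>
    farr N (g \<odot>\<^bsub>D\<^esub> f) = farr N g \<odot>\<^bsub>E\<^esub> farr N f"
  using is_functor by (auto simp: is_functor_def PiE_iff)

lemma len_map [simp]: "x \<in> ob D \<Longrightarrow> len E (fob N x) = len D x"
  and map_ft: "x \<in> ob D \<Longrightarrow> fob N (ft D x) = ft E (fob N x)"
  and map_pr: "x \<in> ob D \<Longrightarrow> 1 \<le> len D x \<Longrightarrow> farr N (pr D x) = pr E (fob N x)"
  using contextual_functor by (simp_all add: contextual_functor_def)

lemma qsq_map:
  assumes "qsq D f g" shows "qsq E (farr N f) (farr N g)"
proof -
  note q = D.qsq_sides[OF assms refl refl]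
  have "map_square N (sq f (pr D (src D f)) (pr D (tgt D f)) g) \<in> sqs E"
    using contextual_functor D.qsq_square[OF assms refl refl] by (simp add: contextual_functor_def)
  then show ?thesis
    using map_pr[OF q(1,3)] map_pr[OF q(2,4)] q(13) by (simp add: qsq_def map_square_def)
qed

lemma dsq_map: "dsq D t l r b \<Longrightarrow> dsq E (farr N t) (farr N l) (farr N r) (farr N b)"
proof (induction rule: D.dsq_induct)
  case (empty f x y)
  have "x \<in> ob D" "y \<in> ob D" using empty by auto
  then show ?case using E.dsq_empty[of "farr N f" "fob N x" "fob N y"] empty by simp
next
  case (step f g x y l r b)
  note q = D.qsq_sides[OF step(1-3)] and d = D.dsq_arr[OF step(4)]
  have "dsq E (farr N f) (farr N l \<odot>\<^bsub>E\<^esub> pr E (fob N x)) (farr N r \<odot>\<^bsub>E\<^esub> pr E (fob N y)) (farr N b)"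
    using q(13) step(2,3) by (intro E.dsq_step[OF qsq_map[OF step(1)] step(5)]) simp_all
  then show ?case
    using map_pr[OF q(1,3)] map_pr[OF q(2,4)] q(5-8,10-12) d(2,3,5,6) by simp
qed

lemma map_display: "display_map D f \<Longrightarrow> display_map E (farr N f)"
proof (induction rule: display_map.induct)
  case (display_id a)
  then show ?case by (simp add: display_map.display_id)
next
  case (display_step g a)
  have g: "g \<in> arr D" using display_step(1) by simp
  have "display_map E (farr N g \<odot>\<^bsub>E\<^esub> pr E (fob N a))"
    using display_step.IH display_step(2-4) g by (intro display_map.display_step) (simp_all add: map_ft)
  then show ?case using map_pr[OF display_step(2,3)] display_step(2-4) g by simp
qed

lemma map_one_ob [simp]: "fob N (one_ob D) = one_ob E"
  using E.one_ob_unique[of "fob N (one_ob D)"] by simp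

end

lemma contextual_functor_id:
  assumes "contextual_cat D" shows "contextual_functor D D (id_fctr D)"
proof -
  interpret contextual_cat D by fact
  have "map_square (id_fctr D) S = S" if "S \<in> sqs D" for S
    using commutative_squareD[OF square_commutative[OF that]] by (cases S) (simp add: map_square_def id_fctr_def)
  then show ?thesis
    by (auto simp: contextual_functor_def is_functor_def id_fctr_def)
qed

lemma contextual_functor_comp:
  assumes "contextual_cat D" "contextual_cat E" "contextual_cat K"
    "contextual_functor D E N" "contextual_functor E K M"
  shows "contextual_functor D K (comp_fctr D M N)"
proof -
  interpret N: contextual_fun D E N using assms by (simp add: contextual_fun_def contextual_fun_axioms_def)
  interpret M: contextual_fun E K M using assms by (simp add: contextual_fun_def contextual_fun_axioms_def)
  have "map_square (comp_fctr D M N) S = map_square M (map_square N S)" if "S \<in> sqs D" for S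
    using commutative_squareD[OF N.D.square_commutative[OF that]]
    by (simp add: map_square_def comp_fctr_def compose_def)
  then have "map_square (comp_fctr D M N) S \<in> sqs K" if "S \<in> sqs D" for S
    using that N.contextual_functor M.contextual_functor by (simp add: contextual_functor_def)
  then show ?thesis
    by (auto simp: contextual_functor_def is_functor_def comp_fctr_def compose_def N.map_ft M.map_ft N.map_pr M.map_pr)
qed

lemma comp_fctr_arr [simp]: "f \<in> arr D \<Longrightarrow> farr (comp_fctr D M N) f = farr M (farr N f)"
  and comp_fctr_ob [simp]: "x \<in> ob D \<Longrightarrow> fob (comp_fctr D M N) x = fob M (fob N x)"
  by (simp_all add: comp_fctr_def compose_def)

text \<open>Functors are extensional, so they agree off the objects and arrows as well.\<close>

lemma functor_eqI:
  assumes "is_functor D E M" "is_functor D' E' N" "ob D = ob D'" "arr D = arr D'"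
    "\<And>x. x \<in> ob D \<Longrightarrow> fob M x = fob N x" "\<And>f. f \<in> arr D \<Longrightarrow> farr M f = farr N f"
  shows "M = N"
proof -
  have "fob M = fob N"
    using assms unfolding is_functor_def PiE_iff by (intro extensionalityI[of _ "ob D"]) simp_all
  moreover have "farr M = farr N"
    using assms unfolding is_functor_def PiE_iff by (intro extensionalityI[of _ "arr D"]) simp_all
  ultimately show ?thesis by simp
qed

section \<open>Bimorphisms\<close>

locale bifunctor = A: contextual_cat A + B: contextual_cat B + D: contextual_cat D
  for A B :: "'u contextual" and D :: "'u contextual" (structure) +
  fixes H :: "'u bifctr"
  assumes bifunctor: "is_functor (prod_cat A B) D H"
begin

abbreviation Ho where "Ho a b \<equiv> fob H (a, b)"
abbreviation Ha where "Ha f g \<equiv> farr H (f, g)"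

lemma Ho_ob [simp, intro]: "a \<in> ob A \<Longrightarrow> b \<in> ob B \<Longrightarrow> Ho a b \<in> ob D"
  and Ha_arr [simp, intro]: "f \<in> arr A \<Longrightarrow> g \<in> arr B \<Longrightarrow> Ha f g \<in> arr D"
  and src_Ha [simp]: "f \<in> arr A \<Longrightarrow> g \<in> arr B \<Longrightarrow> src D (Ha f g) = Ho (src A f) (src B g)"
  and tgt_Ha [simp]: "f \<in> arr A \<Longrightarrow> g \<in> arr B \<Longrightarrow> tgt D (Ha f g) = Ho (tgt A f) (tgt B g)"
  and Ha_idm [simp]: "a \<in> ob A \<Longrightarrow> b \<in> ob B \<Longrightarrow> Ha (idm A a) (idm B b) = idm D (Ho a b)"
  using bifunctor by (auto simp: is_functor_def prod_cat_def PiE_iff)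

lemma Ha_comp [simp]: "f \<in> arr A \<Longrightarrow> g \<in> arr B \<Longrightarrow> f' \<in> arr A \<Longrightarrow> g' \<in> arr B \<Longrightarrow>
    src A f' = tgt A f \<Longrightarrow> src B g' = tgt B g \<Longrightarrow>
    Ha f' g' \<odot> Ha f g = Ha (f' \<odot>\<^bsub>A\<^esub> f) (g' \<odot>\<^bsub>B\<^esub> g)"
  using bifunctor by (auto simp: is_functor_def prod_cat_def)

text \<open>The law \<open>Ha_comp\<close> inside a right-normalised composite; the two rules
  together let simplification settle every interchange of the variables.\<close>

lemma Ha_comp' [simp]: "f \<in> arr A \<Longrightarrow> g \<in> arr B \<Longrightarrow> f' \<in> arr A \<Longrightarrow> g' \<in> arr B \<Longrightarrow>
    src A f' = tgt A f \<Longrightarrow> src B g' = tgt B g \<Longrightarrow> k \<in> arr D \<Longrightarrow> tgt D k = Ho (src A f) (src B g) \<Longrightarrow>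
    Ha f' g' \<odot> (Ha f g \<odot> k) = Ha (f' \<odot>\<^bsub>A\<^esub> f) (g' \<odot>\<^bsub>B\<^esub> g) \<odot> k"
  by (rule D.comp_eq) simp_all

end

lemma is_functor_prodI:
  assumes "contextual_cat A" "contextual_cat B" "contextual_cat D"
    and "\<And>x y. x \<in> ob A \<Longrightarrow> y \<in> ob B \<Longrightarrow> fob H (x, y) \<in> ob D"
    and "\<And>f g. f \<in> arr A \<Longrightarrow> g \<in> arr B \<Longrightarrow> farr H (f, g) \<in> hom_set D (fob H (src A f, src B g)) (fob H (tgt A f, tgt B g))"
    and "\<And>x y. x \<in> ob A \<Longrightarrow> y \<in> ob B \<Longrightarrow> farr H (idm A x, idm B y) = idm D (fob H (x, y))"
    and "\<And>f g f' g'. f \<in> arr A \<Longrightarrow> g \<in> arr B \<Longrightarrow> f' \<in> arr A \<Longrightarrow> g' \<in> arr B \<Longrightarrow>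
      src A f' = tgt A f \<Longrightarrow> src B g' = tgt B g \<Longrightarrow>
      farr H (f' \<odot>\<^bsub>A\<^esub> f, g' \<odot>\<^bsub>B\<^esub> g) = farr H (f', g') \<odot>\<^bsub>D\<^esub> farr H (f, g)"
    and "fob H \<in> extensional (ob A \<times> ob B)" "farr H \<in> extensional (arr A \<times> arr B)"
  shows "is_functor (prod_cat A B) D H"
  using assms(4-) by (auto simp: is_functor_def prod_cat_def PiE_iff hom_set_def)

text \<open>\<open>tp a b\<close> and \<open>lp a b\<close> are the two projections from the codomain \<open>\<partial>(H(a, b))\<close> of the gap map.\<close>

locale bimorphism_cones = bifunctor A B D H
  for A B :: "'u contextual" and D :: "'u contextual" (structure) and H +
  fixes tp lp :: "'u \<Rightarrow> 'u \<Rightarrow> 'u"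
  assumes Ha_display: "b \<in> ob B \<Longrightarrow> display_map A f \<Longrightarrow> display_map D (Ha f (idm B b))"
    and Ho_one: "a \<in> ob A \<Longrightarrow> b \<in> ob B \<Longrightarrow> len A a = 0 \<or> len B b = 0 \<Longrightarrow> Ho a b = one_ob D"
    and len_Ho: "a \<in> ob A \<Longrightarrow> b \<in> ob B \<Longrightarrow> 1 \<le> len A a \<Longrightarrow> 1 \<le> len B b \<Longrightarrow> 1 \<le> len D (Ho a b)"
    and cone: "a \<in> ob A \<Longrightarrow> b \<in> ob B \<Longrightarrow> 1 \<le> len A a \<Longrightarrow> 1 \<le> len B b \<Longrightarrow>
      dsq D (tp a b) (lp a b) (Ha (pr A a) (idm B (ft B b))) (Ha (idm A (ft A a)) (pr B b))"
    and ft_Ho: "a \<in> ob A \<Longrightarrow> b \<in> ob B \<Longrightarrow> 1 \<le> len A a \<Longrightarrow> 1 \<le> len B b \<Longrightarrow> ft D (Ho a b) = src D (lp a b)"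
    and lp_pr: "a \<in> ob A \<Longrightarrow> b \<in> ob B \<Longrightarrow> 1 \<le> len A a \<Longrightarrow> 1 \<le> len B b \<Longrightarrow>
      lp a b \<odot> pr D (Ho a b) = Ha (pr A a) (idm B b)"
    and tp_pr: "a \<in> ob A \<Longrightarrow> b \<in> ob B \<Longrightarrow> 1 \<le> len A a \<Longrightarrow> 1 \<le> len B b \<Longrightarrow>
      tp a b \<odot> pr D (Ho a b) = Ha (idm A a) (pr B b)"
    and qsq_left: "b \<in> ob B \<Longrightarrow> 1 \<le> len B b \<Longrightarrow> qsq A f' f \<Longrightarrow>
      \<exists>g. qsq D (Ha f' (idm B b)) g \<and>
        lp (tgt A f') b \<odot> g = Ha f (idm B b) \<odot> lp (src A f') b \<and>
        tp (tgt A f') b \<odot> g = Ha f' (idm B (ft B b)) \<odot> tp (src A f') b"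
    and qsq_right: "a \<in> ob A \<Longrightarrow> 1 \<le> len A a \<Longrightarrow> qsq B f' f \<Longrightarrow>
      \<exists>g. qsq D (Ha (idm A a) f') g \<and>
        lp a (tgt B f') \<odot> g = Ha (idm A (ft A a)) f' \<odot> lp a (src B f') \<and>
        tp a (tgt B f') \<odot> g = Ha (idm A a) f \<odot> tp a (src B f')"
begin

lemma
  assumes "a \<in> ob A" "b \<in> ob B" "1 \<le> len A a" "1 \<le> len B b"
  shows lp_arr [simp]: "lp a b \<in> arr D" and src_lp [simp]: "src D (lp a b) = ft D (Ho a b)"
    and tgt_lp [simp]: "tgt D (lp a b) = Ho (ft A a) b"
    and tp_arr [simp]: "tp a b \<in> arr D" and src_tp [simp]: "src D (tp a b) = ft D (Ho a b)"
    and tgt_tp [simp]: "tgt D (tp a b) = Ho a (ft B b)"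
    and pr_Ho_arr [simp]: "pr D (Ho a b) \<in> arr D" and src_pr_Ho [simp]: "src D (pr D (Ho a b)) = Ho a b"
    and tgt_pr_Ho [simp]: "tgt D (pr D (Ho a b)) = ft D (Ho a b)"
proof -
  note d = D.dsq_arr[OF cone[OF assms]]
  show "lp a b \<in> arr D" "src D (lp a b) = ft D (Ho a b)" "tgt D (lp a b) = Ho (ft A a) b"
    "tp a b \<in> arr D" "src D (tp a b) = ft D (Ho a b)" "tgt D (tp a b) = Ho a (ft B b)"
    using d ft_Ho[OF assms] assms by simp_all
  show "pr D (Ho a b) \<in> arr D" "src D (pr D (Ho a b)) = Ho a b" "tgt D (pr D (Ho a b)) = ft D (Ho a b)"
    using len_Ho[OF assms] assms by simp_all
qed

lemma cone_pullback:
  assumes "a \<in> ob A" "b \<in> ob B" "1 \<le> len A a" "1 \<le> len B b"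
  shows "bi_pullback A B D H a b = sq (tp a b) (lp a b) (Ha (pr A a) (idm B (ft B b))) (Ha (idm A (ft A a)) (pr B b))"
  unfolding bi_pullback_def bi_square_def square.select_convs
  by (rule D.dist_pullback_eq[OF cone[OF assms]])

lemma cone_gap:
  assumes "a \<in> ob A" "b \<in> ob B" "1 \<le> len A a" "1 \<le> len B b"
  shows "bi_gap A B D H a b = pr D (Ho a b)"
  using cone_pullback[OF assms] unfolding bi_gap_def gap_map_def bi_pullback_def bi_square_def square.select_convs
  using assms lp_pr[OF assms] tp_pr[OF assms]
  by (simp add: D.pullback_map_eqI[OF cone[OF assms]])

text \<open>With the converse \<open>bimorphism_cones\<close> below, the locale is another form of
  the definition: the gap map is \<open>pr D (Ho a b)\<close>, so the corner of the pullback is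
  \<open>ft D (Ho a b)\<close> and the conditions on gap squares become instances of
  \<open>qsq\<close>.\<close>

lemma bimorphism: "bimorphism A B D H"
proof -
  have "display_map D (Ha f (idm B b))" if "b \<in> ob B" "display_map A f" for b f
    using Ha_display that .
  moreover have "Ho a b = one_ob D" if "b \<in> ob B" "a \<in> ob A" "len A a = 0 \<or> len B b = 0" for a b
    using Ho_one that by blast
  moreover have "Ha f (idm B b) = idm D (one_ob D)" if "b \<in> ob B" "len B b = 0" "f \<in> arr A" for b f
    using that Ho_one[of "src A f" b] Ho_one[of "tgt A f" b] by - (rule D.terminal; simp)
  moreover have "relative_length1_display D (bi_square A B H a b)"
    if "a \<in> ob A" "b \<in> ob B" "1 \<le> len A a" "1 \<le> len B b" for a b
  proof -
    have "gap_map D (bi_square A B H a b) = pr D (Ho a b)"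
      using cone_gap[OF that] by (simp add: bi_gap_def)
    then show ?thesis
      using that len_Ho[OF that] Ha_display[of b "pr A a"] Ha_display[of "ft B b" "pr A a"]
      by (simp add: relative_length1_display_def D.display_length1_pr[simplified]) (simp add: bi_square_def commutative_square_def)
  qed
  moreover have "dsq D (Ha f' (idm B b)) (bi_gap A B D H (src A f') b) (bi_gap A B D H (tgt A f') b)
     (pullback_map D (bi_pullback A B D H (tgt A f') b)
       (Ha f (idm B b) \<odot> left_side (bi_pullback A B D H (src A f') b))
       (Ha f' (idm B (ft B b)) \<odot> top_side (bi_pullback A B D H (src A f') b)))"
    if w: "b \<in> ob B" "qsq A f' f" "1 \<le> len B b" for b f' f
  proof -
    note q = A.qsq_sides[OF w(2) refl refl]
    obtain g where g: "qsq D (Ha f' (idm B b)) g" "lp (tgt A f') b \<odot> g = Ha f (idm B b) \<odot> lp (src A f') b"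
       "tp (tgt A f') b \<odot> g = Ha f' (idm B (ft B b)) \<odot> tp (src A f') b"
      using qsq_left[OF w(1,3,2)] by blast
    note g' = D.qsqD[OF g(1)]
    have "pullback_map D (bi_pullback A B D H (tgt A f') b)
       (Ha f (idm B b) \<odot> lp (src A f') b) (Ha f' (idm B (ft B b)) \<odot> tp (src A f') b) = g"
      unfolding cone_pullback[OF q(2) w(1) q(4) w(3)]
      using g g'(2,6) q w by - (rule D.pullback_map_eqI[OF cone[OF q(2) w(1) q(4) w(3)]]; simp)
    then show ?thesis
      using D.qsq_dsq[OF g(1)] q w
      by (simp add: cone_gap cone_pullback)
  qed
  moreover have "dsq D (Ha (idm A a) f') (bi_gap A B D H a (src B f')) (bi_gap A B D H a (tgt B f'))
     (pullback_map D (bi_pullback A B D H a (tgt B f'))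
       (Ha (idm A (ft A a)) f' \<odot> left_side (bi_pullback A B D H a (src B f')))
       (Ha (idm A a) f \<odot> top_side (bi_pullback A B D H a (src B f'))))"
    if w: "a \<in> ob A" "qsq B f' f" "1 \<le> len A a" for a f' f
  proof -
    note q = B.qsq_sides[OF w(2) refl refl]
    obtain g where g: "qsq D (Ha (idm A a) f') g" "lp a (tgt B f') \<odot> g = Ha (idm A (ft A a)) f' \<odot> lp a (src B f')"
       "tp a (tgt B f') \<odot> g = Ha (idm A a) f \<odot> tp a (src B f')"
      using qsq_right[OF w(1,3,2)] by blast
    note g' = D.qsqD[OF g(1)]
    have "pullback_map D (bi_pullback A B D H a (tgt B f'))
       (Ha (idm A (ft A a)) f' \<odot> lp a (src B f')) (Ha (idm A a) f \<odot> tp a (src B f')) = g"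
      unfolding cone_pullback[OF w(1) q(2) w(3) q(4)]
      using g g'(2,6) q w by - (rule D.pullback_map_eqI[OF cone[OF w(1) q(2) w(3) q(4)]]; simp)
    then show ?thesis
      using D.qsq_dsq[OF g(1)] q w
      by (simp add: cone_gap cone_pullback)
  qed
  ultimately show ?thesis
    unfolding bimorphism_def Let_def using bifunctor A.square_qsq B.square_qsq by auto
qed

end

definition bi_tp where "bi_tp A B D H a b = top_side (bi_pullback A B D H a b)"
definition bi_lp where "bi_lp A B D H a b = left_side (bi_pullback A B D H a b)"

text \<open>The work lies in showing that the definite descriptions in the definition denote: the
  gap map and the bottom maps of the gap squares exist by the universal property of the
  distinguished pullbacks.\<close>

lemma bimorphism_cones:
  assumes "contextual_cat A" "contextual_cat B" "contextual_cat D" "bimorphism A B D H"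
  shows "bimorphism_cones A B D H (bi_tp A B D H) (bi_lp A B D H)"
proof -
  interpret bifunctor A B D H
    using assms by (simp add: bifunctor_def bifunctor_axioms_def bimorphism_def)
  have disp: "display_map D (Ha f (idm B b))" if "b \<in> ob B" "display_map A f" for b f
    using that assms(4) by (simp add: bimorphism_def)
  have one: "Ho a b = one_ob D" if "b \<in> ob B" "a \<in> ob A" "len A a = 0 \<or> len B b = 0" for a b
    using that assms(4) unfolding bimorphism_def by blast
  have gap: "bi_pullback A B D H a b = sq (bi_tp A B D H a b) (bi_lp A B D H a b) (Ha (pr A a) (idm B (ft B b))) (Ha (idm A (ft A a)) (pr B b))
     \<and> dsq D (bi_tp A B D H a b) (bi_lp A B D H a b) (Ha (pr A a) (idm B (ft B b))) (Ha (idm A (ft A a)) (pr B b))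
     \<and> bi_gap A B D H a b = pr D (Ho a b) \<and> 1 \<le> len D (Ho a b) \<and> ft D (Ho a b) = src D (bi_lp A B D H a b)
     \<and> bi_lp A B D H a b \<odot>\<^bsub>D\<^esub> pr D (Ho a b) = Ha (pr A a) (idm B b)
     \<and> bi_tp A B D H a b \<odot>\<^bsub>D\<^esub> pr D (Ho a b) = Ha (idm A a) (pr B b)"
    if ab: "a \<in> ob A" "b \<in> ob B" "1 \<le> len A a" "1 \<le> len B b" for a b
  proof -
    have r: "relative_length1_display D (bi_square A B H a b)"
      using ab assms(4) by (simp add: bimorphism_def)
    have "display_map D (Ha (pr A a) (idm B (ft B b)))" using ab by (intro disp) simp_all
    then obtain t l where tl: "dsq D t l (Ha (pr A a) (idm B (ft B b))) (Ha (idm A (ft A a)) (pr B b))"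
      using D.dsq_ex[of "Ha (pr A a) (idm B (ft B b))" "Ha (idm A (ft A a)) (pr B b)"] ab by auto
    have P: "bi_pullback A B D H a b = sq t l (Ha (pr A a) (idm B (ft B b))) (Ha (idm A (ft A a)) (pr B b))"
      unfolding bi_pullback_def bi_square_def square.select_convs by (rule D.dist_pullback_eq[OF tl])
    have e: "bi_tp A B D H a b = t" "bi_lp A B D H a b = l" by (simp_all add: bi_tp_def bi_lp_def P)
    obtain m where m: "m \<in> arr D" "src D m = src D (Ha (pr A a) (idm B b))" "tgt D m = src D t"
        "l \<odot>\<^bsub>D\<^esub> m = Ha (pr A a) (idm B b)" "t \<odot>\<^bsub>D\<^esub> m = Ha (idm A a) (pr B b)"
      by (rule D.dsq_univ[OF tl, of "Ha (pr A a) (idm B b)" "Ha (idm A a) (pr B b)"]) (use ab in simp_all)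
    have "gap_map D (bi_square A B H a b) = m"
      using P D.pullback_map_eqI[OF tl m(1,3,4,5)]
      unfolding gap_map_def bi_pullback_def bi_square_def square.select_convs by simp
    then have g: "bi_gap A B D H a b = m" "display_map_of_length D 1 m"
      using r by (simp_all add: bi_gap_def relative_length1_display_def)
    have s: "src D m = Ho a b" using m(2) ab by simp
    \<comment> \<open>A display map of length 1 is the projection of its source, which turns the gap
      map into \<open>pr\<close>.\<close>
    have "m = pr D (Ho a b)" "1 \<le> len D (Ho a b)" using D.display_length1[OF g(2)] s by simp_all
    moreover from this have "ft D (Ho a b) = src D l"
      using m(1,3) D.dsq_arr(5)[OF tl] D.tgt_pr[of "Ho a b"] ab by simp
    ultimately show ?thesis using P tl g m e by simp
  qed
  show ?thesis
  proof
    fix b f' f assume q0: "b \<in> ob B" "1 \<le> len B b" "qsq A f' f"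
    note q = A.qsq_sides[OF q0(3) refl refl]
    let ?P1 = "bi_pullback A B D H (src A f') b" and ?P2 = "bi_pullback A B D H (tgt A f') b"
    note g1 = gap[OF q(1) q0(1) q(3) q0(2)] and g2 = gap[OF q(2) q0(1) q(4) q0(2)]
    let ?u = "Ha f (idm B b) \<odot>\<^bsub>D\<^esub> bi_lp A B D H (src A f') b"
    let ?v = "Ha f' (idm B (ft B b)) \<odot>\<^bsub>D\<^esub> bi_tp A B D H (src A f') b"
    let ?g = "pullback_map D ?P2 ?u ?v"
    have ds: "dsq D (Ha f' (idm B b)) (bi_gap A B D H (src A f') b) (bi_gap A B D H (tgt A f') b) ?g"
    proof -
      have "\<forall>b\<in>ob B. \<forall>S\<in>sqs A. 1 \<le> len B b \<longrightarrow>
        (let f' = top_side S; f = bottom_side S; a\<^sub>1 = src A f'; a\<^sub>2 = tgt A f';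
             P\<^sub>1 = bi_pullback A B D H a\<^sub>1 b; P\<^sub>2 = bi_pullback A B D H a\<^sub>2 b
         in distinguished D
              \<lparr>top_side = farr H (f', idm B b),
               left_side = bi_gap A B D H a\<^sub>1 b, right_side = bi_gap A B D H a\<^sub>2 b,
               bottom_side = pullback_map D P\<^sub>2
                 (farr H (f, idm B b) \<odot>\<^bsub>D\<^esub> left_side P\<^sub>1)
                 (farr H (f', idm B (ft B b)) \<odot>\<^bsub>D\<^esub> top_side P\<^sub>1)\<rparr>)"
        using assms(4) unfolding bimorphism_def by blast
      from this[rule_format, OF q0(1) A.qsq_square[OF q0(3) refl refl] q0(2)]
      show ?thesis unfolding Let_def square.select_convs bi_lp_def bi_tp_def .
    qed
    have c1: "dsq D (bi_tp A B D H (src A f') b) (bi_lp A B D H (src A f') b) (Ha (pr A (src A f')) (idm B (ft B b))) (Ha (idm A (ft A (src A f'))) (pr B b))"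
      and c2: "dsq D (bi_tp A B D H (tgt A f') b) (bi_lp A B D H (tgt A f') b) (Ha (pr A (tgt A f')) (idm B (ft B b))) (Ha (idm A (ft A (tgt A f'))) (pr B b))"
      using g1 g2 by blast+
    note d1 = D.dsq_arr[OF c1] and d2 = D.dsq_arr[OF c2]
    have uv: "?u \<in> arr D" "?v \<in> arr D" "src D ?u = src D ?v" "tgt D ?u = Ho (ft A (tgt A f')) b" "tgt D ?v = Ho (tgt A f') (ft B b)"
      using d1 q q0 by simp_all
    \<comment> \<open>The two components must form a cone before \<open>pullback_map\<close> has a
      meaning; this reduces to the commuting cone at the source of \<open>f'\<close>, followed by
      \<open>Ha f (idm B (ft B b))\<close>.\<close>
    have "Ha (idm A (ft A (tgt A f'))) (pr B b) \<odot>\<^bsub>D\<^esub> ?u = Ha f (idm B (ft B b)) \<odot>\<^bsub>D\<^esub> (Ha (idm A (ft A (src A f'))) (pr B b) \<odot>\<^bsub>D\<^esub> bi_lp A B D H (src A f') b)"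
      using d1 q q0 by simp
    also have "\<dots> = Ha (pr A (tgt A f')) (idm B (ft B b)) \<odot>\<^bsub>D\<^esub> ?v"
      unfolding D.dsq_comm[OF c1, symmetric] using d1 q q0 by simp
    finally have c: "Ha (idm A (ft A (tgt A f'))) (pr B b) \<odot>\<^bsub>D\<^esub> ?u = Ha (pr A (tgt A f')) (idm B (ft B b)) \<odot>\<^bsub>D\<^esub> ?v" .
    obtain m where m: "m \<in> arr D" "tgt D m = src D (bi_tp A B D H (tgt A f') b)"
        "bi_lp A B D H (tgt A f') b \<odot>\<^bsub>D\<^esub> m = ?u" "bi_tp A B D H (tgt A f') b \<odot>\<^bsub>D\<^esub> m = ?v"
      by (rule D.dsq_univ[OF c2 uv(1-3) _ _ c]) (use uv(4,5) q q0 in auto)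
    have "?g = m" using g2 D.pullback_map_eqI[OF c2 m] by simp
    then have "dsq D (Ha f' (idm B b)) (pr D (Ho (src A f') b)) (pr D (Ho (tgt A f') b)) m"
      using ds g1 g2 by simp
    from D.dsq_qsq(1)[OF this] have "qsq D (Ha f' (idm B b)) m" using g2 q q0 by simp
    then show "\<exists>g. qsq D (Ha f' (idm B b)) g \<and> bi_lp A B D H (tgt A f') b \<odot>\<^bsub>D\<^esub> g = ?u \<and> bi_tp A B D H (tgt A f') b \<odot>\<^bsub>D\<^esub> g = ?v"
      using m by blast
  next
    fix a f' f assume q0: "a \<in> ob A" "1 \<le> len A a" "qsq B f' f"
    note q = B.qsq_sides[OF q0(3) refl refl]
    let ?P1 = "bi_pullback A B D H a (src B f')" and ?P2 = "bi_pullback A B D H a (tgt B f')"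
    note g1 = gap[OF q0(1) q(1) q0(2) q(3)] and g2 = gap[OF q0(1) q(2) q0(2) q(4)]
    let ?u = "Ha (idm A (ft A a)) f' \<odot>\<^bsub>D\<^esub> bi_lp A B D H a (src B f')"
    let ?v = "Ha (idm A a) f \<odot>\<^bsub>D\<^esub> bi_tp A B D H a (src B f')"
    let ?g = "pullback_map D ?P2 ?u ?v"
    have ds: "dsq D (Ha (idm A a) f') (bi_gap A B D H a (src B f')) (bi_gap A B D H a (tgt B f')) ?g"
    proof -
      have "\<forall>a\<in>ob A. \<forall>S\<in>sqs B. 1 \<le> len A a \<longrightarrow>
        (let f' = top_side S; f = bottom_side S; b\<^sub>1 = src B f'; b\<^sub>2 = tgt B f';
             P\<^sub>1 = bi_pullback A B D H a b\<^sub>1; P\<^sub>2 = bi_pullback A B D H a b\<^sub>2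
         in distinguished D
              \<lparr>top_side = farr H (idm A a, f'),
               left_side = bi_gap A B D H a b\<^sub>1, right_side = bi_gap A B D H a b\<^sub>2,
               bottom_side = pullback_map D P\<^sub>2
                 (farr H (idm A (ft A a), f') \<odot>\<^bsub>D\<^esub> left_side P\<^sub>1)
                 (farr H (idm A a, f) \<odot>\<^bsub>D\<^esub> top_side P\<^sub>1)\<rparr>)"
        using assms(4) unfolding bimorphism_def by blast
      from this[rule_format, OF q0(1) B.qsq_square[OF q0(3) refl refl] q0(2)]
      show ?thesis unfolding Let_def square.select_convs bi_lp_def bi_tp_def .
    qed
    have c1: "dsq D (bi_tp A B D H a (src B f')) (bi_lp A B D H a (src B f')) (Ha (pr A a) (idm B (ft B (src B f')))) (Ha (idm A (ft A a)) (pr B (src B f')))"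
      and c2: "dsq D (bi_tp A B D H a (tgt B f')) (bi_lp A B D H a (tgt B f')) (Ha (pr A a) (idm B (ft B (tgt B f')))) (Ha (idm A (ft A a)) (pr B (tgt B f')))"
      using g1 g2 by blast+
    note d1 = D.dsq_arr[OF c1] and d2 = D.dsq_arr[OF c2]
    have uv: "?u \<in> arr D" "?v \<in> arr D" "src D ?u = src D ?v" "tgt D ?u = Ho (ft A a) (tgt B f')" "tgt D ?v = Ho a (ft B (tgt B f'))"
      using d1 q q0 by simp_all
    have "Ha (idm A (ft A a)) (pr B (tgt B f')) \<odot>\<^bsub>D\<^esub> ?u = Ha (idm A (ft A a)) f \<odot>\<^bsub>D\<^esub> (Ha (idm A (ft A a)) (pr B (src B f')) \<odot>\<^bsub>D\<^esub> bi_lp A B D H a (src B f'))"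
      using d1 q q0 by simp
    also have "\<dots> = Ha (pr A a) (idm B (ft B (tgt B f'))) \<odot>\<^bsub>D\<^esub> ?v"
      unfolding D.dsq_comm[OF c1, symmetric] using d1 q q0 by simp
    finally have c: "Ha (idm A (ft A a)) (pr B (tgt B f')) \<odot>\<^bsub>D\<^esub> ?u = Ha (pr A a) (idm B (ft B (tgt B f'))) \<odot>\<^bsub>D\<^esub> ?v" .
    obtain m where m: "m \<in> arr D" "tgt D m = src D (bi_tp A B D H a (tgt B f'))"
        "bi_lp A B D H a (tgt B f') \<odot>\<^bsub>D\<^esub> m = ?u" "bi_tp A B D H a (tgt B f') \<odot>\<^bsub>D\<^esub> m = ?v"
      by (rule D.dsq_univ[OF c2 uv(1-3) _ _ c]) (use uv(4,5) q q0 in auto)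
    have "?g = m" using g2 D.pullback_map_eqI[OF c2 m] by simp
    then have "dsq D (Ha (idm A a) f') (pr D (Ho a (src B f'))) (pr D (Ho a (tgt B f'))) m"
      using ds g1 g2 by simp
    from D.dsq_qsq(1)[OF this] have "qsq D (Ha (idm A a) f') m" using g2 q q0 by simp
    then show "\<exists>g. qsq D (Ha (idm A a) f') g \<and> bi_lp A B D H a (tgt B f') \<odot>\<^bsub>D\<^esub> g = ?u \<and> bi_tp A B D H a (tgt B f') \<odot>\<^bsub>D\<^esub> g = ?v"
      using m by blast
  qed (use disp one gap in \<open>simp_all only:\<close>)
qed

section \<open>Images of distinguished squares under a bimorphism\<close>

context bimorphism_cones
begin

lemma Ha_one:
  assumes "f \<in> arr A" "g \<in> arr A" "b \<in> ob B" "len B b = 0"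
  shows "Ha f (idm B b) = Ha g (idm B b)"
  using assms by - (rule D.terminal; simp add: Ho_one)

text \<open>Induction on the length of \<open>b\<close>. The image splits into a gap square, an
  element of \<open>sqs\<close>, on top of the square between the projections \<open>lp\<close>. The
  latter arises by cancellation: the cone at \<open>x\<close> pasted to the square for
  \<open>ft B b\<close> also factors through the cone at \<open>y\<close>.\<close>

lemma qsq_Ha_left:
  assumes "qsq A f' f" "src A f' = x" "tgt A f' = y"
  shows "b \<in> ob B \<Longrightarrow>
    dsq D (Ha f' (idm B b)) (Ha (pr A x) (idm B b)) (Ha (pr A y) (idm B b)) (Ha f (idm B b))"
proof (induction "len B b" arbitrary: b)
  case 0
  note q = A.qsq_sides[OF assms]
  have e: "Ha f' (idm B b) = idm D (one_ob D)" "Ha (pr A x) (idm B b) = idm D (one_ob D)"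
    "Ha (pr A y) (idm B b) = idm D (one_ob D)" "Ha f (idm B b) = idm D (one_ob D)"
    using Ha_one[of _ "idm A x" b] q 0 Ho_one[of x b] by simp_all
  show ?case unfolding e by (rule D.dsq_empty) simp_all
next
  case (Suc n)
  note q = A.qsq_sides[OF assms]
  have b: "1 \<le> len B b" using Suc(2) by simp
  have IH: "dsq D (Ha f' (idm B (ft B b))) (Ha (pr A x) (idm B (ft B b))) (Ha (pr A y) (idm B (ft B b))) (Ha f (idm B (ft B b)))"
    using Suc(1)[of "ft B b"] Suc(2,3) B.len_ft[OF Suc(3) b] by simp
  obtain g where g: "qsq D (Ha f' (idm B b)) g" "lp y b \<odot> g = Ha f (idm B b) \<odot> lp x b"
      "tp y b \<odot> g = Ha f' (idm B (ft B b)) \<odot> tp x b"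
    using qsq_left[OF Suc(3) b assms(1)] assms(2,3) by auto
  have src: "src D (Ha f' (idm B b)) = Ho x b" "tgt D (Ha f' (idm B b)) = Ho y b" using q assms Suc(3) by simp_all
  note g' = D.qsq_sides[OF g(1) src]
  have "dsq D (Ha f' (idm B (ft B b)) \<odot> tp x b) (lp x b) (Ha (pr A y) (idm B (ft B b)))
      (Ha f (idm B (ft B b)) \<odot> Ha (idm A (ft A x)) (pr B b))"
    by (rule D.dsq_hcomp[OF cone[OF q(1) Suc(3) q(3) b] IH])
  moreover have "Ha f (idm B (ft B b)) \<odot> Ha (idm A (ft A x)) (pr B b) =
     Ha (idm A (ft A y)) (pr B b) \<odot> Ha f (idm B b)"
    using q b Suc(3) by simp
  ultimately have "dsq D (tp y b \<odot> g) (lp x b) (Ha (pr A y) (idm B (ft B b)))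
      (Ha (idm A (ft A y)) (pr B b) \<odot> Ha f (idm B b))"
    using g(3) by simp
  from D.dsq_hcancel[OF this cone[OF q(2) Suc(3) q(4) b] g'(14)]
  have "dsq D g (lp x b) (lp y b) (Ha f (idm B b))"
    using g(2) g' q b Suc(3) by simp
  from D.dsq_vcomp[OF D.qsq_dsq[OF g(1), unfolded src] this]
  show ?case using lp_pr q b Suc(3) by simp
qed

lemma dsq_Ha_left:
  assumes "b \<in> ob B"
  shows "dsq A t l r m \<Longrightarrow> dsq D (Ha t (idm B b)) (Ha l (idm B b)) (Ha r (idm B b)) (Ha m (idm B b))"
proof (induction rule: A.dsq_induct)
  case (empty f x y)
  have ob: "x \<in> ob A" "y \<in> ob A" using empty by auto
  have "dsq D (Ha f (idm B b)) (idm D (Ho x b)) (idm D (Ho y b)) (Ha f (idm B b))"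
    using empty assms by (intro D.dsq_empty) simp_all
  then show ?case using ob assms by simp
next
  case (step f g x y l r m)
  note q = A.qsq_sides[OF step(1-3)] and d = A.dsq_arr[OF step(4)]
  from D.dsq_vcomp[OF qsq_Ha_left[OF step(1-3) assms] step(5)]
  show ?case using q(5-12) d assms by simp
qed

text \<open>In the second variable the image of an element of \<open>sqs\<close> need not be
  distinguished, since \<open>Ha (idm A a) (pr B x)\<close> need not be a display map. Joint
  monicity survives, by induction on the length of \<open>a\<close>: the induction hypothesis
  settles the component through \<open>lp\<close>, the assumption the one through \<open>tp\<close>,
  hence the map into \<open>ft D (Ho a x)\<close> is settled, and the gap square does the
  rest.\<close>

lemma qsq_Ha_right_mono:
  assumes "qsq B f' f" "src B f' = x" "tgt B f' = y"
  shows "a \<in> ob A \<Longrightarrow> m \<in> arr D \<Longrightarrow> m' \<in> arr D \<Longrightarrow> src D m = src D m' \<Longrightarrow> tgt D m = Ho a x \<Longrightarrow>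
    tgt D m' = Ho a x \<Longrightarrow> Ha (idm A a) (pr B x) \<odot> m = Ha (idm A a) (pr B x) \<odot> m' \<Longrightarrow>
    Ha (idm A a) f' \<odot> m = Ha (idm A a) f' \<odot> m' \<Longrightarrow> m = m'"
proof (induction "len A a" arbitrary: a m m')
  case 0
  note q = B.qsq_sides[OF assms]
  show ?case using 0 q Ho_one[of a x] by - (rule D.terminal; simp)
next
  case (Suc n)
  note q = B.qsq_sides[OF assms]
  have a: "1 \<le> len A a" using Suc(2) by simp
  note ob = Suc(3)
  obtain g where g: "qsq D (Ha (idm A a) f') g"
    using qsq_right[OF ob a assms(1)] by auto
  have src: "src D (Ha (idm A a) f') = Ho a x" "tgt D (Ha (idm A a) f') = Ho a y" using q assms ob by simp_all
  have l: "Ha (idm A (ft A a)) (pr B x) \<odot> (Ha (pr A a) (idm B x) \<odot> k) = Ha (pr A a) (idm B (ft B x)) \<odot> (Ha (idm A a) (pr B x) \<odot> k)"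
    "Ha (idm A (ft A a)) f' \<odot> (Ha (pr A a) (idm B x) \<odot> k) = Ha (pr A a) (idm B y) \<odot> (Ha (idm A a) f' \<odot> k)"
    if "k \<in> arr D" "tgt D k = Ho a x" for k
    using that q assms ob a by simp_all
  have "Ha (pr A a) (idm B x) \<odot> m = Ha (pr A a) (idm B x) \<odot> m'"
  proof (rule Suc(1))
    show "Ha (idm A (ft A a)) (pr B x) \<odot> (Ha (pr A a) (idm B x) \<odot> m) = Ha (idm A (ft A a)) (pr B x) \<odot> (Ha (pr A a) (idm B x) \<odot> m')"
      unfolding l(1)[OF Suc(4,7)] l(1)[OF Suc(5,8)] Suc(9) ..
    show "Ha (idm A (ft A a)) f' \<odot> (Ha (pr A a) (idm B x) \<odot> m) = Ha (idm A (ft A a)) f' \<odot> (Ha (pr A a) (idm B x) \<odot> m')"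
      unfolding l(2)[OF Suc(4,7)] l(2)[OF Suc(5,8)] Suc(10) ..
  qed (use Suc(2,4-8) ob a q A.len_ft[OF ob a] in simp_all)
  then have lp: "lp a x \<odot> (pr D (Ho a x) \<odot> m) = lp a x \<odot> (pr D (Ho a x) \<odot> m')"
    using D.comp_eq[OF lp_pr[OF ob q(1) a q(3)]] Suc(4-8) ob a q by simp
  have tp: "tp a x \<odot> (pr D (Ho a x) \<odot> m) = tp a x \<odot> (pr D (Ho a x) \<odot> m')"
    using D.comp_eq[OF tp_pr[OF ob q(1) a q(3)]] Suc(4-9) ob a q by simp
  have "pr D (Ho a x) \<odot> m = pr D (Ho a x) \<odot> m'"
    using lp tp Suc(4-8) ob a q by - (rule D.dsq_mono[OF cone[OF ob q(1) a q(3)]]; simp)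
  then show ?case
    using Suc(4-8,10) ob a q src by - (rule D.dsq_mono[OF D.qsq_dsq[OF g, unfolded src]]; simp)
qed

text \<open>The gap map of \<open>H\<close> at \<open>pr A a\<close> and a display map
  \<open>q\<close> of any length in place of a single \<open>pr B b\<close>; \<open>t\<close> and
  \<open>l\<close> are the projections from the pullback. The vertical sides of the cones in a
  tensor product are display maps of this general kind.\<close>

definition gen_gap where
  "gen_gap a q t l \<gamma> \<longleftrightarrow>
    dsq D t l (Ha (pr A a) (idm B (tgt B q))) (Ha (idm A (ft A a)) q) \<and>
    display_map D \<gamma> \<and> tgt D \<gamma> = src D t \<and> src D \<gamma> = Ho a (src B q) \<and>
    l \<odot> \<gamma> = Ha (pr A a) (idm B (src B q)) \<and> t \<odot> \<gamma> = Ha (idm A a) q"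

text \<open>Pulling back along \<open>r\<close> and then along \<open>pr B x\<close> gives the
  projections for the longer map. Its gap map is \<open>pr D (Ho a x)\<close> followed by the
  pullback \<open>l'\<close> of the old gap map.\<close>

lemma gen_gap_step:
  assumes "gen_gap a r t l \<gamma>" "a \<in> ob A" "1 \<le> len A a" "x \<in> ob B" "1 \<le> len B x" "r \<in> arr B" "src B r = ft B x"
  obtains tt ll l' where "dsq D tt ll l (Ha (idm A (ft A a)) (pr B x))" "dsq D (tp a x) l' \<gamma> tt"
    "lp a x = ll \<odot> l'" "gen_gap a (r \<odot>\<^bsub>B\<^esub> pr B x) (t \<odot> tt) ll (l' \<odot> pr D (Ho a x))"
proof -
  note G = assms(1)[unfolded gen_gap_def]
  have U: "dsq D t l (Ha (pr A a) (idm B (tgt B r))) (Ha (idm A (ft A a)) r)"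
    and disp: "display_map D \<gamma>" and \<gamma>: "tgt D \<gamma> = src D t" "src D \<gamma> = Ho a (src B r)"
    and l\<gamma>: "l \<odot> \<gamma> = Ha (pr A a) (idm B (ft B x))" and t\<gamma>: "t \<odot> \<gamma> = Ha (idm A a) r"
    using G assms(7) by auto
  note d = D.dsq_arr[OF U]
  note as = assms(2,4,3,5)
  have "tgt D (Ha (idm A (ft A a)) (pr B x)) = tgt D l" using d(7) assms by simp
  then obtain tt ll where B2: "dsq D tt ll l (Ha (idm A (ft A a)) (pr B x))"
    using D.dsq_ex[OF D.dsq_left[OF U], of "Ha (idm A (ft A a)) (pr B x)"] assms by auto
  note d2 = D.dsq_arr[OF B2]
  obtain t' l' where B1: "dsq D t' l' \<gamma> tt"
    using D.dsq_ex[OF disp d2(1)] d2(6) \<gamma>(1) d(5) by auto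
  note d1 = D.dsq_arr[OF B1]
  \<comment> \<open>Since \<open>l \<odot> \<gamma>\<close> is
    \<open>Ha (pr A a) (idm B (ft B x))\<close>, the two pullbacks stacked on each other are the
    cone at \<open>a\<close> and \<open>x\<close>.\<close>
  have "dsq D t' (ll \<odot> l') (Ha (pr A a) (idm B (ft B x))) (Ha (idm A (ft A a)) (pr B x))"
    using D.dsq_vcomp[OF B1 B2] l\<gamma> by simp
  from D.dsq_unique[OF cone[OF as] this] have e: "t' = tp a x" "lp a x = ll \<odot> l'" by simp_all
  have "gen_gap a (r \<odot>\<^bsub>B\<^esub> pr B x) (t \<odot> tt) ll (l' \<odot> pr D (Ho a x))"
    unfolding gen_gap_def
  proof (intro conjI)
    show "dsq D (t \<odot> tt) ll (Ha (pr A a) (idm B (tgt B (r \<odot>\<^bsub>B\<^esub> pr B x)))) (Ha (idm A (ft A a)) (r \<odot>\<^bsub>B\<^esub> pr B x))"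
      using D.dsq_hcomp[OF B2 U] assms by simp
    have s: "src D l' = ft D (Ho a x)" using d1(5) e(1) as by simp
    show "display_map D (l' \<odot> pr D (Ho a x))"
      using D.dsq_left[OF B1] as len_Ho[OF as] s by (intro D.display_comp) simp_all
    show "tgt D (l' \<odot> pr D (Ho a x)) = src D (t \<odot> tt)"
      using d d1 d2 s as by simp
    show "src D (l' \<odot> pr D (Ho a x)) = Ho a (src B (r \<odot>\<^bsub>B\<^esub> pr B x))"
      using d1 s assms by simp
    have "ll \<odot> (l' \<odot> pr D (Ho a x)) = lp a x \<odot> pr D (Ho a x)"
      unfolding e(2) using d1 d2 s as by simp
    then show "ll \<odot> (l' \<odot> pr D (Ho a x)) = Ha (pr A a) (idm B (src B (r \<odot>\<^bsub>B\<^esub> pr B x)))"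
      using lp_pr[OF as] assms by simp
    have "(t \<odot> tt) \<odot> (l' \<odot> pr D (Ho a x)) = t \<odot> ((tt \<odot> l') \<odot> pr D (Ho a x))"
      using d d1 d2 s as by simp
    also have "\<dots> = (t \<odot> \<gamma>) \<odot> (tp a x \<odot> pr D (Ho a x))"
      unfolding D.dsq_comm[OF B1, symmetric] e(1) using d d1[unfolded e(1)] d2 as disp \<gamma> assms(7) by simp
    also have "\<dots> = Ha (idm A a) (r \<odot>\<^bsub>B\<^esub> pr B x)"
      unfolding t\<gamma> tp_pr[OF as] using assms by simp
    finally show "(t \<odot> tt) \<odot> (l' \<odot> pr D (Ho a x)) = Ha (idm A a) (r \<odot>\<^bsub>B\<^esub> pr B x)" .
  qed
  then show thesis using that B2 B1 e by simp
qed

text \<open>Takes the place of preservation of distinguished squares in the second variable. Each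
  layer contributes a gap square of \<open>H\<close>, below which lies the square of the previous
  layers, pulled back to the larger pullbacks.\<close>

lemma gen_gap_dsq:
  assumes "a \<in> ob A" "1 \<le> len A a"
  shows "dsq B t l r m \<Longrightarrow> \<exists>t1 l1 \<gamma>1 t2 l2 \<gamma>2 u. gen_gap a l t1 l1 \<gamma>1 \<and> gen_gap a r t2 l2 \<gamma>2 \<and>
     dsq D (Ha (idm A a) t) \<gamma>1 \<gamma>2 u \<and> l2 \<odot> u = Ha (idm A (ft A a)) t \<odot> l1 \<and>
     t2 \<odot> u = Ha (idm A a) m \<odot> t1"
proof (induction rule: B.dsq_induct)
  case (empty f x y)
  have ob: "x \<in> ob B" "y \<in> ob B" using empty by auto
  have g: "gen_gap a (idm B z) (idm D (Ho a z)) (Ha (pr A a) (idm B z)) (idm D (Ho a z))" if "z \<in> ob B" for z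
  proof -
    have "dsq D (idm D (Ho a z)) (Ha (pr A a) (idm B z)) (Ha (pr A a) (idm B z)) (idm D (Ho (ft A a) z))"
      using that assms Ha_display[of z "pr A a"] by (intro D.dsq_idm) simp_all
    then show ?thesis using that assms by (simp add: gen_gap_def display_map.display_id)
  qed
  have "dsq D (Ha (idm A a) f) (idm D (Ho a x)) (idm D (Ho a y)) (Ha (idm A a) f)"
    using empty assms by (intro D.dsq_empty) simp_all
  then have "gen_gap a (idm B x) (idm D (Ho a x)) (Ha (pr A a) (idm B x)) (idm D (Ho a x)) \<and>
     gen_gap a (idm B y) (idm D (Ho a y)) (Ha (pr A a) (idm B y)) (idm D (Ho a y)) \<and>
     dsq D (Ha (idm A a) f) (idm D (Ho a x)) (idm D (Ho a y)) (Ha (idm A a) f) \<and>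
     Ha (pr A a) (idm B y) \<odot> Ha (idm A a) f = Ha (idm A (ft A a)) f \<odot> Ha (pr A a) (idm B x) \<and>
     idm D (Ho a y) \<odot> Ha (idm A a) f = Ha (idm A a) f \<odot> idm D (Ho a x)"
    using g ob empty assms by simp
  then show ?case by blast
next
  case (step f g x y l r m)
  note q = B.qsq_sides[OF step(1-3)] and d = B.dsq_arr[OF step(4)]
  obtain t1 l1 \<gamma>1 t2 l2 \<gamma>2 u where G1: "gen_gap a l t1 l1 \<gamma>1" and G2: "gen_gap a r t2 l2 \<gamma>2"
    and U: "dsq D (Ha (idm A a) g) \<gamma>1 \<gamma>2 u" "l2 \<odot> u = Ha (idm A (ft A a)) g \<odot> l1"
     "t2 \<odot> u = Ha (idm A a) m \<odot> t1"
    using step(5) by blast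
  have sl: "src B l = ft B x" "src B r = ft B y" using d(5,6) q(11,12) by simp_all
  obtain tt1 ll1 k1 where S1: "dsq D tt1 ll1 l1 (Ha (idm A (ft A a)) (pr B x))" "dsq D (tp a x) k1 \<gamma>1 tt1"
    "lp a x = ll1 \<odot> k1" "gen_gap a (l \<odot>\<^bsub>B\<^esub> pr B x) (t1 \<odot> tt1) ll1 (k1 \<odot> pr D (Ho a x))"
    using gen_gap_step[OF G1 assms q(1,3) d(2) sl(1)] by metis
  obtain tt2 ll2 k2 where S2: "dsq D tt2 ll2 l2 (Ha (idm A (ft A a)) (pr B y))" "dsq D (tp a y) k2 \<gamma>2 tt2"
    "lp a y = ll2 \<odot> k2" "gen_gap a (r \<odot>\<^bsub>B\<^esub> pr B y) (t2 \<odot> tt2) ll2 (k2 \<odot> pr D (Ho a y))"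
    using gen_gap_step[OF G2 assms q(2,4) d(3) sl(2)] by metis
  obtain h where h: "qsq D (Ha (idm A a) f) h" "lp a y \<odot> h = Ha (idm A (ft A a)) f \<odot> lp a x"
    "tp a y \<odot> h = Ha (idm A a) g \<odot> tp a x"
    using qsq_right[OF assms step(1)] step(2,3) by auto
  have src: "src D (Ha (idm A a) f) = Ho a x" "tgt D (Ha (idm A a) f) = Ho a y" using q step(2,3) assms by simp_all
  note h' = D.qsq_sides[OF h(1) src]
  note as1 = assms(1) q(1) assms(2) q(3) and as2 = assms(1) q(2) assms(2) q(4)
  note dU = D.dsq_arr[OF U(1)] and d11 = D.dsq_arr[OF S1(1)] and d12 = D.dsq_arr[OF S1(2)]
    and d21 = D.dsq_arr[OF S2(1)] and d22 = D.dsq_arr[OF S2(2)]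
  note g1 = G1[unfolded gen_gap_def, THEN conjunct1, THEN D.dsq_arr(1)] G1[unfolded gen_gap_def, THEN conjunct1, THEN D.dsq_arr(5)]
    G1[unfolded gen_gap_def, THEN conjunct1, THEN D.dsq_arr(6)]
  note g2 = G2[unfolded gen_gap_def, THEN conjunct1, THEN D.dsq_arr(1)] G2[unfolded gen_gap_def, THEN conjunct1, THEN D.dsq_arr(5)]
    G2[unfolded gen_gap_def, THEN conjunct1, THEN D.dsq_arr(6)]
  have t\<gamma>: "tgt D \<gamma>1 = src D l1" "tgt D \<gamma>2 = src D l2"
    using G1 G2 g1(2) g2(2) by (simp_all add: gen_gap_def)
  have su: "src D u = src D l1" "tgt D u = src D l2"
    using dU(7,8) t\<gamma> by simp_all
  have tl: "tgt D l1 = Ho (ft A a) (ft B x)" "tgt D l2 = Ho (ft A a) (ft B y)"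
    "tgt D ll1 = Ho (ft A a) x" "tgt D ll2 = Ho (ft A a) y"
    using d11(7,8) d21(7,8) q assms by simp_all
  have "Ha (idm A (ft A a)) (pr B y) \<odot> (Ha (idm A (ft A a)) f \<odot> ll1)
     = Ha (idm A (ft A a)) g \<odot> (Ha (idm A (ft A a)) (pr B x) \<odot> ll1)"
    using q step(2,3) assms d11(2) tl by simp
  also have "\<dots> = (l2 \<odot> u) \<odot> tt1"
    unfolding D.dsq_comm[OF S1(1), symmetric] U(2) using d11 tl q assms by simp
  also have "\<dots> = l2 \<odot> (u \<odot> tt1)"
    using d11 d21 dU su by simp
  finally have c: "Ha (idm A (ft A a)) (pr B y) \<odot> (Ha (idm A (ft A a)) f \<odot> ll1) = l2 \<odot> (u \<odot> tt1)" .
  \<comment> \<open>The map between the pullbacks along the longer vertical sides; its cone commutes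
    by the equation for \<open>l2 \<odot>\<u>\<close>, which is part of the induction
    hypothesis.\<close>
  obtain v where v: "v \<in> arr D" "src D v = src D (Ha (idm A (ft A a)) f \<odot> ll1)" "tgt D v = src D tt2"
     "ll2 \<odot> v = Ha (idm A (ft A a)) f \<odot> ll1" "tt2 \<odot> v = u \<odot> tt1"
    by (rule D.dsq_univ[OF S2(1) _ _ _ _ _ c]) (use d11 d21 dU su tl q step(2,3) assms in simp_all)
  have sv: "src D v = src D ll1" "tgt D v = src D ll2"
    using v(2,3) tl d11(2) d21(5) q step(2,3) assms by simp_all
  have sk: "src D k1 = ft D (Ho a x)" "src D k2 = ft D (Ho a y)" "tgt D k1 = src D ll1" "tgt D k2 = src D ll2"
    using d12(5,7) d22(5,7) d11(5) d21(5) as1 as2 by simp_all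
  \<comment> \<open>Commutativity of the square to be split off, required for the cancellation
    below; it is tested on the projections \<open>ll2\<close> and \<open>tt2\<close>.\<close>
  have kh: "k2 \<odot> h = v \<odot> k1"
  proof (rule D.dsq_mono[OF S2(1)])
    have "ll2 \<odot> (k2 \<odot> h) = lp a y \<odot> h"
      unfolding S2(3) using d21 d22 sk h' by simp
    also have "\<dots> = (Ha (idm A (ft A a)) f \<odot> ll1) \<odot> k1"
      unfolding h(2) S1(3) using d11 d12 sk tl q step(2,3) assms by simp
    also have "\<dots> = ll2 \<odot> (v \<odot> k1)"
      unfolding v(4)[symmetric] using d12(2) d21(2) v(1) sv sk by simp
    finally show "ll2 \<odot> (k2 \<odot> h) = ll2 \<odot> (v \<odot> k1)" .
    have "tt2 \<odot> (k2 \<odot> h) = (\<gamma>2 \<odot> tp a y) \<odot> h"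
      unfolding D.dsq_comm[OF S2(2)] using d21 d22 sk h' by simp
    also have "\<dots> = \<gamma>2 \<odot> (Ha (idm A a) g \<odot> tp a x)"
      unfolding h(3)[symmetric] using d22(3,6) h' as2 by simp
    also have "\<dots> = (\<gamma>2 \<odot> Ha (idm A a) g) \<odot> tp a x"
      using d22(3) dU(6) q as1 by simp
    also have "\<dots> = u \<odot> (\<gamma>1 \<odot> tp a x)"
      unfolding D.dsq_comm[OF U(1)] using d12(1,3,6) dU(2,4,7) as1 by simp
    also have "\<dots> = (u \<odot> tt1) \<odot> k1"
      unfolding D.dsq_comm[OF S1(2)] using d12(2,4) d12(7) dU(4) d11(1,5,6) su sk by simp
    also have "\<dots> = tt2 \<odot> (v \<odot> k1)"
      unfolding v(5)[symmetric] using v(1,3) d21(1) d12(2) sk sv by simp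
    finally show "tt2 \<odot> (k2 \<odot> h) = tt2 \<odot> (v \<odot> k1)" .
  qed (use d12(2) d22(2) d21(5) h' v(1) sv sk in simp_all)
  \<comment> \<open>The pullback square for \<open>x\<close> pasted to the induction hypothesis.
    Cancelling the pullback square for \<open>y\<close> leaves a square with top \<open>h\<close>,
    which fits under the gap square.\<close>
  have "dsq D (tp a y \<odot> h) k1 \<gamma>2 (tt2 \<odot> v)"
    unfolding v(5) h(3) by (rule D.dsq_hcomp[OF S1(2) U(1)])
  from D.dsq_hcancel[OF this S2(2) h'(14) v(1)]
  have "dsq D h k1 k2 v"
    using h' sk v(3) kh by simp
  from D.dsq_vcomp[OF D.qsq_dsq[OF h(1), unfolded src] this]
  have F: "dsq D (Ha (idm A a) f) (k1 \<odot> pr D (Ho a x)) (k2 \<odot> pr D (Ho a y)) v" .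
  have "(t2 \<odot> tt2) \<odot> v = t2 \<odot> (u \<odot> tt1)"
    unfolding v(5)[symmetric] using v(1,3) d21(1,6) g2 by simp
  also have "\<dots> = (t2 \<odot> u) \<odot> tt1"
    using d11(1,6) dU(4) su g2 by simp
  also have "\<dots> = Ha (idm A a) m \<odot> (t1 \<odot> tt1)"
    unfolding U(3) using d11(1,6) g1 assms d by simp
  finally have "(t2 \<odot> tt2) \<odot> v = Ha (idm A a) m \<odot> (t1 \<odot> tt1)" .
  then show ?case using S1(4) S2(4) F v(4) by blast
qed

end

text \<open>A contextual functor preserves distinguished squares, so the images of \<open>tp\<close>
  and \<open>lp\<close> serve as projections. To allow this choice the projections are parameters of
  the locale and not values of \<open>dist_pullback\<close>.\<close>

lemma bimorphism_cones_postcomp: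
  assumes "bimorphism_cones A B D H tp lp" "contextual_fun D E N"
  shows "bimorphism_cones A B E (comp_fctr (prod_cat A B) N H) (\<lambda>a b. farr N (tp a b)) (\<lambda>a b. farr N (lp a b))"
proof -
  interpret bimorphism_cones A B D H tp lp by fact
  interpret N: contextual_fun D E N by fact
  have s: "f \<in> arr A \<Longrightarrow> g \<in> arr B \<Longrightarrow> farr (comp_fctr (prod_cat A B) N H) (f, g) = farr N (Ha f g)"
    "a \<in> ob A \<Longrightarrow> b \<in> ob B \<Longrightarrow> fob (comp_fctr (prod_cat A B) N H) (a, b) = fob N (Ho a b)" for f g a b
    by (simp_all add: comp_fctr_def prod_cat_def compose_def)
  show ?thesis
  proof
    show "is_functor (prod_cat A B) E (comp_fctr (prod_cat A B) N H)"
    proof (rule is_functor_prodI[OF A.contextual_cat_axioms B.contextual_cat_axioms N.E.contextual_cat_axioms])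
      show "fob (comp_fctr (prod_cat A B) N H) \<in> extensional (ob A \<times> ob B)"
        "farr (comp_fctr (prod_cat A B) N H) \<in> extensional (arr A \<times> arr B)"
        by (simp_all add: comp_fctr_def prod_cat_def compose_extensional)
      show "farr (comp_fctr (prod_cat A B) N H) (f' \<odot>\<^bsub>A\<^esub> f, g' \<odot>\<^bsub>B\<^esub> g) = farr (comp_fctr (prod_cat A B) N H) (f', g') \<odot>\<^bsub>E\<^esub> farr (comp_fctr (prod_cat A B) N H) (f, g)"
        if "f \<in> arr A" "g \<in> arr B" "f' \<in> arr A" "g' \<in> arr B" "src A f' = tgt A f" "src B g' = tgt B g" for f g f' g'
        using that by (simp add: s del: Ha_comp N.map_comp) (simp add: N.map_comp[symmetric] del: N.map_comp)
    qed (simp_all add: s hom_set_def)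
  next
    fix a b assume ab: "a \<in> ob A" "b \<in> ob B" "1 \<le> len A a" "1 \<le> len B b"
    note p = N.map_pr[OF Ho_ob[OF ab(1,2)] len_Ho[OF ab], symmetric]
    show "1 \<le> len E (fob (comp_fctr (prod_cat A B) N H) (a, b))" using ab len_Ho[OF ab] by (simp add: s)
    show "dsq E (farr N (tp a b)) (farr N (lp a b)) (farr (comp_fctr (prod_cat A B) N H) (pr A a, idm B (ft B b)))
        (farr (comp_fctr (prod_cat A B) N H) (idm A (ft A a), pr B b))"
      using N.dsq_map[OF cone[OF ab]] ab by (simp add: s)
    show "ft E (fob (comp_fctr (prod_cat A B) N H) (a, b)) = src E (farr N (lp a b))"
      using ab by (simp add: s N.map_ft)
    show "farr N (lp a b) \<odot>\<^bsub>E\<^esub> pr E (fob (comp_fctr (prod_cat A B) N H) (a, b)) = farr (comp_fctr (prod_cat A B) N H) (pr A a, idm B b)"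
      using ab arg_cong[OF lp_pr[OF ab], of "farr N"] by (simp add: s p)
    show "farr N (tp a b) \<odot>\<^bsub>E\<^esub> pr E (fob (comp_fctr (prod_cat A B) N H) (a, b)) = farr (comp_fctr (prod_cat A B) N H) (idm A a, pr B b)"
      using ab arg_cong[OF tp_pr[OF ab], of "farr N"] by (simp add: s p)
  next
    fix b f' f assume b: "b \<in> ob B" "1 \<le> len B b" "qsq A f' f"
    note q = A.qsq_sides[OF b(3) refl refl]
    obtain g where g: "qsq D (Ha f' (idm B b)) g" "lp (tgt A f') b \<odot>\<^bsub>D\<^esub> g = Ha f (idm B b) \<odot>\<^bsub>D\<^esub> lp (src A f') b"
      "tp (tgt A f') b \<odot>\<^bsub>D\<^esub> g = Ha f' (idm B (ft B b)) \<odot>\<^bsub>D\<^esub> tp (src A f') b"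
      using qsq_left[OF b] by blast
    note g' = D.qsqD[OF g(1)]
    show "\<exists>g. qsq E (farr (comp_fctr (prod_cat A B) N H) (f', idm B b)) g \<and>
        farr N (lp (tgt A f') b) \<odot>\<^bsub>E\<^esub> g = farr (comp_fctr (prod_cat A B) N H) (f, idm B b) \<odot>\<^bsub>E\<^esub> farr N (lp (src A f') b) \<and>
        farr N (tp (tgt A f') b) \<odot>\<^bsub>E\<^esub> g = farr (comp_fctr (prod_cat A B) N H) (f', idm B (ft B b)) \<odot>\<^bsub>E\<^esub> farr N (tp (src A f') b)"
      using N.qsq_map[OF g(1)] arg_cong[OF g(2), of "farr N"] arg_cong[OF g(3), of "farr N"] g'(2,6) q b(1,2)
      by (intro exI[of _ "farr N g"]) (simp add: s)
  next
    fix a f' f assume a: "a \<in> ob A" "1 \<le> len A a" "qsq B f' f"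
    note q = B.qsq_sides[OF a(3) refl refl]
    obtain g where g: "qsq D (Ha (idm A a) f') g" "lp a (tgt B f') \<odot>\<^bsub>D\<^esub> g = Ha (idm A (ft A a)) f' \<odot>\<^bsub>D\<^esub> lp a (src B f')"
      "tp a (tgt B f') \<odot>\<^bsub>D\<^esub> g = Ha (idm A a) f \<odot>\<^bsub>D\<^esub> tp a (src B f')"
      using qsq_right[OF a] by blast
    note g' = D.qsqD[OF g(1)]
    show "\<exists>g. qsq E (farr (comp_fctr (prod_cat A B) N H) (idm A a, f')) g \<and>
        farr N (lp a (tgt B f')) \<odot>\<^bsub>E\<^esub> g = farr (comp_fctr (prod_cat A B) N H) (idm A (ft A a), f') \<odot>\<^bsub>E\<^esub> farr N (lp a (src B f')) \<and>
        farr N (tp a (tgt B f')) \<odot>\<^bsub>E\<^esub> g = farr (comp_fctr (prod_cat A B) N H) (idm A a, f) \<odot>\<^bsub>E\<^esub> farr N (tp a (src B f'))"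
      using N.qsq_map[OF g(1)] arg_cong[OF g(2), of "farr N"] arg_cong[OF g(3), of "farr N"] g'(2,6) q a(1,2)
      by (intro exI[of _ "farr N g"]) (simp add: s)
  qed (simp_all add: s N.map_display Ha_display Ho_one)
qed

definition bi_precomp ::
  "'u contextual \<Rightarrow> 'u contextual \<Rightarrow> 'u bifctr \<Rightarrow> ('u, 'u, 'u, 'u) fctr \<Rightarrow> ('u, 'u, 'u, 'u) fctr \<Rightarrow> 'u bifctr" where
  "bi_precomp A B H F G =
     \<lparr>fob = (\<lambda>(x, y)\<in>ob A \<times> ob B. fob H (fob F x, fob G y)),
      farr = (\<lambda>(f, g)\<in>arr A \<times> arr B. farr H (farr F f, farr G g))\<rparr>"

lemma bi_precomp_simps [simp]:
  "f \<in> arr A \<Longrightarrow> g \<in> arr B \<Longrightarrow> farr (bi_precomp A B H F G) (f, g) = farr H (farr F f, farr G g)"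
  "a \<in> ob A \<Longrightarrow> b \<in> ob B \<Longrightarrow> fob (bi_precomp A B H F G) (a, b) = fob H (fob F a, fob G b)"
  by (simp_all add: bi_precomp_def)

text \<open>Strict preservation of \<open>ft\<close>, \<open>pr\<close> and \<open>sqs\<close> turns
  the conditions on \<open>H\<close> at the image objects into those on the composite.\<close>

lemma bimorphism_cones_precomp:
  assumes "bimorphism_cones A' B' D H tp lp" "contextual_fun A A' F" "contextual_fun B B' G"
  shows "bimorphism_cones A B D (bi_precomp A B H F G) (\<lambda>a b. tp (fob F a) (fob G b)) (\<lambda>a b. lp (fob F a) (fob G b))"
proof -
  interpret bimorphism_cones A' B' D H tp lp by fact
  interpret F: contextual_fun A A' F by fact
  interpret G: contextual_fun B B' G by fact
  show ?thesis
  proof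
    show "is_functor (prod_cat A B) D (bi_precomp A B H F G)"
    proof (rule is_functor_prodI[OF F.D.contextual_cat_axioms G.D.contextual_cat_axioms D.contextual_cat_axioms])
      show "fob (bi_precomp A B H F G) \<in> extensional (ob A \<times> ob B)"
        "farr (bi_precomp A B H F G) \<in> extensional (arr A \<times> arr B)"
        by (simp_all add: bi_precomp_def)
    qed (simp_all add: hom_set_def)
  next
    fix a b assume ab: "a \<in> ob A" "b \<in> ob B" "1 \<le> len A a" "1 \<le> len B b"
    have ab': "fob F a \<in> ob A'" "fob G b \<in> ob B'" "1 \<le> len A' (fob F a)" "1 \<le> len B' (fob G b)"
      using ab by simp_all
    note p = F.map_pr[OF ab(1,3)] G.map_pr[OF ab(2,4)] F.map_ft[OF ab(1)] G.map_ft[OF ab(2)]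
    show "1 \<le> len D (fob (bi_precomp A B H F G) (a, b))"
      using ab len_Ho[OF ab'] by simp
    show "dsq D (tp (fob F a) (fob G b)) (lp (fob F a) (fob G b)) (farr (bi_precomp A B H F G) (pr A a, idm B (ft B b)))
        (farr (bi_precomp A B H F G) (idm A (ft A a), pr B b))"
      using ab cone[OF ab'] by (simp add: p)
    show "ft D (fob (bi_precomp A B H F G) (a, b)) = src D (lp (fob F a) (fob G b))"
      using ab ab' by simp
    show "lp (fob F a) (fob G b) \<odot>\<^bsub>D\<^esub> pr D (fob (bi_precomp A B H F G) (a, b)) = farr (bi_precomp A B H F G) (pr A a, idm B b)"
      using ab lp_pr[OF ab'] by (simp add: p)
    show "tp (fob F a) (fob G b) \<odot>\<^bsub>D\<^esub> pr D (fob (bi_precomp A B H F G) (a, b)) = farr (bi_precomp A B H F G) (idm A a, pr B b)"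
      using ab tp_pr[OF ab'] by (simp add: p)
  next
    fix b f' f assume b: "b \<in> ob B" "1 \<le> len B b" "qsq A f' f"
    note q = F.D.qsq_sides[OF b(3) refl refl]
    have b': "fob G b \<in> ob B'" "1 \<le> len B' (fob G b)" using b by simp_all
    show "\<exists>g. qsq D (farr (bi_precomp A B H F G) (f', idm B b)) g \<and>
        lp (fob F (tgt A f')) (fob G b) \<odot>\<^bsub>D\<^esub> g = farr (bi_precomp A B H F G) (f, idm B b) \<odot>\<^bsub>D\<^esub> lp (fob F (src A f')) (fob G b) \<and>
        tp (fob F (tgt A f')) (fob G b) \<odot>\<^bsub>D\<^esub> g = farr (bi_precomp A B H F G) (f', idm B (ft B b)) \<odot>\<^bsub>D\<^esub> tp (fob F (src A f')) (fob G b)"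
      using qsq_left[OF b' F.qsq_map[OF b(3)]] q(13,14) b(1) by (simp add: G.map_ft)
  next
    fix a f' f assume a: "a \<in> ob A" "1 \<le> len A a" "qsq B f' f"
    note q = G.D.qsq_sides[OF a(3) refl refl]
    have a': "fob F a \<in> ob A'" "1 \<le> len A' (fob F a)" using a by simp_all
    show "\<exists>g. qsq D (farr (bi_precomp A B H F G) (idm A a, f')) g \<and>
        lp (fob F a) (fob G (tgt B f')) \<odot>\<^bsub>D\<^esub> g = farr (bi_precomp A B H F G) (idm A (ft A a), f') \<odot>\<^bsub>D\<^esub> lp (fob F a) (fob G (src B f')) \<and>
        tp (fob F a) (fob G (tgt B f')) \<odot>\<^bsub>D\<^esub> g = farr (bi_precomp A B H F G) (idm A a, f) \<odot>\<^bsub>D\<^esub> tp (fob F a) (fob G (src B f'))"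
      using qsq_right[OF a' G.qsq_map[OF a(3)]] q(13,14) a(1) by (simp add: F.map_ft)
  qed (simp_all add: F.map_display Ha_display Ho_one)
qed

section \<open>Iterated gap maps\<close>

text \<open>For a functor \<open>F\<close> of three variables, \<open>\<pi>1\<close>, \<open>\<pi>2\<close>, \<open>\<pi>3\<close> are the projections from the limit of the
  punctured cube at \<open>(a, b, c)\<close> to \<open>F(\<partial>a, b, c)\<close>, \<open>F(a, \<partial>b, c)\<close> and \<open>F(a, b, \<partial>c)\<close>.  The limit is
  the distinguished pullback of the gap map \<open>d\<close> of the square in the first two variables at \<open>\<partial>c\<close>.\<close>

definition cube_cone ::
  "'u contextual \<Rightarrow> 'u contextual \<Rightarrow> 'u contextual \<Rightarrow> 'u contextual \<Rightarrow> ('u \<Rightarrow> 'u \<Rightarrow> 'u \<Rightarrow> 'u) \<Rightarrow>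
   'u \<Rightarrow> 'u \<Rightarrow> 'u \<Rightarrow> 'u \<Rightarrow> 'u \<Rightarrow> 'u \<Rightarrow> bool" where
  "cube_cone A B C D F a b c \<pi>1 \<pi>2 \<pi>3 \<longleftrightarrow> (\<exists>t l t' l' d w k.
     dsq D t l (F (pr A a) (idm B (ft B b)) (idm C c)) (F (idm A (ft A a)) (pr B b) (idm C c)) \<and>
     dsq D t' l' (F (pr A a) (idm B (ft B b)) (idm C (ft C c)))
       (F (idm A (ft A a)) (pr B b) (idm C (ft C c))) \<and>
     display_map D d \<and> F (idm A a) (idm B b) (idm C (ft C c)) \<in> arr D \<and>
     src D d = src D (F (idm A a) (idm B b) (idm C (ft C c))) \<and> tgt D d = src D t' \<and>
     F (idm A (ft A a)) (idm B b) (pr C c) \<in> arr D \<and>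
     src D (F (idm A (ft A a)) (idm B b) (pr C c)) = tgt D l \<and>
     F (idm A a) (idm B (ft B b)) (pr C c) \<in> arr D \<and>
     src D (F (idm A a) (idm B (ft B b)) (pr C c)) = tgt D t \<and>
     l' \<odot>\<^bsub>D\<^esub> w = F (idm A (ft A a)) (idm B b) (pr C c) \<odot>\<^bsub>D\<^esub> l \<and>
     t' \<odot>\<^bsub>D\<^esub> w = F (idm A a) (idm B (ft B b)) (pr C c) \<odot>\<^bsub>D\<^esub> t \<and>
     dsq D \<pi>3 k d w \<and> src D w = src D t \<and>
     \<pi>1 = l \<odot>\<^bsub>D\<^esub> k \<and> \<pi>2 = t \<odot>\<^bsub>D\<^esub> k)"

context contextual_cat
begin

text \<open>\<open>F\<close> enters only through arrows that start at a proper face of the cube, so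
  agreement at smaller triples is enough. The gap map \<open>d\<close> is determined as a display
  map with given ends, and \<open>w\<close> by its two projections.\<close>

lemma cube_cone_unique:
  assumes "cube_cone A B C D F a b c p1 p2 p3" "cube_cone A B C D F' a b c q1 q2 q3"
    and "F (pr A a) (idm B (ft B b)) (idm C c) = F' (pr A a) (idm B (ft B b)) (idm C c)"
    and "F (idm A (ft A a)) (pr B b) (idm C c) = F' (idm A (ft A a)) (pr B b) (idm C c)"
    and "F (pr A a) (idm B (ft B b)) (idm C (ft C c)) = F' (pr A a) (idm B (ft B b)) (idm C (ft C c))"
    and "F (idm A (ft A a)) (pr B b) (idm C (ft C c)) = F' (idm A (ft A a)) (pr B b) (idm C (ft C c))"
    and "F (idm A a) (idm B b) (idm C (ft C c)) = F' (idm A a) (idm B b) (idm C (ft C c))"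
    and "F (idm A (ft A a)) (idm B b) (pr C c) = F' (idm A (ft A a)) (idm B b) (pr C c)"
    and "F (idm A a) (idm B (ft B b)) (pr C c) = F' (idm A a) (idm B (ft B b)) (pr C c)"
  shows "p1 = q1" "p2 = q2" "p3 = q3"
proof -
  obtain t l t' l' d w k where
    p: "dsq D t l (F (pr A a) (idm B (ft B b)) (idm C c)) (F (idm A (ft A a)) (pr B b) (idm C c))"
     "dsq D t' l' (F (pr A a) (idm B (ft B b)) (idm C (ft C c))) (F (idm A (ft A a)) (pr B b) (idm C (ft C c)))"
     "display_map D d" "src D d = src D (F (idm A a) (idm B b) (idm C (ft C c)))" "tgt D d = src D t'"
     "l' \<odot> w = F (idm A (ft A a)) (idm B b) (pr C c) \<odot> l"
     "t' \<odot> w = F (idm A a) (idm B (ft B b)) (pr C c) \<odot> t"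
     "dsq D p3 k d w" "src D w = src D t" "p1 = l \<odot> k" "p2 = t \<odot> k"
    using assms(1) unfolding cube_cone_def by metis
  obtain t2 l2 t2' l2' d2 w2 k2 where
    q: "dsq D t2 l2 (F' (pr A a) (idm B (ft B b)) (idm C c)) (F' (idm A (ft A a)) (pr B b) (idm C c))"
     "dsq D t2' l2' (F' (pr A a) (idm B (ft B b)) (idm C (ft C c))) (F' (idm A (ft A a)) (pr B b) (idm C (ft C c)))"
     "display_map D d2" "src D d2 = src D (F' (idm A a) (idm B b) (idm C (ft C c)))" "tgt D d2 = src D t2'"
     "l2' \<odot> w2 = F' (idm A (ft A a)) (idm B b) (pr C c) \<odot> l2"
     "t2' \<odot> w2 = F' (idm A a) (idm B (ft B b)) (pr C c) \<odot> t2"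
     "dsq D q3 k2 d2 w2" "src D w2 = src D t2" "q1 = l2 \<odot> k2" "q2 = t2 \<odot> k2"
    using assms(2) unfolding cube_cone_def by metis
  have e: "t2 = t" "l2 = l" using dsq_unique[OF p(1) q(1)[folded assms(3,4)]] by simp_all
  have e': "t2' = t'" "l2' = l'" using dsq_unique[OF p(2) q(2)[folded assms(5,6)]] by simp_all
  have d: "d2 = d"
    using display_unique[OF q(3) p(3)] p(4,5) q(4,5) assms(7) e' by simp
  have w: "w2 = w"
    using dsq_arr(4,8)[OF p(8)] dsq_arr(4,8)[OF q(8)] p(5-7,9) q(5-7,9) assms(8,9) e e' d
    by - (rule dsq_mono[OF p(2)]; simp)
  have "q3 = p3" "k2 = k" using dsq_unique[OF p(8) q(8)[unfolded d w]] by simp_all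
  then show "p1 = q1" "p2 = q2" "p3 = q3" using p q e by simp_all
qed

text \<open>\<open>p1\<close> and \<open>p2\<close> detect the component \<open>k \<odot> m\<close>
  in the pullback for the first two variables; together with \<open>p3\<close> this detects
  \<open>m\<close>.\<close>

lemma cube_cone_mono:
  assumes "cube_cone A B C D F a b c p1 p2 p3" "m \<in> arr D" "m' \<in> arr D" "tgt D m = src D p3" "tgt D m' = src D p3"
    "src D m = src D m'" "p1 \<odot> m = p1 \<odot> m'" "p2 \<odot> m = p2 \<odot> m'" "p3 \<odot> m = p3 \<odot> m'"
  shows "m = m'"
proof -
  obtain t l t' l' d w k where
    p: "dsq D t l (F (pr A a) (idm B (ft B b)) (idm C c)) (F (idm A (ft A a)) (pr B b) (idm C c))"
     "dsq D p3 k d w" "src D w = src D t" "p1 = l \<odot> k" "p2 = t \<odot> k"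
    using assms(1) unfolding cube_cone_def by metis
  note d1 = dsq_arr[OF p(1)] and d2 = dsq_arr[OF p(2)]
  have "k \<odot> m = k \<odot> m'"
    using d1 d2 p(3-5) assms(2-8) by - (rule dsq_mono[OF p(1)]; simp)
  then show ?thesis using assms by - (rule dsq_mono[OF p(2)]; simp)
qed

end

text \<open>The clauses on membership, sources and targets in \<open>cube_cone\<close> are there so
  that \<open>farr N\<close> distributes over its composites.\<close>

lemma (in contextual_fun) cube_cone_map:
  assumes "cube_cone A B C D F a b c p1 p2 p3"
  shows "cube_cone A B C E (\<lambda>f g h. farr N (F f g h)) a b c (farr N p1) (farr N p2) (farr N p3)"
proof -
  obtain t l t' l' d w k where
    p: "dsq D t l (F (pr A a) (idm B (ft B b)) (idm C c)) (F (idm A (ft A a)) (pr B b) (idm C c))"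
     "dsq D t' l' (F (pr A a) (idm B (ft B b)) (idm C (ft C c))) (F (idm A (ft A a)) (pr B b) (idm C (ft C c)))"
     "display_map D d" "F (idm A a) (idm B b) (idm C (ft C c)) \<in> arr D"
     "src D d = src D (F (idm A a) (idm B b) (idm C (ft C c)))" "tgt D d = src D t'"
     "F (idm A (ft A a)) (idm B b) (pr C c) \<in> arr D" "src D (F (idm A (ft A a)) (idm B b) (pr C c)) = tgt D l"
     "F (idm A a) (idm B (ft B b)) (pr C c) \<in> arr D" "src D (F (idm A a) (idm B (ft B b)) (pr C c)) = tgt D t"
     "l' \<odot>\<^bsub>D\<^esub> w = F (idm A (ft A a)) (idm B b) (pr C c) \<odot>\<^bsub>D\<^esub> l"
     "t' \<odot>\<^bsub>D\<^esub> w = F (idm A a) (idm B (ft B b)) (pr C c) \<odot>\<^bsub>D\<^esub> t"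
     "dsq D p3 k d w" "src D w = src D t" "p1 = l \<odot>\<^bsub>D\<^esub> k" "p2 = t \<odot>\<^bsub>D\<^esub> k"
    using assms unfolding cube_cone_def by blast
  note d1 = D.dsq_arr[OF p(1)] and d2 = D.dsq_arr[OF p(2)] and d3 = D.dsq_arr[OF p(13)]
  have c: "farr N l' \<odot>\<^bsub>E\<^esub> farr N w = farr N (F (idm A (ft A a)) (idm B b) (pr C c)) \<odot>\<^bsub>E\<^esub> farr N l"
     "farr N t' \<odot>\<^bsub>E\<^esub> farr N w = farr N (F (idm A a) (idm B (ft B b)) (pr C c)) \<odot>\<^bsub>E\<^esub> farr N t"
    using arg_cong[OF p(11), of "farr N"] arg_cong[OF p(12), of "farr N"] d1(1,2) d2(1,2,5) d3(4,8) p(6-10) by simp_all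
  show ?thesis
    unfolding cube_cone_def
    apply (rule exI[of _ "farr N t"], rule exI[of _ "farr N l"], rule exI[of _ "farr N t'"], rule exI[of _ "farr N l'"],
        rule exI[of _ "farr N d"], rule exI[of _ "farr N w"], rule exI[of _ "farr N k"])
    using dsq_map[OF p(1)] dsq_map[OF p(2)] dsq_map[OF p(13)] map_display[OF p(3)] c p(3-10,14-16) d1(1,2,5) d2(1) d3(2,4,7)
    by simp
qed

locale bimorphism_left = G: bimorphism_cones A B T G tG lG + L: bimorphism_cones T C D L tL lL
  for A B C T D :: "'u contextual" and G tG lG L tL lL
begin

text \<open>In its first variable \<open>L\<close> preserves distinguished squares, so the images of
  the cone of \<open>G\<close> are the pullbacks at \<open>c\<close> and at \<open>ft C c\<close>.
  The gap map \<open>d\<close> is the image of \<open>pr T (G.Ho a b)\<close>, and its distinguished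
  pullback is the cone of \<open>L\<close>.\<close>

lemma cube_cone:
  assumes "a \<in> ob A" "b \<in> ob B" "c \<in> ob C" "1 \<le> len A a" "1 \<le> len B b" "1 \<le> len C c"
  shows "cube_cone A B C D (\<lambda>f g h. L.Ha (G.Ha f g) h) a b c
    (L.Ha (lG a b) (idm C c) \<odot>\<^bsub>D\<^esub> lL (G.Ho a b) c)
    (L.Ha (tG a b) (idm C c) \<odot>\<^bsub>D\<^esub> lL (G.Ho a b) c)
    (tL (G.Ho a b) c)"
proof -
  let ?y = "G.Ho a b"
  note ab = assms(1,2,4,5)
  have y: "?y \<in> ob T" "1 \<le> len T ?y" using G.len_Ho[OF ab] ab by simp_all
  note yc = y(1) assms(3) y(2) assms(6)
  have c: "ft C c \<in> ob C" using assms(3) by simp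
  note cone = L.dsq_Ha_left[OF assms(3) G.cone[OF ab]] and cone' = L.dsq_Ha_left[OF c G.cone[OF ab]]
  have disp: "display_map D (L.Ha (pr T ?y) (idm C (ft C c)))"
    using y c by (intro L.Ha_display) simp_all
  show ?thesis
    unfolding cube_cone_def
    by (rule exI[of _ "L.Ha (tG a b) (idm C c)"], rule exI[of _ "L.Ha (lG a b) (idm C c)"],
        rule exI[of _ "L.Ha (tG a b) (idm C (ft C c))"], rule exI[of _ "L.Ha (lG a b) (idm C (ft C c))"],
        rule exI[of _ "L.Ha (pr T ?y) (idm C (ft C c))"], rule exI[of _ "L.Ha (idm T (ft T ?y)) (pr C c)"],
        rule exI[of _ "lL ?y c"])
      (use cone cone' disp L.cone[OF yc] assms y in simp)
qed

end

locale bimorphism_right = G: bimorphism_cones B C T G tG lG + H: bimorphism_cones A T D H tH lH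
  for A B C T D :: "'u contextual" and G tG lG H tH lH
begin

text \<open>Now the cone of \<open>G\<close> sits in the second variable of \<open>H\<close>, so
  \<open>d\<close> is the generalised gap map for \<open>G.Ha (pr B b) (idm C (ft C c))\<close>. The
  square between gap maps from \<open>gen_gap_dsq\<close>, pasted to the pullback square with top
  \<open>tH a (G.Ho b c)\<close>, is the required distinguished pullback.\<close>

lemma cube_cone:
  assumes "a \<in> ob A" "b \<in> ob B" "c \<in> ob C" "1 \<le> len A a" "1 \<le> len B b" "1 \<le> len C c"
  shows "cube_cone A B C D (\<lambda>f g h. H.Ha f (G.Ha g h)) a b c
    (lH a (G.Ho b c))
    (H.Ha (idm A a) (lG b c) \<odot>\<^bsub>D\<^esub> tH a (G.Ho b c))
    (H.Ha (idm A a) (tG b c) \<odot>\<^bsub>D\<^esub> tH a (G.Ho b c))"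
proof -
  let ?x = "G.Ho b c"
  note bc = assms(2,3,5,6)
  have x: "?x \<in> ob T" "1 \<le> len T ?x" using G.len_Ho[OF bc] bc by simp_all
  note ax = assms(1) x(1) assms(4) x(2)
  obtain t1 l1 \<gamma>1 t2 l2 \<gamma>2 u where G1: "H.gen_gap a (lG b c) t1 l1 \<gamma>1"
    and G2: "H.gen_gap a (G.Ha (pr B b) (idm C (ft C c))) t2 l2 \<gamma>2"
    and U: "dsq D (H.Ha (idm A a) (tG b c)) \<gamma>1 \<gamma>2 u"
      "l2 \<odot>\<^bsub>D\<^esub> u = H.Ha (idm A (ft A a)) (tG b c) \<odot>\<^bsub>D\<^esub> l1"
      "t2 \<odot>\<^bsub>D\<^esub> u = H.Ha (idm A a) (G.Ha (idm B (ft B b)) (pr C c)) \<odot>\<^bsub>D\<^esub> t1"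
    using H.gen_gap_dsq[OF assms(1,4) G.cone[OF bc]] by blast
  \<comment> \<open>The left side \<open>lG b c\<close> followed after \<open>pr T\<close> is
    \<open>G.Ha (pr B b) (idm C c)\<close>, so one more step of the gap construction reaches the
    pullback at \<open>c\<close> itself.\<close>
  obtain tt ll k where S: "dsq D tt ll l1 (H.Ha (idm A (ft A a)) (pr T ?x))" "dsq D (tH a ?x) k \<gamma>1 tt"
    "lH a ?x = ll \<odot>\<^bsub>D\<^esub> k" and G3: "H.gen_gap a (lG b c \<odot>\<^bsub>T\<^esub> pr T ?x) (t1 \<odot>\<^bsub>D\<^esub> tt) ll (k \<odot>\<^bsub>D\<^esub> pr D (H.Ho a ?x))"
    using H.gen_gap_step[OF G1 assms(1,4) x, of thesis] bc by simp
  note dS1 = H.D.dsq_arr[OF S(1)] and dS2 = H.D.dsq_arr[OF S(2)] and dU = H.D.dsq_arr[OF U(1)]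
  have g1: "dsq D t1 l1 (H.Ha (pr A a) (idm T (G.Ho (ft B b) c))) (H.Ha (idm A (ft A a)) (lG b c))"
    "tgt D \<gamma>1 = src D t1" "t1 \<odot>\<^bsub>D\<^esub> \<gamma>1 = H.Ha (idm A a) (lG b c)"
    using G1 bc unfolding H.gen_gap_def by simp_all
  have g2: "dsq D t2 l2 (H.Ha (pr A a) (G.Ha (idm B (ft B b)) (idm C (ft C c)))) (H.Ha (idm A (ft A a)) (G.Ha (pr B b) (idm C (ft C c))))"
    "tgt D \<gamma>2 = src D t2" "src D \<gamma>2 = H.Ho a (G.Ho b (ft C c))"
    using G2 bc unfolding H.gen_gap_def by simp_all
  note d1 = H.D.dsq_arr[OF g1(1)] and d2 = H.D.dsq_arr[OF g2(1)]
  have W: "dsq D (t1 \<odot>\<^bsub>D\<^esub> tt) ll (H.Ha (pr A a) (G.Ha (idm B (ft B b)) (idm C c))) (H.Ha (idm A (ft A a)) (G.Ha (pr B b) (idm C c)))"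
    using G3 bc G.lp_pr[OF bc] unfolding H.gen_gap_def by simp
  note dW = H.D.dsq_arr[OF W]
  have P: "dsq D (H.Ha (idm A a) (tG b c) \<odot>\<^bsub>D\<^esub> tH a ?x) k \<gamma>2 (u \<odot>\<^bsub>D\<^esub> tt)"
    by (rule H.D.dsq_hcomp[OF S(2) U(1)])
  have su: "src D u = src D t1" "tgt D u = src D t2" using dU(7,8) g1(2) g2(2) by simp_all
  have tt: "tgt D tt = src D t1" "src D tt = src D ll" using dS1(5,6) d1(5) by simp_all
  have tl: "tgt D ll = H.Ho (ft A a) ?x" "tgt D l1 = H.Ho (ft A a) (ft T ?x)" "tgt D t1 = H.Ho a (G.Ho (ft B b) c)"
    using dS1(7) d1(6,7) ax bc by simp_all
  have "l2 \<odot>\<^bsub>D\<^esub> (u \<odot>\<^bsub>D\<^esub> tt) = H.Ha (idm A (ft A a)) (tG b c) \<odot>\<^bsub>D\<^esub> (l1 \<odot>\<^bsub>D\<^esub> tt)"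
  proof -
    have "l2 \<odot>\<^bsub>D\<^esub> (u \<odot>\<^bsub>D\<^esub> tt) = (l2 \<odot>\<^bsub>D\<^esub> u) \<odot>\<^bsub>D\<^esub> tt"
      using d2(2,5) dU(4) dS1(1) su tt by simp
    also have "\<dots> = H.Ha (idm A (ft A a)) (tG b c) \<odot>\<^bsub>D\<^esub> (l1 \<odot>\<^bsub>D\<^esub> tt)"
      unfolding U(2) using d1(2,5) dS1(1) tt tl ax bc by simp
    finally show ?thesis .
  qed
  also have "\<dots> = H.Ha (idm A (ft A a)) (G.Ha (idm B b) (pr C c)) \<odot>\<^bsub>D\<^esub> ll"
    unfolding H.D.dsq_comm[OF S(1)] using dS1(2) tl ax bc G.tp_pr[OF bc] by simp
  finally have w1: "l2 \<odot>\<^bsub>D\<^esub> (u \<odot>\<^bsub>D\<^esub> tt) = H.Ha (idm A (ft A a)) (G.Ha (idm B b) (pr C c)) \<odot>\<^bsub>D\<^esub> ll" .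
  have "t2 \<odot>\<^bsub>D\<^esub> (u \<odot>\<^bsub>D\<^esub> tt) = (t2 \<odot>\<^bsub>D\<^esub> u) \<odot>\<^bsub>D\<^esub> tt"
    using d2(1) dU(4) dS1(1) su tt by simp
  also have "\<dots> = H.Ha (idm A a) (G.Ha (idm B (ft B b)) (pr C c)) \<odot>\<^bsub>D\<^esub> (t1 \<odot>\<^bsub>D\<^esub> tt)"
    unfolding U(3) using d1(1) dS1(1) tt tl ax bc by simp
  finally have w2: "t2 \<odot>\<^bsub>D\<^esub> (u \<odot>\<^bsub>D\<^esub> tt) = H.Ha (idm A a) (G.Ha (idm B (ft B b)) (pr C c)) \<odot>\<^bsub>D\<^esub> (t1 \<odot>\<^bsub>D\<^esub> tt)" .
  have "H.Ha (idm A a) (lG b c) \<odot>\<^bsub>D\<^esub> tH a ?x = t1 \<odot>\<^bsub>D\<^esub> (\<gamma>1 \<odot>\<^bsub>D\<^esub> tH a ?x)"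
    unfolding g1(3)[symmetric] using d1(1) g1(2) dS2(1,3,6) by simp
  also have "\<dots> = (t1 \<odot>\<^bsub>D\<^esub> tt) \<odot>\<^bsub>D\<^esub> k"
    unfolding H.D.dsq_comm[OF S(2)] using d1(1) dS1(1) dS2(2,7) tt by simp
  finally have p2: "H.Ha (idm A a) (lG b c) \<odot>\<^bsub>D\<^esub> tH a ?x = (t1 \<odot>\<^bsub>D\<^esub> tt) \<odot>\<^bsub>D\<^esub> k" .
  show ?thesis
    unfolding cube_cone_def
    by (rule exI[of _ "t1 \<odot>\<^bsub>D\<^esub> tt"], rule exI[of _ ll], rule exI[of _ t2], rule exI[of _ l2],
        rule exI[of _ \<gamma>2], rule exI[of _ "u \<odot>\<^bsub>D\<^esub> tt"], rule exI[of _ k], intro conjI)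
      (fact W g2(1) P H.D.dsq_right[OF U(1)] w1 w2 S(3) p2 |
       use g2(2,3) assms d1(1) dS1(1,2,5) dU(4) su tt tl in simp)+
qed

end

section \<open>Generation of the tensor product by pure tensors\<close>

locale universal_cones = bimorphism_cones A B T H tp lp for A B T :: "'u contextual" and H tp lp +
  assumes universal: "universal_bimorphism A B T H"
begin

text \<open>Agreement on arrows is enough, because the object maps are read off from the sources of
  identities.\<close>

lemma functor_unique:
  assumes "contextual_cat D" "contextual_functor T D M" "contextual_functor T D N"
    and "\<And>f g. f \<in> arr A \<Longrightarrow> g \<in> arr B \<Longrightarrow> farr M (Ha f g) = farr N (Ha f g)"
  shows "M = N"
proof -
  interpret M: contextual_fun T D M
    using assms D.contextual_cat_axioms by (simp add: contextual_fun_def contextual_fun_axioms_def)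
  interpret N: contextual_fun T D N
    using assms D.contextual_cat_axioms by (simp add: contextual_fun_def contextual_fun_axioms_def)
  interpret MH: bimorphism_cones A B D "comp_fctr (prod_cat A B) M H" "\<lambda>a b. farr M (tp a b)" "\<lambda>a b. farr M (lp a b)"
    by (rule bimorphism_cones_postcomp) unfold_locales
  interpret NH: bimorphism_cones A B D "comp_fctr (prod_cat A B) N H" "\<lambda>a b. farr N (tp a b)" "\<lambda>a b. farr N (lp a b)"
    by (rule bimorphism_cones_postcomp) unfold_locales
  have o: "fob M (Ho a b) = fob N (Ho a b)" if "a \<in> ob A" "b \<in> ob B" for a b
  proof -
    have "idm D (fob M (Ho a b)) = idm D (fob N (Ho a b))"
      using assms(4)[of "idm A a" "idm B b"] that by simp
    from arg_cong[OF this, of "src D"] show ?thesis using that by simp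
  qed
  have "comp_fctr (prod_cat A B) M H = comp_fctr (prod_cat A B) N H"
    using MH.bifunctor NH.bifunctor
    by (rule functor_eqI) (auto simp: o assms(4) comp_fctr_def prod_cat_def compose_def)
  then show ?thesis
    using universal assms(1-3) MH.bimorphism unfolding universal_bimorphism_def contextual_cat_def by metis
qed

lemma functor_ex:
  assumes "contextual_cat D" "bimorphism A B D K"
  obtains N where "contextual_functor T D N" "\<And>f g. f \<in> arr A \<Longrightarrow> g \<in> arr B \<Longrightarrow> farr N (Ha f g) = farr K (f, g)"
proof -
  obtain N where N: "contextual_functor T D N" "comp_fctr (prod_cat A B) N H = K"
    using universal assms unfolding universal_bimorphism_def contextual_cat_def by metis
  have "farr N (Ha f g) = farr K (f, g)" if "f \<in> arr A" "g \<in> arr B" for f g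
    unfolding N(2)[symmetric] using that by (simp add: prod_cat_def)
  then show ?thesis using that N by blast
qed

end

text \<open>The closure conditions are chosen so that the arrows on which two bimorphisms agree
  satisfy them: \<open>Y_qsq\<close> derives the top and the left side from the right side and the
  bottom, whereas \<open>Y_univ\<close> may take all four sides to be in \<open>Y\<close>
  already.\<close>

locale generating = universal_cones A B T H tp lp
  for A B :: "'u contextual" and T :: "'u contextual" (structure) and H tp lp +
  fixes Y :: "'u set"
  assumes Y_arr: "f \<in> Y \<Longrightarrow> f \<in> arr T"
    and Y_idm: "f \<in> Y \<Longrightarrow> idm T (src T f) \<in> Y \<and> idm T (tgt T f) \<in> Y"
    and Y_Ha: "f \<in> arr A \<Longrightarrow> g \<in> arr B \<Longrightarrow> Ha f g \<in> Y"
    and Y_comp: "f \<in> Y \<Longrightarrow> g \<in> Y \<Longrightarrow> src T g = tgt T f \<Longrightarrow> g \<odot> f \<in> Y"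
    and Y_qsq: "qsq T f g \<Longrightarrow> pr T (tgt T f) \<in> Y \<Longrightarrow> g \<in> Y \<Longrightarrow> f \<in> Y \<and> pr T (src T f) \<in> Y"
    and Y_univ: "qsq T f g \<Longrightarrow> f \<in> Y \<Longrightarrow> g \<in> Y \<Longrightarrow> pr T (src T f) \<in> Y \<Longrightarrow> pr T (tgt T f) \<in> Y \<Longrightarrow> m \<in> arr T \<Longrightarrow>
      tgt T m = src T f \<Longrightarrow> pr T (src T f) \<odot> m \<in> Y \<Longrightarrow> f \<odot> m \<in> Y \<Longrightarrow> m \<in> Y"
begin

text \<open>\<open>Y\<close> need not contain \<open>\<partial>x\<close> together with \<open>x\<close>; this is built into the objects of the subcategory.\<close>

definition Yob :: "'u set" where
  "Yob = {x \<in> ob T. \<forall>n. idm T ((ft T ^^ n) x) \<in> Y \<and> (1 \<le> len T ((ft T ^^ n) x) \<longrightarrow> pr T ((ft T ^^ n) x) \<in> Y)}"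

definition Yarr :: "'u set" where
  "Yarr = {f \<in> Y. src T f \<in> Yob \<and> tgt T f \<in> Yob}"

text \<open>Only the sets of objects, arrows and squares shrink; the operations are those of
  \<open>T\<close>, so equations in \<open>R\<close> are equations in \<open>T\<close>.\<close>

definition R :: "'u contextual" where
  "R = T\<lparr>ob := Yob, arr := Yarr,
    sqs := {S \<in> sqs T. top_side S \<in> Yarr \<and> left_side S \<in> Yarr \<and> right_side S \<in> Yarr \<and> bottom_side S \<in> Yarr}\<rparr>"

lemma R_simps [simp]:
  "ob R = Yob" "arr R = Yarr" "src R = src T" "tgt R = tgt T" "idm R = idm T" "cmp R = cmp T"
  "len R = len T" "ft R = ft T" "pr R = pr T"
  "sqs R = {S \<in> sqs T. top_side S \<in> Yarr \<and> left_side S \<in> Yarr \<and> right_side S \<in> Yarr \<and> bottom_side S \<in> Yarr}"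
  by (simp_all add: R_def)

lemma Yob_ob [simp]: "x \<in> Yob \<Longrightarrow> x \<in> ob T" and Yarr_arr [simp]: "f \<in> Yarr \<Longrightarrow> f \<in> arr T"
  and Yarr_Y: "f \<in> Yarr \<Longrightarrow> f \<in> Y"
  and Yarr_src [simp]: "f \<in> Yarr \<Longrightarrow> src T f \<in> Yob" and Yarr_tgt [simp]: "f \<in> Yarr \<Longrightarrow> tgt T f \<in> Yob"
  using Y_arr by (auto simp: Yob_def Yarr_def)

lemma YarrI: "f \<in> Y \<Longrightarrow> src T f \<in> Yob \<Longrightarrow> tgt T f \<in> Yob \<Longrightarrow> f \<in> Yarr"
  by (simp only: Yarr_def mem_Collect_eq)

lemma Yob_idm: "x \<in> Yob \<Longrightarrow> idm T x \<in> Y"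
proof -
  assume "x \<in> Yob"
  then have "idm T ((ft T ^^ 0) x) \<in> Y" unfolding Yob_def by blast
  then show ?thesis by simp
qed

lemma Yob_pr: "x \<in> Yob \<Longrightarrow> 1 \<le> len T x \<Longrightarrow> pr T x \<in> Y"
proof -
  assume "x \<in> Yob" "1 \<le> len T x"
  then have "1 \<le> len T ((ft T ^^ 0) x) \<longrightarrow> pr T ((ft T ^^ 0) x) \<in> Y" unfolding Yob_def by blast
  then show ?thesis using \<open>1 \<le> len T x\<close> by simp
qed

lemma Yob_ft [simp]: assumes "x \<in> Yob" shows "ft T x \<in> Yob"
proof -
  have "(ft T ^^ n) (ft T x) = (ft T ^^ Suc n) x" for n by (simp add: funpow_swap1)
  then show ?thesis using assms unfolding Yob_def by (auto simp del: funpow.simps)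
qed

lemma YobI:
  assumes "x \<in> ob T" "pr T x \<in> Y" "1 \<le> len T x" "ft T x \<in> Yob"
  shows "x \<in> Yob"
proof -
  have i: "idm T x \<in> Y" using Y_idm[OF assms(2)] assms by simp
  have "idm T ((ft T ^^ n) x) \<in> Y \<and> (1 \<le> len T ((ft T ^^ n) x) \<longrightarrow> pr T ((ft T ^^ n) x) \<in> Y)" for n
  proof (cases n)
    case 0
    then show ?thesis using i assms by simp
  next
    case (Suc k)
    have "(ft T ^^ n) x = (ft T ^^ k) (ft T x)" unfolding Suc by (simp add: funpow_swap1)
    then show ?thesis using assms(4) unfolding Yob_def by simp
  qed
  then show ?thesis using assms unfolding Yob_def by blast
qed

lemma Yarr_idm [simp]: "x \<in> Yob \<Longrightarrow> idm T x \<in> Yarr"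
  using Yob_idm by (intro YarrI) simp_all

lemma Yarr_pr [simp]: "x \<in> Yob \<Longrightarrow> 1 \<le> len T x \<Longrightarrow> pr T x \<in> Yarr"
  using Yob_pr by (intro YarrI) simp_all

lemma Yarr_comp [simp]: "f \<in> Yarr \<Longrightarrow> g \<in> Yarr \<Longrightarrow> src T g = tgt T f \<Longrightarrow> g \<odot> f \<in> Yarr"
  by (intro YarrI Y_comp) (simp_all add: Yarr_Y)

lemma Yarr_qsq:
  assumes "qsq T f g" "tgt T f \<in> Yob" "g \<in> Yarr"
  shows "f \<in> Yarr" "src T f \<in> Yob"
proof -
  note q = D.qsqD[OF assms(1)]
  have f: "f \<in> Y" "pr T (src T f) \<in> Y"
    using Y_qsq[OF assms(1) Yob_pr[OF assms(2) q(4)] Yarr_Y[OF assms(3)]] by simp_all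
  have "ft T (src T f) \<in> Yob" using Yarr_src[OF assms(3)] q(5) by simp
  then show "src T f \<in> Yob" using f q(1,3) by - (rule YobI; simp)
  then show "f \<in> Yarr" using f assms(2) by (intro YarrI) simp_all
qed

text \<open>The terminal object is \<open>Ho (one_ob A) (one_ob B)\<close>, so its identity is a
  pure tensor, and it is its own father.\<close>

lemma Yob_one: "one_ob T \<in> Yob"
proof -
  have "Ho (one_ob A) (one_ob B) = one_ob T" by (simp add: Ho_one)
  then have i: "idm T (one_ob T) \<in> Y"
    using Y_Ha[of "idm A (one_ob A)" "idm B (one_ob B)"] by simp
  have "(ft T ^^ n) (one_ob T) = one_ob T" for n
    by (induction n) (simp_all add: D.ft_zero[OF D.one_ob])
  then show ?thesis using i by (simp add: Yob_def del: Yob_ob)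
qed

text \<open>The map to the terminal object is a composite of projections \<open>pr\<close>, all of
  which lie in \<open>Y\<close>.\<close>

lemma Yob_terminal:
  "x \<in> Yob \<Longrightarrow> \<exists>f\<in>Yarr. src T f = x \<and> tgt T f = one_ob T"
proof (induction "len T x" arbitrary: x)
  case 0
  then have "x = one_ob T" by (intro D.one_ob_unique) simp_all
  then show ?case using Yob_one by (intro bexI[of _ "idm T x"]) simp_all
next
  case (Suc n)
  have l: "1 \<le> len T x" using Suc(2) by simp
  have "n = len T (ft T x)" using D.len_ft[OF Yob_ob[OF Suc(3)] l] Suc(2) by simp
  then obtain f where f: "f \<in> Yarr" "src T f = ft T x" "tgt T f = one_ob T"
    using Suc(1) Yob_ft[OF Suc(3)] by blast
  then show ?case using l Suc(3) by (intro bexI[of _ "f \<odot> pr T x"]) simp_all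
qed

lemma R_commutative:
  assumes "commutative_square T S" "top_side S \<in> Yarr" "left_side S \<in> Yarr" "right_side S \<in> Yarr" "bottom_side S \<in> Yarr"
  shows "commutative_square R S"
  using assms by (simp add: commutative_square_def)

lemma R_precontextual: "precontextual_category R"
proof -
  have "is_category R"
    unfolding is_category_def by (simp add: hom_set_def)
  moreover have "\<exists>a\<in>Yob. 1 \<le> len T a \<and> left_side S = pr T a" "\<exists>b\<in>Yob. 1 \<le> len T b \<and> right_side S = pr T b"
    if "S \<in> sqs R" for S
  proof -
    have S: "S \<in> sqs T" "top_side S \<in> Yarr" using that by simp_all
    note s = D.square_sides[OF S(1)]
    show "\<exists>a\<in>Yob. 1 \<le> len T a \<and> left_side S = pr T a" using s(1,3) Yarr_src[OF S(2)] by blast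
    show "\<exists>b\<in>Yob. 1 \<le> len T b \<and> right_side S = pr T b" using s(2,4) Yarr_tgt[OF S(2)] by blast
  qed
  moreover have "commutative_square R S" if "S \<in> sqs R" for S
    using that by (intro R_commutative D.square_commutative) simp_all
  ultimately show ?thesis
    unfolding precontextual_category_def by (simp add: hom_set_def D.len_ft[simplified] D.ft_zero)
qed

lemma R_pullback:
  assumes "S \<in> sqs R"
  shows "pullback_square R S"
proof -
  have S: "S \<in> sqs T" "top_side S \<in> Yarr" "left_side S \<in> Yarr" "right_side S \<in> Yarr" "bottom_side S \<in> Yarr"
    using assms by simp_all
  obtain f g x y where q: "S = sq f (pr T x) (pr T y) g" "qsq T f g" "src T f = x" "tgt T f = y"
    using D.square_cases[OF S(1)] .
  note qs = D.qsq_sides[OF q(2-4)]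
  have Y: "f \<in> Yarr" "g \<in> Yarr" "pr T x \<in> Yarr" "pr T y \<in> Yarr" using S(2-5) q(1) by simp_all
  have "\<exists>!m. m \<in> hom_set R (src R u) (corner R S) \<and> left_side S \<odot>\<^bsub>R\<^esub> m = u \<and> top_side S \<odot>\<^bsub>R\<^esub> m = v"
    if uv: "u \<in> arr R" "v \<in> arr R" "src R u = src R v" "tgt R u = src R (bottom_side S)"
      "tgt R v = src R (right_side S)" "bottom_side S \<odot>\<^bsub>R\<^esub> u = right_side S \<odot>\<^bsub>R\<^esub> v" for u v
  proof -
    have uv': "u \<in> Yarr" "v \<in> Yarr" "src T u = src T v" "tgt T u = src T g" "tgt T v = y" "g \<odot> u = pr T y \<odot> v"
      using uv q(1) qs(9) by simp_all
    have ex: "\<exists>!m. m \<in> arr T \<and> src T m = src T u \<and> tgt T m = x \<and> pr T x \<odot> m = u \<and> f \<odot> m = v"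
      by (rule D.qsq_univ[OF q(2-4) _ _ uv'(3-6)]) (use uv' in simp_all)
    from ex1_implies_ex[OF this] obtain m where
      "m \<in> arr T \<and> src T m = src T u \<and> tgt T m = x \<and> pr T x \<odot> m = u \<and> f \<odot> m = v" ..
    then have m: "m \<in> arr T" "src T m = src T u" "tgt T m = x" "pr T x \<odot> m = u" "f \<odot> m = v"
      by simp_all
    \<comment> \<open>The factorisation comes from the universal property in \<open>T\<close>;
      \<open>Y_univ\<close> keeps it inside the subcategory.\<close>
    have "m \<in> Y"
      using m(1,3) by - (rule Y_univ[OF q(2)]; simp add: Y uv' Yarr_Y q(3,4) m(4,5))
    then have mY: "m \<in> Yarr" using m(2,3) uv'(1) q(3) Y(1) Yarr_src[of f] by (intro YarrI) simp_all
    show ?thesis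
    proof (rule ex1I[of _ m])
      show "m \<in> hom_set R (src R u) (corner R S) \<and> left_side S \<odot>\<^bsub>R\<^esub> m = u \<and> top_side S \<odot>\<^bsub>R\<^esub> m = v"
        using m mY q by (simp add: hom_set_def corner_def)
      fix k assume "k \<in> hom_set R (src R u) (corner R S) \<and> left_side S \<odot>\<^bsub>R\<^esub> k = u \<and> top_side S \<odot>\<^bsub>R\<^esub> k = v"
      then have "k \<in> arr T \<and> src T k = src T u \<and> tgt T k = x \<and> pr T x \<odot> k = u \<and> f \<odot> k = v"
        using q by (simp add: hom_set_def corner_def)
      then show "k = m" using ex m by blast
    qed
  qed
  moreover have "commutative_square R S" using S by (intro R_commutative D.square_commutative)
  ultimately show ?thesis unfolding pullback_square_def by blast
qed

lemma R_contextual: "contextual_cat R"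
proof
  have one: "t = one_ob T" if "t \<in> Yob" "len T t = 0" for t
    using that by (intro D.one_ob_unique) simp_all
  have c1: "\<exists>!t. t \<in> ob R \<and> len R t = 0"
    using Yob_one by (intro ex1I[of _ "one_ob T"]) (auto intro: one)
  have c2: "\<exists>!f. f \<in> hom_set R a t" if t: "t \<in> ob R" "len R t = 0" "a \<in> ob R" for a t
  proof -
    have t': "t = one_ob T" "a \<in> Yob" using one t by simp_all
    obtain f where f: "f \<in> Yarr" "src T f = a" "tgt T f = one_ob T"
      using Yob_terminal[OF t'(2)] by blast
    show ?thesis
    proof (rule ex1I[of _ f])
      show "f \<in> hom_set R a t" using f t' by (simp add: hom_set_def)
      show "g = f" if "g \<in> hom_set R a t" for g
        using that f t' by - (rule D.terminal; simp add: hom_set_def)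
    qed
  qed
  have c3: "\<lparr>top_side = idm R a, left_side = pr R a, right_side = pr R a, bottom_side = idm R (ft R a)\<rparr> \<in> sqs R"
    if "a \<in> ob R" "1 \<le> len R a" for a
    using that D.square_idm[of a] by simp
  have c4: "hcomp R Q S \<in> sqs R" if "S \<in> sqs R" "Q \<in> sqs R" "right_side S = left_side Q" for S Q
  proof -
    have S: "S \<in> sqs T" "Q \<in> sqs T" using that by simp_all
    note s = commutative_squareD[OF D.square_commutative[OF S(1)]] and q = commutative_squareD[OF D.square_commutative[OF S(2)]]
    have "src T (top_side Q) = tgt T (top_side S)" "src T (bottom_side Q) = tgt T (bottom_side S)"
      using s(6,8) q(5,7) that(3) by simp_all
    moreover have "hcomp R Q S = hcomp T Q S" by (simp add: hcomp_def)
    ultimately show ?thesis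
      using that D.square_hcomp[OF S that(3)] by (simp add: hcomp_def)
  qed
  have c5: "\<exists>!S. S \<in> sqs R \<and> right_side S = pr R a \<and> bottom_side S = f"
    if a: "a \<in> ob R" "f \<in> arr R" "1 \<le> len R a" "tgt R f = ft R a" for a f
  proof -
    have a': "a \<in> ob T" "1 \<le> len T a" "f \<in> arr T" "tgt T f = ft T a" using a by simp_all
    obtain g where g: "qsq T g f" "tgt T g = a" using D.qsq_ex[OF a'] by blast
    have gY: "g \<in> Yarr" "src T g \<in> Yob" using Yarr_qsq[OF g(1)] g(2) a by simp_all
    let ?S = "sq g (pr T (src T g)) (pr T a) f"
    have S: "?S \<in> sqs T" using D.qsq_square[OF g(1) refl g(2)] .
    show ?thesis
    proof (rule ex1I[of _ ?S])
      show "?S \<in> sqs R \<and> right_side ?S = pr R a \<and> bottom_side ?S = f"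
        using S gY a D.qsqD(3)[OF g(1)] by simp
      note u = D.square_ex1[OF a'(1,3,2,4)]
      fix S' assume "S' \<in> sqs R \<and> right_side S' = pr R a \<and> bottom_side S' = f"
      then have "S' \<in> sqs T \<and> right_side S' = pr T a \<and> bottom_side S' = f" by simp
      from the1_equality[OF u this]
      have "S' = (THE S. S \<in> sqs T \<and> right_side S = pr T a \<and> bottom_side S = f)" ..
      also have "\<dots> = ?S" using S by (intro the1_equality[OF u]) simp
      finally show "S' = ?S" .
    qed
  qed
  show "contextual_category R"
    unfolding contextual_category_def
    by (intro conjI ballI impI) (rule R_precontextual c1 | (rule c2 c3 c4 c5 R_pullback; assumption))+
qed

lemma R_qsq: "qsq T f g \<Longrightarrow> f \<in> Yarr \<Longrightarrow> g \<in> Yarr \<Longrightarrow> qsq R f g"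
  using D.qsqD(3,4)[of f g] by (simp add: qsq_def)

lemma R_qsqD: "qsq R f g \<Longrightarrow> qsq T f g \<and> f \<in> Yarr \<and> g \<in> Yarr"
  by (simp add: qsq_def)

lemma R_display: "display_map T f \<Longrightarrow> src T f \<in> Yob \<Longrightarrow> display_map R f"
proof (induction rule: display_map.induct)
  case (display_id a)
  then show ?case using display_map.display_id[of a R] by simp
next
  case (display_step g a)
  have g: "g \<in> arr T" using display_step(1) by simp
  have a: "a \<in> Yob" using display_step(2-4,6) g by simp
  then have "display_map R g" using display_step.IH display_step(4) by simp
  then show ?case using display_map.display_step[of R g a] a display_step(3,4) by simp
qed

lemma R_dsq: "dsq T t l r b \<Longrightarrow> src T r \<in> Yob \<Longrightarrow> b \<in> Yarr \<Longrightarrow> dsq R t l r b"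
proof (induction rule: D.dsq_induct)
  interpret R: contextual_cat R by (rule R_contextual)
  case (empty f x y)
  then show ?case using R.dsq_empty[of f x y] by simp
next
  interpret R: contextual_cat R by (rule R_contextual)
  case (step f g x y l r b)
  note q = D.qsq_sides[OF step(1-3)] and d = D.dsq_arr[OF step(4)]
  have y: "y \<in> Yob" using step(6) d(3,6) q(8-10,12) by simp
  have "src T r = ft T y" using d(6) q(12) by simp
  then have IH: "dsq R g l r b" using step.IH step(7) y by simp
  have "g \<in> Yarr" using R.dsq_arr(1)[OF IH] by simp
  with Yarr_qsq[OF step(1) _ this] have "f \<in> Yarr" using step(3) y by simp
  with \<open>g \<in> Yarr\<close> have "qsq R f g" using R_qsq step(1) by blast
  from R.dsq_step[OF this IH, of x y] show ?case using step(2,3) by simp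
qed

text \<open>Extends \<open>Y_univ\<close> from one layer to many: the component into the lower
  layers is in \<open>Y\<close> by induction, and the top layer then gives \<open>m\<close>.\<close>

lemma R_univ: "dsq R t l r b \<Longrightarrow> m \<in> arr T \<Longrightarrow> tgt T m = src T t \<Longrightarrow>
   l \<odot> m \<in> Y \<Longrightarrow> t \<odot> m \<in> Y \<Longrightarrow> m \<in> Y"
proof -
  interpret R: contextual_cat R by (rule R_contextual)
  assume "dsq R t l r b" "m \<in> arr T" "tgt T m = src T t" "l \<odot> m \<in> Y" "t \<odot> m \<in> Y"
  then show "m \<in> Y"
  proof (induction arbitrary: m rule: R.dsq_induct)
    case (empty f x y)
    have "x \<in> Yob" using empty(1,2) by auto
    then show ?case using empty by simp
  next
    case (step f g x y l r b)
    note q = R.qsq_sides[OF step(1-3), simplified] and d = R.dsq_arr[OF step(4), simplified]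
    have qT: "qsq T f g" using R_qsqD[OF step(1)] by blast
    have s: "src T f = x" "tgt T f = y" using step(2,3) by simp_all
    have xm: "tgt T m = x" using s step(7) by simp
    have pm: "pr T x \<odot> m \<in> arr T" using q(1,3) xm step(6) by simp
    have c: "g \<odot> (pr T x \<odot> m) = pr T y \<odot> (f \<odot> m)"
      using D.dsq_cone[OF D.qsq_dsq[OF qT] step(6,7)] s by simp
    have "pr T x \<odot> m \<in> Y"
    proof (rule step.IH[OF pm])
      show "tgt T (pr T x \<odot> m) = src T g" using q(1,3,11) xm step(6) by simp
      have "l \<odot> (pr T x \<odot> m) = (l \<odot> pr T x) \<odot> m"
        using q(1,3,11) d(2,5) xm step(6) by simp
      then show "l \<odot> (pr T x \<odot> m) \<in> Y" using step(8) by simp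
      have "pr T y \<odot> (f \<odot> m) \<in> Y"
        using step(9) Yob_pr[OF q(2)] q(2,4,13) s xm step(6) by - (rule Y_comp; simp)
      then show "g \<odot> (pr T x \<odot> m) \<in> Y" using c by simp
    qed
    then show ?case
      using step(6,9) s xm q(1-4,13,14) Yarr_Y Yob_pr by - (rule Y_univ[OF qT]; simp)
  qed
qed

text \<open>The cone at \<open>a\<close> and \<open>b\<close> involves only smaller pairs, so it
  lies in \<open>R\<close>; then \<open>pr T (Ho a b)\<close> is induced by two pure tensors and
  hence belongs to \<open>Y\<close>.\<close>

lemma Yob_Ho: "a \<in> ob A \<Longrightarrow> b \<in> ob B \<Longrightarrow> Ho a b \<in> Yob"
proof (induction "len A a + len B b" arbitrary: a b rule: less_induct)
  case less
  show ?case
  proof (cases "1 \<le> len A a \<and> 1 \<le> len B b")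
    case False
    then have "len A a = 0 \<or> len B b = 0" by auto
    then show ?thesis using Ho_one[OF less(2,3)] Yob_one by simp
  next
    case True
    note ab = less(2,3) conjunct1[OF True] conjunct2[OF True]
    have 1: "Ho (ft A a) b \<in> Yob" "Ho a (ft B b) \<in> Yob" "Ho (ft A a) (ft B b) \<in> Yob"
      using less A.len_ft[OF ab(1,3)] B.len_ft[OF ab(2,4)] True by simp_all
    interpret R: contextual_cat R by (rule R_contextual)
    have R: "dsq R (tp a b) (lp a b) (Ha (pr A a) (idm B (ft B b))) (Ha (idm A (ft A a)) (pr B b))"
      using ab 1 by (intro R_dsq[OF cone[OF ab]]) (auto intro!: YarrI Y_Ha simp: 1)
    note d = R.dsq_arr[OF R, simplified]
    have ft: "ft T (Ho a b) \<in> Yob" using Yarr_src[OF d(2)] ab by simp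
    have "pr T (Ho a b) \<in> Y"
      using lp_pr[OF ab] tp_pr[OF ab] Y_Ha ab by - (rule R_univ[OF R]; simp)
    then show ?thesis using ab ft len_Ho[OF ab] by - (rule YobI; simp)
  qed
qed

lemma R_cone:
  assumes "a \<in> ob A" "b \<in> ob B" "1 \<le> len A a" "1 \<le> len B b"
  shows "dsq R (tp a b) (lp a b) (Ha (pr A a) (idm B (ft B b))) (Ha (idm A (ft A a)) (pr B b))"
  using assms by (intro R_dsq[OF cone[OF assms]]) (auto intro!: YarrI Y_Ha Yob_Ho)

lemma Yarr_Ha [simp]: "f \<in> arr A \<Longrightarrow> g \<in> arr B \<Longrightarrow> Ha f g \<in> Yarr"
  by (auto intro!: YarrI Y_Ha Yob_Ho)

text \<open>The tensor map corestricts to \<open>R\<close>: the bottom maps of the gap squares lie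
  in \<open>Y\<close> because both of their projections do.\<close>

lemma R_cones: "bimorphism_cones A B R H tp lp"
proof -
  interpret R: contextual_cat R by (rule R_contextual)
  have Yc: "lp a b \<in> Yarr" "tp a b \<in> Yarr" if "a \<in> ob A" "b \<in> ob B" "1 \<le> len A a" "1 \<le> len B b" for a b
    using R.dsq_arr(1,2)[OF R_cone[OF that]] by simp_all
  have one: "one_ob R = one_ob T"
    using R.one_ob_unique[of "one_ob T"] Yob_one by simp
  show ?thesis
  proof
    have "fob H \<in> extensional (ob A \<times> ob B)" "farr H \<in> extensional (arr A \<times> arr B)"
      using bifunctor by (simp_all add: is_functor_def prod_cat_def PiE_iff)
    then show "is_functor (prod_cat A B) R H"
      by (intro is_functor_prodI[OF A.contextual_cat_axioms B.contextual_cat_axioms R_contextual])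
        (simp_all add: hom_set_def Yob_Ho)
  next
    fix b f' f assume b: "b \<in> ob B" "1 \<le> len B b" "qsq A f' f"
    note q = A.qsq_sides[OF b(3) refl refl]
    obtain g where g: "qsq T (Ha f' (idm B b)) g" "lp (tgt A f') b \<odot> g = Ha f (idm B b) \<odot> lp (src A f') b"
      "tp (tgt A f') b \<odot> g = Ha f' (idm B (ft B b)) \<odot> tp (src A f') b"
      using qsq_left[OF b] by blast
    note g' = D.qsqD[OF g(1)]
    have s: "src T g = ft T (Ho (src A f') b)" "tgt T g = ft T (Ho (tgt A f') b)"
      using g'(5,6) q b by simp_all
    have "lp (tgt A f') b \<odot> g \<in> Yarr" "tp (tgt A f') b \<odot> g \<in> Yarr"
      unfolding g(2,3) using Yc[OF q(1) b(1) q(3) b(2)] q b by simp_all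
    then have "g \<in> Y"
      using g'(2) s q b by - (rule R_univ[OF R_cone[OF q(2) b(1) q(4) b(2)]]; simp add: Yarr_Y)
    then have "g \<in> Yarr" using s q b by (intro YarrI) (simp_all add: Yob_Ho)
    then have "qsq R (Ha f' (idm B b)) g" using R_qsq[OF g(1)] q b by simp
    then show "\<exists>g. qsq R (Ha f' (idm B b)) g \<and>
        lp (tgt A f') b \<odot>\<^bsub>R\<^esub> g = Ha f (idm B b) \<odot>\<^bsub>R\<^esub> lp (src A f') b \<and>
        tp (tgt A f') b \<odot>\<^bsub>R\<^esub> g = Ha f' (idm B (ft B b)) \<odot>\<^bsub>R\<^esub> tp (src A f') b"
      using g(2,3) by auto
  next
    fix a f' f assume a: "a \<in> ob A" "1 \<le> len A a" "qsq B f' f"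
    note q = B.qsq_sides[OF a(3) refl refl]
    obtain g where g: "qsq T (Ha (idm A a) f') g" "lp a (tgt B f') \<odot> g = Ha (idm A (ft A a)) f' \<odot> lp a (src B f')"
      "tp a (tgt B f') \<odot> g = Ha (idm A a) f \<odot> tp a (src B f')"
      using qsq_right[OF a] by blast
    note g' = D.qsqD[OF g(1)]
    have s: "src T g = ft T (Ho a (src B f'))" "tgt T g = ft T (Ho a (tgt B f'))"
      using g'(5,6) q a by simp_all
    have "lp a (tgt B f') \<odot> g \<in> Yarr" "tp a (tgt B f') \<odot> g \<in> Yarr"
      unfolding g(2,3) using Yc[OF a(1) q(1) a(2) q(3)] q a by simp_all
    then have "g \<in> Y"
      using g'(2) s q a by - (rule R_univ[OF R_cone[OF a(1) q(2) a(2) q(4)]]; simp add: Yarr_Y)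
    then have "g \<in> Yarr" using s q a by (intro YarrI) (simp_all add: Yob_Ho)
    then have "qsq R (Ha (idm A a) f') g" using R_qsq[OF g(1)] q a by simp
    then show "\<exists>g. qsq R (Ha (idm A a) f') g \<and>
        lp a (tgt B f') \<odot>\<^bsub>R\<^esub> g = Ha (idm A (ft A a)) f' \<odot>\<^bsub>R\<^esub> lp a (src B f') \<and>
        tp a (tgt B f') \<odot>\<^bsub>R\<^esub> g = Ha (idm A a) f \<odot>\<^bsub>R\<^esub> tp a (src B f')"
      using g(2,3) by auto
  next
    fix a b assume ab: "a \<in> ob A" "b \<in> ob B" "1 \<le> len A a" "1 \<le> len B b"
    show "dsq R (tp a b) (lp a b) (Ha (pr A a) (idm B (ft B b))) (Ha (idm A (ft A a)) (pr B b))"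
      by (rule R_cone[OF ab])
    show "1 \<le> len R (Ho a b)" using len_Ho[OF ab] by simp
    show "ft R (Ho a b) = src R (lp a b)" using ab by simp
    show "lp a b \<odot>\<^bsub>R\<^esub> pr R (Ho a b) = Ha (pr A a) (idm B b)" using lp_pr[OF ab] by simp
    show "tp a b \<odot>\<^bsub>R\<^esub> pr R (Ho a b) = Ha (idm A a) (pr B b)" using tp_pr[OF ab] by simp
  next
    fix b f assume b: "b \<in> ob B" "display_map A f"
    then show "display_map R (Ha f (idm B b))"
      using A.display_arr[OF b(2)] by (intro R_display Ha_display) (simp_all add: Yob_Ho)
  next
    fix a b assume "a \<in> ob A" "b \<in> ob B" "len A a = 0 \<or> len B b = 0"
    then show "Ho a b = one_ob R" using Ho_one one by simp
  qed
qed

text \<open>Universality yields a functor from \<open>T\<close> to \<open>R\<close>. Followed by the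
  inclusion it fixes all pure tensors, so it is the identity, and every arrow comes from
  \<open>R\<close>.\<close>

lemma generates: assumes "f \<in> arr T" shows "f \<in> Y"
proof -
  interpret R: contextual_cat R by (rule R_contextual)
  obtain N where N: "contextual_functor T R N" "\<And>f g. f \<in> arr A \<Longrightarrow> g \<in> arr B \<Longrightarrow> farr N (Ha f g) = Ha f g"
    using functor_ex[OF R_contextual bimorphism_cones.bimorphism[OF R_cones]] by metis
  interpret N: contextual_fun T R N
    using N(1) R_contextual D.contextual_cat_axioms by (simp add: contextual_fun_def contextual_fun_axioms_def)
  define I where "I = \<lparr>fob = (\<lambda>x\<in>Yob. x), farr = (\<lambda>f\<in>Yarr. f)\<rparr>"
  have I: "fob I x = x" "farr I f = f" if "x \<in> Yob" "f \<in> Yarr" for x f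
    using that by (simp_all add: I_def)
  have "map_square I S = S" if "S \<in> sqs R" for S
    using that by (cases S) (simp add: map_square_def I_def)
  then have "contextual_functor R T I"
    by (auto simp: contextual_functor_def is_functor_def I_def)
  then have c: "contextual_functor T T (comp_fctr T I N)"
    using N(1) by (intro contextual_functor_comp[OF D.contextual_cat_axioms R_contextual D.contextual_cat_axioms])
  have "comp_fctr T I N = id_fctr T"
  proof (rule functor_unique[OF D.contextual_cat_axioms c contextual_functor_id[OF D.contextual_cat_axioms]])
    fix f g assume "f \<in> arr A" "g \<in> arr B"
    then show "farr (comp_fctr T I N) (Ha f g) = farr (id_fctr T) (Ha f g)"
      by (simp add: N(2) I_def id_fctr_def)
  qed
  then have "farr (comp_fctr T I N) f = f" using assms by (simp add: id_fctr_def)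
  moreover have "farr N f \<in> Yarr" using N.map_arr[OF assms] by simp
  ultimately have "f \<in> Yarr" using assms by (simp add: I_def)
  then show ?thesis by (rule Yarr_Y)
qed

end

text \<open>Generation applied to the inner tensor product: the arrows of \<open>U\<close> on which
  the two bimorphisms agree, whatever stands in the first variable, form a closed set in the sense
  of \<open>generating\<close>.\<close>

lemma bimorphisms_agree:
  assumes "universal_cones B C U G tG lG"
    and "bimorphism_cones A U D K tK lK" "bimorphism_cones A U D L tL lL"
    and agree: "\<And>f g h. f \<in> arr A \<Longrightarrow> g \<in> arr B \<Longrightarrow> h \<in> arr C \<Longrightarrow> farr K (f, farr G (g, h)) = farr L (f, farr G (g, h))"
    and "f \<in> arr A" "k \<in> arr U"
  shows "farr K (f, k) = farr L (f, k)"
proof -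
  interpret G: universal_cones B C U G tG lG by fact
  interpret K: bimorphism_cones A U D K tK lK by fact
  interpret L: bimorphism_cones A U D L tL lL by fact
  \<comment> \<open>Quantifying over all arrows of \<open>A\<close> lets the closure proofs pass
    between \<open>a\<close> and \<open>ft A a\<close>.\<close>
  define good where "good k \<longleftrightarrow> (\<forall>f\<in>arr A. K.Ha f k = L.Ha f k)" for k
  have good: "good k \<Longrightarrow> f \<in> arr A \<Longrightarrow> K.Ha f k = L.Ha f k" for f k
    unfolding good_def by blast
  have ob: "K.Ho a x = L.Ho a x" if "good (idm U x)" "x \<in> ob U" "a \<in> ob A" for a x
    using arg_cong[OF good[OF that(1), of "idm A a"], of "src D"] that by simp
  \<comment> \<open>The identities at both ends are included so that agreement on objects is
    available too.\<close>
  define Y where "Y = {k \<in> arr U. good k \<and> good (idm U (src U k)) \<and> good (idm U (tgt U k))}"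
  \<comment> \<open>Closure under distinguished pullback, first over identities of \<open>A\<close>,
    by induction on the length of \<open>a\<close>: the cones at \<open>x\<close> and
    \<open>y\<close> coincide, hence so do the bottom maps of the gap squares, hence so do the
    tops.\<close>
  have left: "K.Ha (idm A a) f' = L.Ha (idm A a) f' \<and> K.Ha (idm A a) (pr U x) = L.Ha (idm A a) (pr U x) \<and>
      (1 \<le> len A a \<longrightarrow> K.Ha (pr A a) (idm U x) = L.Ha (pr A a) (idm U x))"
    if q: "qsq U f' f" "src U f' = x" "tgt U f' = y" and "f \<in> Y" "pr U y \<in> Y" "a \<in> ob A" for f' f x y a
    using \<open>a \<in> ob A\<close>
  proof (induction "len A a" arbitrary: a)
    note qs = G.D.qsq_sides[OF q]
    case 0
    then have one: "K.Ho a z = one_ob D" "L.Ho a z = one_ob D" if "z \<in> ob U" for z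
      using that K.Ho_one L.Ho_one by simp_all
    have "K.Ha (idm A a) k = L.Ha (idm A a) k" if "k \<in> arr U" for k
      using that 0 one by - (rule K.D.terminal; simp)
    then show ?case using qs 0 by simp
  next
    note qs = G.D.qsq_sides[OF q]
    case (Suc n)
    have a: "1 \<le> len A a" using Suc(2) by simp
    note ax = Suc(3) qs(1) a qs(3) and ay = Suc(3) qs(2) a qs(4)
    have IH: "K.Ha (idm A (ft A a)) f' = L.Ha (idm A (ft A a)) f'" "K.Ha (idm A (ft A a)) (pr U x) = L.Ha (idm A (ft A a)) (pr U x)"
      using Suc(1)[of "ft A a"] Suc(2,3) K.A.len_ft[OF Suc(3) a] by simp_all
    have g: "good f" "good (idm U (ft U x))" "good (idm U (ft U y))" "good (pr U y)" "good (idm U y)"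
      using that(4,5) qs by (simp_all add: Y_def)
    have "K.Ha (pr A a) (idm U (ft U y)) = L.Ha (pr A a) (idm U (ft U y))" "K.Ha (idm A (ft A a)) (pr U y) = L.Ha (idm A (ft A a)) (pr U y)"
      using g good Suc(3) a by simp_all
    then have ey: "tK a y = tL a y" "lK a y = lL a y"
      using K.D.dsq_unique[OF L.cone[OF ay]] K.cone[OF ay] by simp_all
    have "K.Ha (pr A a) (idm U (ft U x)) = L.Ha (pr A a) (idm U (ft U x))"
      using g good Suc(3) a by simp
    then have ex: "tK a x = tL a x" "lK a x = lL a x"
      using K.D.dsq_unique[OF L.cone[OF ax]] K.cone[OF ax] IH(2) by simp_all
    obtain g1 where g1: "qsq D (K.Ha (idm A a) f') g1" "lK a y \<odot>\<^bsub>D\<^esub> g1 = K.Ha (idm A (ft A a)) f' \<odot>\<^bsub>D\<^esub> lK a x"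
        "tK a y \<odot>\<^bsub>D\<^esub> g1 = K.Ha (idm A a) f \<odot>\<^bsub>D\<^esub> tK a x"
      using K.qsq_right[OF Suc(3) a q(1)] q(2,3) by auto
    obtain g2 where g2: "qsq D (L.Ha (idm A a) f') g2" "lL a y \<odot>\<^bsub>D\<^esub> g2 = L.Ha (idm A (ft A a)) f' \<odot>\<^bsub>D\<^esub> lL a x"
        "tL a y \<odot>\<^bsub>D\<^esub> g2 = L.Ha (idm A a) f \<odot>\<^bsub>D\<^esub> tL a x"
      using L.qsq_right[OF Suc(3) a q(1)] q(2,3) by auto
    have s1: "src D g1 = src D (tK a x)" "tgt D g1 = src D (tK a y)" "g1 \<in> arr D"
      using K.D.qsqD[OF g1(1)] q(2,3) qs ax ay by simp_all
    have s2: "src D g2 = src D (tL a x)" "tgt D g2 = src D (tL a y)" "g2 \<in> arr D"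
      using K.D.qsqD[OF g2(1)] q(2,3) qs ax ay by simp_all
    have "K.Ha (idm A a) f = L.Ha (idm A a) f" using g good Suc(3) by simp
    then have l: "lK a y \<odot>\<^bsub>D\<^esub> g1 = lK a y \<odot>\<^bsub>D\<^esub> g2" and t: "tK a y \<odot>\<^bsub>D\<^esub> g1 = tK a y \<odot>\<^bsub>D\<^esub> g2"
      using g1(2,3) g2(2,3) ex ey IH by simp_all
    have "g1 = g2"
      by (rule K.D.dsq_mono[OF K.cone[OF ay] s1(3) s2(3) s1(2) _ _ l t])
        (simp_all only: s1 s2 ex ey)
    \<comment> \<open>\<open>qsq_unique\<close> asks for a common target, which is supplied by
      agreement on \<open>idm U y\<close>.\<close>
    moreover have "tgt D (K.Ha (idm A a) f') = tgt D (L.Ha (idm A a) f')"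
      using ob[OF g(5) qs(2) Suc(3)] qs q(3) Suc(3) by simp
    ultimately have f: "K.Ha (idm A a) f' = L.Ha (idm A a) f'"
      using K.D.qsq_unique g1(1) g2(1) by blast
    from arg_cong[OF this, of "src D"] have o: "K.Ho a x = L.Ho a x"
      using qs q(2) Suc(3) by simp
    then have "K.Ha (idm A a) (pr U x) = L.Ha (idm A a) (pr U x)" "K.Ha (pr A a) (idm U x) = L.Ha (pr A a) (idm U x)"
      using K.tp_pr[OF ax] L.tp_pr[OF ax] K.lp_pr[OF ax] L.lp_pr[OF ax] ex by simp_all
    with f show ?case by simp
  qed
  \<comment> \<open>Splits off the arrow of \<open>A\<close>, so that only identities of
    \<open>A\<close> and identities of \<open>U\<close> have to be treated.\<close>
  have factor: "K.Ha f k = K.Ha f (idm U (tgt U k)) \<odot>\<^bsub>D\<^esub> K.Ha (idm A (src A f)) k"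
    "L.Ha f k = L.Ha f (idm U (tgt U k)) \<odot>\<^bsub>D\<^esub> L.Ha (idm A (src A f)) k"
    if "f \<in> arr A" "k \<in> arr U" for f k
    using that by simp_all
  have "generating B C U G tG lG Y"
  proof
    fix f g assume "f \<in> arr B" "g \<in> arr C"
    then show "G.Ha f g \<in> Y"
      using agree[of _ f g] agree[of _ "idm B (src B f)" "idm C (src C g)"] agree[of _ "idm B (tgt B f)" "idm C (tgt C g)"]
      by (simp add: Y_def good_def)
  next
    fix f g assume fg: "f \<in> Y" "g \<in> Y" "src U g = tgt U f"
    have arrs: "f \<in> arr U" "g \<in> arr U" using fg by (simp_all add: Y_def)
    have "K.Ha h (g \<odot>\<^bsub>U\<^esub> f) = L.Ha h (g \<odot>\<^bsub>U\<^esub> f)" if h: "h \<in> arr A" for h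
    proof -
      have "K.Ha h (g \<odot>\<^bsub>U\<^esub> f) = K.Ha h g \<odot>\<^bsub>D\<^esub> K.Ha (idm A (src A h)) f"
        using h arrs fg(3) by simp
      also have "\<dots> = L.Ha h g \<odot>\<^bsub>D\<^esub> L.Ha (idm A (src A h)) f"
        using good[of g h] good[of f "idm A (src A h)"] fg h by (simp add: Y_def)
      also have "\<dots> = L.Ha h (g \<odot>\<^bsub>U\<^esub> f)"
        using h arrs fg(3) by simp
      finally show ?thesis .
    qed
    then show "g \<odot>\<^bsub>U\<^esub> f \<in> Y" using fg arrs by (simp add: Y_def good_def)
  next
    fix f' f assume q: "qsq U f' f" "pr U (tgt U f') \<in> Y" "f \<in> Y"
    let ?x = "src U f'" and ?y = "tgt U f'"
    note qs = G.D.qsq_sides[OF q(1) refl refl]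
    note lf = left[OF q(1) refl refl q(3,2)]
    have g: "good f" "good (idm U (ft U ?x))" "good (idm U (ft U ?y))" "good (pr U ?y)" "good (idm U ?y)"
      using q(2,3) qs by (simp_all add: Y_def)
    have ox: "K.Ho a ?x = L.Ho a ?x" if "a \<in> ob A" for a
      using lf[OF that] qs(13) that K.src_Ha[of "idm A a" f'] L.src_Ha[of "idm A a" f'] by simp
    \<comment> \<open>Agreement on \<open>idm U ?x\<close> is tested on the jointly monic images of
      \<open>pr U ?x\<close> and \<open>f'\<close>; there it follows from interchange with arrows
      already known to agree.\<close>
    have idx: "K.Ha h (idm U ?x) = L.Ha h (idm U ?x)" if h: "h \<in> arr A" for h
    proof (rule K.qsq_Ha_right_mono[OF q(1) refl refl, of "tgt A h"])
      have "K.Ha (idm A (tgt A h)) (pr U ?x) \<odot>\<^bsub>D\<^esub> K.Ha h (idm U ?x) = K.Ha h (idm U (ft U ?x)) \<odot>\<^bsub>D\<^esub> K.Ha (idm A (src A h)) (pr U ?x)"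
        using h qs by simp
      also have "\<dots> = L.Ha h (idm U (ft U ?x)) \<odot>\<^bsub>D\<^esub> L.Ha (idm A (src A h)) (pr U ?x)"
        using lf[of "src A h"] good[OF g(2) h] h by simp
      also have "\<dots> = L.Ha (idm A (tgt A h)) (pr U ?x) \<odot>\<^bsub>D\<^esub> L.Ha h (idm U ?x)"
        using h qs by simp
      finally show "K.Ha (idm A (tgt A h)) (pr U ?x) \<odot>\<^bsub>D\<^esub> K.Ha h (idm U ?x) = K.Ha (idm A (tgt A h)) (pr U ?x) \<odot>\<^bsub>D\<^esub> L.Ha h (idm U ?x)"
        using lf[of "tgt A h"] h by simp
      have "K.Ha (idm A (tgt A h)) f' \<odot>\<^bsub>D\<^esub> K.Ha h (idm U ?x) = K.Ha h (idm U ?y) \<odot>\<^bsub>D\<^esub> K.Ha (idm A (src A h)) f'"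
        using h qs by simp
      also have "\<dots> = L.Ha h (idm U ?y) \<odot>\<^bsub>D\<^esub> L.Ha (idm A (src A h)) f'"
        using lf[of "src A h"] good[OF g(5) h] h by simp
      also have "\<dots> = L.Ha (idm A (tgt A h)) f' \<odot>\<^bsub>D\<^esub> L.Ha h (idm U ?x)"
        using h qs by simp
      finally show "K.Ha (idm A (tgt A h)) f' \<odot>\<^bsub>D\<^esub> K.Ha h (idm U ?x) = K.Ha (idm A (tgt A h)) f' \<odot>\<^bsub>D\<^esub> L.Ha h (idm U ?x)"
        using lf[of "tgt A h"] h by simp
    qed (use h qs ox in simp_all)
    have "K.Ha h f' = L.Ha h f'" "K.Ha h (pr U ?x) = L.Ha h (pr U ?x)" if h: "h \<in> arr A" for h
      using factor[OF h qs(13)] factor[OF h qs(5)] good[OF g(5) h] good[OF g(2) h] lf[of "src A h"] h qs(7)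
      by (simp_all del: K.Ha_comp L.Ha_comp)
    then show "f' \<in> Y \<and> pr U ?x \<in> Y"
      using idx g qs by (simp add: Y_def good_def)
  next
    fix f' f m assume q: "qsq U f' f" "f' \<in> Y" "f \<in> Y" "pr U (src U f') \<in> Y" "pr U (tgt U f') \<in> Y" and m: "m \<in> arr U"
      "tgt U m = src U f'" "pr U (src U f') \<odot>\<^bsub>U\<^esub> m \<in> Y" "f' \<odot>\<^bsub>U\<^esub> m \<in> Y"
    let ?x = "src U f'" and ?y = "tgt U f'"
    note qs = G.D.qsq_sides[OF q(1) refl refl]
    have g: "good f'" "good (pr U ?x)" "good (idm U ?x)" "good (pr U ?x \<odot>\<^bsub>U\<^esub> m)" "good (f' \<odot>\<^bsub>U\<^esub> m)" "good (idm U (src U m))"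
      using q m qs by (simp_all add: Y_def)
    have "K.Ha h m = L.Ha h m" if h: "h \<in> arr A" for h
    proof (rule K.qsq_Ha_right_mono[OF q(1) refl refl, of "tgt A h"])
      have "K.Ha (idm A (tgt A h)) (pr U ?x) \<odot>\<^bsub>D\<^esub> K.Ha h m = K.Ha h (pr U ?x \<odot>\<^bsub>U\<^esub> m)"
        using h m qs by simp
      also have "\<dots> = L.Ha h (pr U ?x \<odot>\<^bsub>U\<^esub> m)" by (rule good[OF g(4) h])
      also have "\<dots> = L.Ha (idm A (tgt A h)) (pr U ?x) \<odot>\<^bsub>D\<^esub> L.Ha h m"
        using h m qs by simp
      finally show "K.Ha (idm A (tgt A h)) (pr U ?x) \<odot>\<^bsub>D\<^esub> K.Ha h m = K.Ha (idm A (tgt A h)) (pr U ?x) \<odot>\<^bsub>D\<^esub> L.Ha h m"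
        using good[OF g(2), of "idm A (tgt A h)"] h by simp
      have "K.Ha (idm A (tgt A h)) f' \<odot>\<^bsub>D\<^esub> K.Ha h m = K.Ha h (f' \<odot>\<^bsub>U\<^esub> m)"
        using h m qs by simp
      also have "\<dots> = L.Ha h (f' \<odot>\<^bsub>U\<^esub> m)" by (rule good[OF g(5) h])
      also have "\<dots> = L.Ha (idm A (tgt A h)) f' \<odot>\<^bsub>D\<^esub> L.Ha h m"
        using h m qs by simp
      finally show "K.Ha (idm A (tgt A h)) f' \<odot>\<^bsub>D\<^esub> K.Ha h m = K.Ha (idm A (tgt A h)) f' \<odot>\<^bsub>D\<^esub> L.Ha h m"
        using good[OF g(1), of "idm A (tgt A h)"] h by simp
    qed (use h m qs ob[OF g(3)] ob[OF g(6)] in simp_all)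
    then show "m \<in> Y" using m g by (simp add: Y_def good_def)
  qed (auto simp: Y_def)
  from generating.generates[OF this \<open>k \<in> arr U\<close>] have "good k" by (simp add: Y_def)
  then show ?thesis using good \<open>f \<in> arr A\<close> by blast
qed

section \<open>Lifting a functor of three variables along isomorphisms\<close>

text \<open>A left inverse gives left cancellation and is preserved by every functor, also in two
  variables at once; the components of the symmetries enter through
  \<open>is_iso_split_mono\<close>.\<close>

definition split_mono :: "'u contextual \<Rightarrow> 'u \<Rightarrow> bool" where
  "split_mono D f \<longleftrightarrow> f \<in> arr D \<and>
     (\<exists>g\<in>arr D. src D g = tgt D f \<and> tgt D g = src D f \<and> g \<odot>\<^bsub>D\<^esub> f = idm D (src D f))"

lemma split_mono_arr: "split_mono D f \<Longrightarrow> f \<in> arr D"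
  by (simp add: split_mono_def)

context contextual_cat
begin

lemma is_iso_split_mono: "is_iso D f \<Longrightarrow> split_mono D f"
  by (auto simp: is_iso_def split_mono_def hom_set_def)

lemma split_mono_comp:
  assumes "split_mono D f" "split_mono D g" "src D g = tgt D f"
  shows "split_mono D (g \<odot> f)"
proof -
  obtain f' where f: "f \<in> arr D" "f' \<in> arr D" "src D f' = tgt D f" "tgt D f' = src D f" "f' \<odot> f = idm D (src D f)"
    using assms(1) by (auto simp: split_mono_def)
  obtain g' where g: "g \<in> arr D" "g' \<in> arr D" "src D g' = tgt D g" "tgt D g' = src D g" "g' \<odot> g = idm D (src D g)"
    using assms(2) by (auto simp: split_mono_def)
  have "(f' \<odot> g') \<odot> (g \<odot> f) = f' \<odot> ((g' \<odot> g) \<odot> f)"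
    using f(1-4) g(1-4) assms(3) by simp
  also have "\<dots> = idm D (src D f)"
    unfolding g(5) using f assms(3) by simp
  finally show ?thesis
    using f(1-4) g(1-4) assms(3) unfolding split_mono_def by (intro conjI bexI[of _ "f' \<odot> g'"]) simp_all
qed

lemma split_mono_cancel:
  assumes "split_mono D f" "u \<in> arr D" "v \<in> arr D" "tgt D u = src D f" "tgt D v = src D f" "f \<odot> u = f \<odot> v"
  shows "u = v"
proof -
  obtain f' where f: "f \<in> arr D" "f' \<in> arr D" "src D f' = tgt D f" "f' \<odot> f = idm D (src D f)"
    using assms(1) by (auto simp: split_mono_def)
  have "u = f' \<odot> (f \<odot> u)" "v = f' \<odot> (f \<odot> v)"
    using comp_eq[OF f(4)] f(1-3) assms(2-5) by simp_all
  then show ?thesis using assms(6) by simp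
qed

end

lemma (in contextual_fun) split_mono_map:
  assumes "split_mono D f" shows "split_mono E (farr N f)"
proof -
  obtain f' where f: "f \<in> arr D" "f' \<in> arr D" "src D f' = tgt D f" "tgt D f' = src D f" "f' \<odot>\<^bsub>D\<^esub> f = idm D (src D f)"
    using assms by (auto simp: split_mono_def)
  have "farr N f' \<odot>\<^bsub>E\<^esub> farr N f = idm E (fob N (src D f))"
    using arg_cong[OF f(5), of "farr N"] f(1-4) by simp
  then show ?thesis using f(1-4) unfolding split_mono_def by (intro conjI bexI[of _ "farr N f'"]) simp_all
qed

lemma (in bifunctor) split_mono_Ha:
  assumes "split_mono A f" "split_mono B g" shows "split_mono D (Ha f g)"
proof -
  obtain f' where f: "f \<in> arr A" "f' \<in> arr A" "src A f' = tgt A f" "tgt A f' = src A f" "f' \<odot>\<^bsub>A\<^esub> f = idm A (src A f)"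
    using assms by (auto simp: split_mono_def)
  obtain g' where g: "g \<in> arr B" "g' \<in> arr B" "src B g' = tgt B g" "tgt B g' = src B g" "g' \<odot>\<^bsub>B\<^esub> g = idm B (src B g)"
    using assms by (auto simp: split_mono_def)
  show ?thesis using f g unfolding split_mono_def by (intro conjI bexI[of _ "Ha f' g'"]) simp_all
qed

lemma (in contextual_cat) split_mono_idm: "x \<in> ob D \<Longrightarrow> split_mono D (idm D x)"
  unfolding split_mono_def by (intro conjI bexI[of _ "idm D x"]) simp_all

text \<open>\<open>q1\<close>, \<open>q2\<close>, \<open>q3\<close> are the projections from \<open>\<partial>(G(a, b, c))\<close> that correspond to the projections
  \<open>p1\<close>, \<open>p2\<close>, \<open>p3\<close> from \<open>\<partial>(F(a, b, c))\<close>.\<close>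

locale cube_lift = A: contextual_cat A + B: contextual_cat B + C: contextual_cat C + D: contextual_cat D
  for A B C D :: "'u contextual" +
  fixes F G Fo Go \<psi> p1 p2 p3 q1 q2 q3 :: "'u \<Rightarrow> 'u \<Rightarrow> 'u \<Rightarrow> 'u"
  assumes F_hom: "f \<in> arr A \<Longrightarrow> g \<in> arr B \<Longrightarrow> h \<in> arr C \<Longrightarrow>
      F f g h \<in> arr D \<and> src D (F f g h) = Fo (src A f) (src B g) (src C h) \<and>
      tgt D (F f g h) = Fo (tgt A f) (tgt B g) (tgt C h)"
    and one: "a \<in> ob A \<Longrightarrow> b \<in> ob B \<Longrightarrow> c \<in> ob C \<Longrightarrow> len A a = 0 \<or> len B b = 0 \<or> len C c = 0 \<Longrightarrow>
      Fo a b c = one_ob D \<and> Go a b c = one_ob D"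
    and \<psi>: "a \<in> ob A \<Longrightarrow> b \<in> ob B \<Longrightarrow> c \<in> ob C \<Longrightarrow>
      split_mono D (\<psi> a b c) \<and> src D (\<psi> a b c) = Fo a b c \<and> tgt D (\<psi> a b c) = Go a b c"
    and \<psi>_natural: "f \<in> arr A \<Longrightarrow> g \<in> arr B \<Longrightarrow> h \<in> arr C \<Longrightarrow>
      \<psi> (tgt A f) (tgt B g) (tgt C h) \<odot>\<^bsub>D\<^esub> F f g h = G f g h \<odot>\<^bsub>D\<^esub> \<psi> (src A f) (src B g) (src C h)"
    and cube: "a \<in> ob A \<Longrightarrow> b \<in> ob B \<Longrightarrow> c \<in> ob C \<Longrightarrow> 1 \<le> len A a \<Longrightarrow> 1 \<le> len B b \<Longrightarrow> 1 \<le> len C c \<Longrightarrow>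
      cube_cone A B C D F a b c (p1 a b c) (p2 a b c) (p3 a b c) \<and> src D (p3 a b c) = ft D (Fo a b c)"
    and q_mono: "a \<in> ob A \<Longrightarrow> b \<in> ob B \<Longrightarrow> c \<in> ob C \<Longrightarrow> 1 \<le> len A a \<Longrightarrow> 1 \<le> len B b \<Longrightarrow> 1 \<le> len C c \<Longrightarrow>
      m \<in> arr D \<Longrightarrow> m' \<in> arr D \<Longrightarrow> tgt D m = ft D (Go a b c) \<Longrightarrow> tgt D m' = ft D (Go a b c) \<Longrightarrow> src D m = src D m' \<Longrightarrow>
      q1 a b c \<odot>\<^bsub>D\<^esub> m = q1 a b c \<odot>\<^bsub>D\<^esub> m' \<Longrightarrow> q2 a b c \<odot>\<^bsub>D\<^esub> m = q2 a b c \<odot>\<^bsub>D\<^esub> m' \<Longrightarrow>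
      q3 a b c \<odot>\<^bsub>D\<^esub> m = q3 a b c \<odot>\<^bsub>D\<^esub> m' \<Longrightarrow> m = m'"
    and lift: "a \<in> ob A \<Longrightarrow> b \<in> ob B \<Longrightarrow> c \<in> ob C \<Longrightarrow> 1 \<le> len A a \<Longrightarrow> 1 \<le> len B b \<Longrightarrow> 1 \<le> len C c \<Longrightarrow>
      \<exists>k. qsq D (\<psi> a b c) k \<and>
        q1 a b c \<odot>\<^bsub>D\<^esub> k = \<psi> (ft A a) b c \<odot>\<^bsub>D\<^esub> p1 a b c \<and>
        q2 a b c \<odot>\<^bsub>D\<^esub> k = \<psi> a (ft B b) c \<odot>\<^bsub>D\<^esub> p2 a b c \<and>
        q3 a b c \<odot>\<^bsub>D\<^esub> k = \<psi> a b (ft C c) \<odot>\<^bsub>D\<^esub> p3 a b c"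
begin

lemma \<psi>_arr [simp]: "a \<in> ob A \<Longrightarrow> b \<in> ob B \<Longrightarrow> c \<in> ob C \<Longrightarrow> \<psi> a b c \<in> arr D"
  and src_\<psi> [simp]: "a \<in> ob A \<Longrightarrow> b \<in> ob B \<Longrightarrow> c \<in> ob C \<Longrightarrow> src D (\<psi> a b c) = Fo a b c"
  and tgt_\<psi> [simp]: "a \<in> ob A \<Longrightarrow> b \<in> ob B \<Longrightarrow> c \<in> ob C \<Longrightarrow> tgt D (\<psi> a b c) = Go a b c"
  using \<psi> by (auto simp: split_mono_def)

end

text \<open>Both functors lie over the same \<open>G\<close> with the same projections
  \<open>q1\<close>, \<open>q2\<close>, \<open>q3\<close>. Each \<psi> is the top of an element of
  \<open>sqs\<close> with a prescribed right side, whose bottom is determined by \<psi> at the three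
  lowered triples.\<close>

lemma cube_lift_unique:
  assumes "cube_lift A B C D F G Fo Go \<psi> p1 p2 p3 q1 q2 q3"
    and "cube_lift A B C D F' G Fo' Go \<psi>' p1' p2' p3' q1 q2 q3"
  shows "f \<in> arr A \<Longrightarrow> g \<in> arr B \<Longrightarrow> h \<in> arr C \<Longrightarrow> F f g h = F' f g h"
proof -
  interpret X: cube_lift A B C D F G Fo Go \<psi> p1 p2 p3 q1 q2 q3 by fact
  interpret Y: cube_lift A B C D F' G Fo' Go \<psi>' p1' p2' p3' q1 q2 q3 by fact
  \<comment> \<open>Naturality and left cancellation recover an arrow from \<psi> at its two ends;
    equality of \<psi> also makes the objects match.\<close>
  have transfer: "F f g h = F' f g h"
    if f: "f \<in> arr A" "g \<in> arr B" "h \<in> arr C"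
      and e: "\<psi> (src A f) (src B g) (src C h) = \<psi>' (src A f) (src B g) (src C h)"
        "\<psi> (tgt A f) (tgt B g) (tgt C h) = \<psi>' (tgt A f) (tgt B g) (tgt C h)" for f g h
  proof (rule X.D.split_mono_cancel)
    show "split_mono D (\<psi> (tgt A f) (tgt B g) (tgt C h))" using X.\<psi> f by simp
    show "\<psi> (tgt A f) (tgt B g) (tgt C h) \<odot>\<^bsub>D\<^esub> F f g h = \<psi> (tgt A f) (tgt B g) (tgt C h) \<odot>\<^bsub>D\<^esub> F' f g h"
      using X.\<psi>_natural[OF f] Y.\<psi>_natural[OF f] e by simp
    have "Fo (tgt A f) (tgt B g) (tgt C h) = Fo' (tgt A f) (tgt B g) (tgt C h)"
      using arg_cong[OF e(2), of "src D"] f by simp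
    then show "tgt D (F' f g h) = src D (\<psi> (tgt A f) (tgt B g) (tgt C h))"
      using Y.F_hom[OF f] f by simp
  qed (use X.F_hom[OF f] Y.F_hom[OF f] f in simp_all)
  have \<psi>: "a \<in> ob A \<Longrightarrow> b \<in> ob B \<Longrightarrow> c \<in> ob C \<Longrightarrow> \<psi> a b c = \<psi>' a b c" for a b c
  proof (induction "len A a + len B b + len C c" arbitrary: a b c rule: less_induct)
    case less
    note ob = less(2-4)
    show ?case
    proof (cases "1 \<le> len A a \<and> 1 \<le> len B b \<and> 1 \<le> len C c")
      case False
      \<comment> \<open>In this case both components are maps from the terminal object to
        itself.\<close>
      then have z: "len A a = 0 \<or> len B b = 0 \<or> len C c = 0" by auto
      show ?thesis
        using X.one[OF ob z] Y.one[OF ob z] ob by - (rule X.D.terminal; simp)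
    next
      case True
      then have l: "1 \<le> len A a" "1 \<le> len B b" "1 \<le> len C c" by simp_all
      have dec: "len A (ft A a) < len A a" "len B (ft B b) < len B b" "len C (ft C c) < len C c"
        using X.A.len_ft[OF ob(1) l(1)] X.B.len_ft[OF ob(2) l(2)] X.C.len_ft[OF ob(3) l(3)] l by simp_all
      have IH: "\<psi> a' b' c' = \<psi>' a' b' c'"
        if "a' = a \<or> a' = ft A a" "b' = b \<or> b' = ft B b" "c' = c \<or> c' = ft C c" "\<not> (a' = a \<and> b' = b \<and> c' = c)" for a' b' c'
        using that dec ob by (intro less(1)) auto
      note cX = X.cube[OF ob l] and cY = Y.cube[OF ob l]
      \<comment> \<open>Each lowered triple differs from the given one, so the induction hypothesis
        covers all arrows that occur in \<open>cube_cone\<close>.\<close>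
      have na: "ft A a \<noteq> a" "ft B b \<noteq> b" "ft C c \<noteq> c" using dec by auto
      have p: "p1 a b c = p1' a b c" "p2 a b c = p2' a b c" "p3 a b c = p3' a b c"
        by (rule X.D.cube_cone_unique[OF conjunct1[OF cX] conjunct1[OF cY]];
            rule transfer; use ob l na in \<open>simp add: IH\<close>)+
      have o: "ft D (Fo a b c) = ft D (Fo' a b c)" using cX cY p by simp
      obtain k where k: "qsq D (\<psi> a b c) k"
          "q1 a b c \<odot>\<^bsub>D\<^esub> k = \<psi> (ft A a) b c \<odot>\<^bsub>D\<^esub> p1 a b c"
          "q2 a b c \<odot>\<^bsub>D\<^esub> k = \<psi> a (ft B b) c \<odot>\<^bsub>D\<^esub> p2 a b c"
          "q3 a b c \<odot>\<^bsub>D\<^esub> k = \<psi> a b (ft C c) \<odot>\<^bsub>D\<^esub> p3 a b c"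
        using X.lift[OF ob l] by blast
      obtain k' where k': "qsq D (\<psi>' a b c) k'"
          "q1 a b c \<odot>\<^bsub>D\<^esub> k' = \<psi>' (ft A a) b c \<odot>\<^bsub>D\<^esub> p1' a b c"
          "q2 a b c \<odot>\<^bsub>D\<^esub> k' = \<psi>' a (ft B b) c \<odot>\<^bsub>D\<^esub> p2' a b c"
          "q3 a b c \<odot>\<^bsub>D\<^esub> k' = \<psi>' a b (ft C c) \<odot>\<^bsub>D\<^esub> p3' a b c"
        using Y.lift[OF ob l] by blast
      have "k = k'"
      proof (rule X.q_mono[OF ob l])
        show "q1 a b c \<odot>\<^bsub>D\<^esub> k = q1 a b c \<odot>\<^bsub>D\<^esub> k'" using k(2) k'(2) p IH na by simp
        show "q2 a b c \<odot>\<^bsub>D\<^esub> k = q2 a b c \<odot>\<^bsub>D\<^esub> k'" using k(3) k'(3) p IH na by simp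
        show "q3 a b c \<odot>\<^bsub>D\<^esub> k = q3 a b c \<odot>\<^bsub>D\<^esub> k'" using k(4) k'(4) p IH na by simp
      qed (use X.D.qsqD[OF k(1)] X.D.qsqD[OF k'(1)] ob o in simp_all)
      then show ?thesis using X.D.qsq_unique k(1) k'(1) ob by simp
    qed
  qed
  show "f \<in> arr A \<Longrightarrow> g \<in> arr B \<Longrightarrow> h \<in> arr C \<Longrightarrow> F f g h = F' f g h"
    by (intro transfer \<psi>) simp_all
qed

section \<open>Tensor products, associators and symmetries\<close>

locale tensor =
  fixes t :: "'u tensor" (structure)
  assumes tensor_choice: "tensor_choice t"
begin

abbreviation tt where "tt A B \<equiv> bi_tp A B (A \<otimes> B) (tmap t A B)"
abbreviation tl where "tl A B \<equiv> bi_lp A B (A \<otimes> B) (tmap t A B)"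

lemma universal_cones:
  assumes "contextual_category A" "contextual_category B"
  shows "universal_cones A B (A \<otimes> B) (tmap t A B) (tt A B) (tl A B)"
proof -
  have u: "universal_bimorphism A B (A \<otimes> B) (tmap t A B)"
    using tensor_choice assms by (simp add: tensor_choice_def)
  then have "bimorphism_cones A B (A \<otimes> B) (tmap t A B) (tt A B) (tl A B)"
    using assms by (intro bimorphism_cones) (simp_all add: contextual_cat_def universal_bimorphism_def)
  then show ?thesis using u by (simp add: universal_cones_def universal_cones_axioms_def)
qed

lemma contextual_tensor: "contextual_category A \<Longrightarrow> contextual_category B \<Longrightarrow> contextual_category (A \<otimes> B)"
  using tensor_choice by (simp add: tensor_choice_def universal_bimorphism_def)

text \<open>Existence and uniqueness behind the definite description, from the universal property
  applied to \<open>tmap t A' B'\<close> precomposed with \<open>F\<close> and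
  \<open>G\<close>.\<close>

lemma tensor_fctr:
  assumes "contextual_fun A A' F" "contextual_fun B B' G"
  shows "contextual_functor (A \<otimes> B) (A' \<otimes> B') (tensor_fctr t A B A' B' F G)"
    and "f \<in> arr A \<Longrightarrow> g \<in> arr B \<Longrightarrow>
      farr (tensor_fctr t A B A' B' F G) (tensor_arr t A B f g) = tensor_arr t A' B' (farr F f) (farr G g)"
proof -
  interpret F: contextual_fun A A' F by fact
  interpret G: contextual_fun B B' G by fact
  interpret S: universal_cones A B "A \<otimes> B" "tmap t A B" "tt A B" "tl A B"
    using universal_cones F.D.contextual G.D.contextual .
  interpret T: universal_cones A' B' "A' \<otimes> B'" "tmap t A' B'" "tt A' B'" "tl A' B'"
    using universal_cones F.E.contextual G.E.contextual .
  interpret P: bimorphism_cones A B "A' \<otimes> B'" "bi_precomp A B (tmap t A' B') F G"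
    "\<lambda>a b. tt A' B' (fob F a) (fob G b)" "\<lambda>a b. tl A' B' (fob F a) (fob G b)"
    by (rule bimorphism_cones_precomp) unfold_locales
  obtain N where N: "contextual_functor (A \<otimes> B) (A' \<otimes> B') N"
    "\<And>f g. f \<in> arr A \<Longrightarrow> g \<in> arr B \<Longrightarrow> farr N (S.Ha f g) = farr (bi_precomp A B (tmap t A' B') F G) (f, g)"
    using S.functor_ex[OF T.D.contextual_cat_axioms P.bimorphism] by metis
  have "\<exists>!N. contextual_functor (A \<otimes> B) (A' \<otimes> B') N \<and>
    (\<forall>f\<in>arr A. \<forall>g\<in>arr B. farr N (S.Ha f g) = T.Ha (farr F f) (farr G g))"
  proof (rule ex1I[of _ N])
    show "contextual_functor (A \<otimes> B) (A' \<otimes> B') N \<and>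
      (\<forall>f\<in>arr A. \<forall>g\<in>arr B. farr N (S.Ha f g) = T.Ha (farr F f) (farr G g))"
      using N by simp
    fix N' assume N': "contextual_functor (A \<otimes> B) (A' \<otimes> B') N' \<and>
      (\<forall>f\<in>arr A. \<forall>g\<in>arr B. farr N' (S.Ha f g) = T.Ha (farr F f) (farr G g))"
    show "N' = N"
      by (rule S.functor_unique[OF T.D.contextual_cat_axioms conjunct1[OF N'] N(1)]) (use N' N(2) in simp)
  qed
  from theI'[OF this]
  have "contextual_functor (A \<otimes> B) (A' \<otimes> B') (tensor_fctr t A B A' B' F G) \<and>
    (\<forall>f\<in>arr A. \<forall>g\<in>arr B. farr (tensor_fctr t A B A' B' F G) (S.Ha f g) = T.Ha (farr F f) (farr G g))"
    unfolding tensor_fctr_def .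
  then show "contextual_functor (A \<otimes> B) (A' \<otimes> B') (tensor_fctr t A B A' B' F G)"
    and "f \<in> arr A \<Longrightarrow> g \<in> arr B \<Longrightarrow>
      farr (tensor_fctr t A B A' B' F G) (tensor_arr t A B f g) = tensor_arr t A' B' (farr F f) (farr G g)"
    by simp_all
qed

text \<open>Both nestings carry cube cones, and after applying \<alpha> these belong to functors
  with the same values on pure tensors, so uniqueness of the cube cone matches the three
  projections.\<close>

lemma associator_cones:
  assumes "contextual_category A" "contextual_category B" "contextual_category C" "is_associator t A B C \<alpha>"
    and "a \<in> ob A" "b \<in> ob B" "c \<in> ob C" "1 \<le> len A a" "1 \<le> len B b" "1 \<le> len C c"
  defines "x \<equiv> fob (tmap t B C) (b, c)" and "y \<equiv> fob (tmap t A B) (a, b)"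
  shows "farr \<alpha> (tl A (B \<otimes> C) a x) = tensor_arr t (A \<otimes> B) C (tl A B a b) (idm C c) \<odot>\<^bsub>(A \<otimes> B) \<otimes> C\<^esub> tl (A \<otimes> B) C y c"
    "farr \<alpha> (tensor_arr t A (B \<otimes> C) (idm A a) (tl B C b c) \<odot>\<^bsub>A \<otimes> (B \<otimes> C)\<^esub> tt A (B \<otimes> C) a x) =
      tensor_arr t (A \<otimes> B) C (tt A B a b) (idm C c) \<odot>\<^bsub>(A \<otimes> B) \<otimes> C\<^esub> tl (A \<otimes> B) C y c"
    "farr \<alpha> (tensor_arr t A (B \<otimes> C) (idm A a) (tt B C b c) \<odot>\<^bsub>A \<otimes> (B \<otimes> C)\<^esub> tt A (B \<otimes> C) a x) = tt (A \<otimes> B) C y c"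
proof -
  interpret BC: universal_cones B C "B \<otimes> C" "tmap t B C" "tt B C" "tl B C"
    using universal_cones assms by blast
  interpret AU: universal_cones A "B \<otimes> C" "A \<otimes> (B \<otimes> C)" "tmap t A (B \<otimes> C)" "tt A (B \<otimes> C)" "tl A (B \<otimes> C)"
    using universal_cones contextual_tensor assms by blast
  interpret AB: universal_cones A B "A \<otimes> B" "tmap t A B" "tt A B" "tl A B"
    using universal_cones assms by blast
  interpret UC: universal_cones "A \<otimes> B" C "(A \<otimes> B) \<otimes> C" "tmap t (A \<otimes> B) C" "tt (A \<otimes> B) C" "tl (A \<otimes> B) C"
    using universal_cones contextual_tensor assms by blast
  have "contextual_functor (A \<otimes> (B \<otimes> C)) ((A \<otimes> B) \<otimes> C) \<alpha>"
    using assms(4) by (simp add: is_associator_def)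
  then interpret \<alpha>: contextual_fun "A \<otimes> (B \<otimes> C)" "(A \<otimes> B) \<otimes> C" \<alpha>
    by unfold_locales
  have \<alpha>: "farr \<alpha> (AU.Ha f (BC.Ha g h)) = UC.Ha (AB.Ha f g) h" if "f \<in> arr A" "g \<in> arr B" "h \<in> arr C" for f g h
    using assms(4) that by (simp add: is_associator_def)
  interpret R: bimorphism_right A B C "B \<otimes> C" "A \<otimes> (B \<otimes> C)" "tmap t B C" "tt B C" "tl B C"
     "tmap t A (B \<otimes> C)" "tt A (B \<otimes> C)" "tl A (B \<otimes> C)" by unfold_locales
  interpret L: bimorphism_left A B C "A \<otimes> B" "(A \<otimes> B) \<otimes> C" "tmap t A B" "tt A B" "tl A B"
     "tmap t (A \<otimes> B) C" "tt (A \<otimes> B) C" "tl (A \<otimes> B) C" by unfold_locales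
  note c = \<alpha>.cube_cone_map[OF R.cube_cone[OF assms(5-10)]] L.cube_cone[OF assms(5-10)]
  have e: "farr \<alpha> (AU.Ha f (BC.Ha g h)) = UC.Ha (AB.Ha f g) h"
    if "f \<in> {idm A a, idm A (ft A a), pr A a}" "g \<in> {idm B b, idm B (ft B b), pr B b}" "h \<in> {idm C c, idm C (ft C c), pr C c}"
    for f g h
    using that assms(5-10) by (intro \<alpha>) auto
  show "farr \<alpha> (tl A (B \<otimes> C) a x) = tensor_arr t (A \<otimes> B) C (tl A B a b) (idm C c) \<odot>\<^bsub>(A \<otimes> B) \<otimes> C\<^esub> tl (A \<otimes> B) C y c"
    "farr \<alpha> (tensor_arr t A (B \<otimes> C) (idm A a) (tl B C b c) \<odot>\<^bsub>A \<otimes> (B \<otimes> C)\<^esub> tt A (B \<otimes> C) a x) =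
      tensor_arr t (A \<otimes> B) C (tt A B a b) (idm C c) \<odot>\<^bsub>(A \<otimes> B) \<otimes> C\<^esub> tl (A \<otimes> B) C y c"
    "farr \<alpha> (tensor_arr t A (B \<otimes> C) (idm A a) (tt B C b c) \<odot>\<^bsub>A \<otimes> (B \<otimes> C)\<^esub> tt A (B \<otimes> C) a x) = tt (A \<otimes> B) C y c"
    unfolding x_def y_def by (rule UC.D.cube_cone_unique[OF c]; rule e; simp)+
qed

text \<open>The content of \<open>is_swapped_bimorphism\<close> for the tensor map, with \<phi>
  curried, the gap square expressed by \<open>qsq\<close> and its bottom \<open>k\<close> given by
  two projections. \<open>tl\<close> and \<open>tt\<close> trade places because the variables
  do.\<close>

definition symmetry_iso where
  "symmetry_iso A B \<beta> \<phi> \<longleftrightarrow>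
     (\<forall>a\<in>ob A. \<forall>b\<in>ob B. split_mono (B \<otimes> A) (\<phi> a b) \<and>
       src (B \<otimes> A) (\<phi> a b) = fob \<beta> (fob (tmap t A B) (a, b)) \<and> tgt (B \<otimes> A) (\<phi> a b) = fob (tmap t B A) (b, a)) \<and>
     (\<forall>f\<in>arr A. \<forall>g\<in>arr B. \<phi> (tgt A f) (tgt B g) \<odot>\<^bsub>B \<otimes> A\<^esub> farr \<beta> (tensor_arr t A B f g) =
       tensor_arr t B A g f \<odot>\<^bsub>B \<otimes> A\<^esub> \<phi> (src A f) (src B g)) \<and>
     (\<forall>a\<in>ob A. \<forall>b\<in>ob B. 1 \<le> len A a \<longrightarrow> 1 \<le> len B b \<longrightarrow>
       (\<exists>k. qsq (B \<otimes> A) (\<phi> a b) k \<and> tl B A b a \<odot>\<^bsub>B \<otimes> A\<^esub> k = \<phi> a (ft B b) \<odot>\<^bsub>B \<otimes> A\<^esub> farr \<beta> (tt A B a b) \<and>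
         tt B A b a \<odot>\<^bsub>B \<otimes> A\<^esub> k = \<phi> (ft A a) b \<odot>\<^bsub>B \<otimes> A\<^esub> farr \<beta> (tl A B a b)))"

lemma symmetry_iso_arr:
  assumes "symmetry_iso A B \<beta> \<phi>" "a \<in> ob A" "b \<in> ob B"
  shows "split_mono (B \<otimes> A) (\<phi> a b)" "\<phi> a b \<in> arr (B \<otimes> A)"
    "src (B \<otimes> A) (\<phi> a b) = fob \<beta> (fob (tmap t A B) (a, b))" "tgt (B \<otimes> A) (\<phi> a b) = fob (tmap t B A) (b, a)"
proof -
  have "split_mono (B \<otimes> A) (\<phi> a b) \<and> src (B \<otimes> A) (\<phi> a b) = fob \<beta> (fob (tmap t A B) (a, b)) \<and>
      tgt (B \<otimes> A) (\<phi> a b) = fob (tmap t B A) (b, a)"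
    using assms(1)[unfolded symmetry_iso_def, THEN conjunct1, rule_format, OF assms(2,3)] .
  then show "split_mono (B \<otimes> A) (\<phi> a b)" "\<phi> a b \<in> arr (B \<otimes> A)"
    "src (B \<otimes> A) (\<phi> a b) = fob \<beta> (fob (tmap t A B) (a, b))" "tgt (B \<otimes> A) (\<phi> a b) = fob (tmap t B A) (b, a)"
    by (simp_all add: split_mono_arr)
qed

lemma symmetry_iso_natural:
  assumes "symmetry_iso A B \<beta> \<phi>" "f \<in> arr A" "g \<in> arr B"
  shows "\<phi> (tgt A f) (tgt B g) \<odot>\<^bsub>B \<otimes> A\<^esub> farr \<beta> (tensor_arr t A B f g) =
    tensor_arr t B A g f \<odot>\<^bsub>B \<otimes> A\<^esub> \<phi> (src A f) (src B g)"
  using assms(1)[unfolded symmetry_iso_def, THEN conjunct2, THEN conjunct1, rule_format, OF assms(2,3)] .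

lemma symmetry_iso_qsq:
  assumes "symmetry_iso A B \<beta> \<phi>" "a \<in> ob A" "b \<in> ob B" "1 \<le> len A a" "1 \<le> len B b"
  obtains k where "qsq (B \<otimes> A) (\<phi> a b) k" "tl B A b a \<odot>\<^bsub>B \<otimes> A\<^esub> k = \<phi> a (ft B b) \<odot>\<^bsub>B \<otimes> A\<^esub> farr \<beta> (tt A B a b)"
    "tt B A b a \<odot>\<^bsub>B \<otimes> A\<^esub> k = \<phi> (ft A a) b \<odot>\<^bsub>B \<otimes> A\<^esub> farr \<beta> (tl A B a b)"
  using assms(1)[unfolded symmetry_iso_def, THEN conjunct2, THEN conjunct2, rule_format, OF assms(2-5)] by blast

text \<open>The composite of \<beta> with the tensor map has the images of \<open>tt\<close> and
  \<open>tl\<close> as projections, which evaluates the pullbacks and gap maps in the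
  definition.\<close>

lemma symmetry_iso_ex:
  assumes "contextual_category A" "contextual_category B" "is_symmetry t A B \<beta>"
  shows "\<exists>\<phi>. symmetry_iso A B \<beta> \<phi>"
proof -
  interpret AB: universal_cones A B "A \<otimes> B" "tmap t A B" "tt A B" "tl A B"
    using universal_cones assms by blast
  interpret BA: universal_cones B A "B \<otimes> A" "tmap t B A" "tt B A" "tl B A"
    using universal_cones assms by blast
  have "contextual_functor (A \<otimes> B) (B \<otimes> A) \<beta>" using assms(3) by (simp add: is_symmetry_def)
  then interpret \<beta>: contextual_fun "A \<otimes> B" "B \<otimes> A" \<beta> by unfold_locales
  let ?F = "comp_fctr (prod_cat A B) \<beta> (tmap t A B)"
  interpret F: bimorphism_cones A B "B \<otimes> A" ?F "\<lambda>a b. farr \<beta> (tt A B a b)" "\<lambda>a b. farr \<beta> (tl A B a b)"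
    by (rule bimorphism_cones_postcomp) unfold_locales
  have Fs [simp]: "f \<in> arr A \<Longrightarrow> g \<in> arr B \<Longrightarrow> farr ?F (f, g) = farr \<beta> (AB.Ha f g)"
    "a \<in> ob A \<Longrightarrow> b \<in> ob B \<Longrightarrow> fob ?F (a, b) = fob \<beta> (AB.Ho a b)" for f g a b
    by (simp_all add: prod_cat_def)
  obtain \<phi> where sw: "is_swapped_bimorphism A B (B \<otimes> A) (tmap t B A) ?F \<phi>"
    using assms(3) by (auto simp: is_symmetry_def)
  have nat: "natural_iso (prod_cat A B) (B \<otimes> A) ?F (comp_fctr (prod_cat A B) (tmap t B A) (swap_fctr A B)) \<phi>"
    using sw by (simp add: is_swapped_bimorphism_def)
  have \<phi>: "split_mono (B \<otimes> A) (\<phi> (a, b))" "\<phi> (a, b) \<in> arr (B \<otimes> A)" "src (B \<otimes> A) (\<phi> (a, b)) = fob \<beta> (AB.Ho a b)"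
    "tgt (B \<otimes> A) (\<phi> (a, b)) = BA.Ho b a" if "a \<in> ob A" "b \<in> ob B" for a b
  proof -
    have "\<phi> (a, b) \<in> hom_set (B \<otimes> A) (fob ?F (a, b)) (fob (comp_fctr (prod_cat A B) (tmap t B A) (swap_fctr A B)) (a, b)) \<and> is_iso (B \<otimes> A) (\<phi> (a, b))"
      using nat that unfolding natural_iso_def by (simp add: prod_cat_def)
    moreover have "fob (comp_fctr (prod_cat A B) (tmap t B A) (swap_fctr A B)) (a, b) = BA.Ho b a"
      using that by (simp add: prod_cat_def swap_fctr_def)
    ultimately show "split_mono (B \<otimes> A) (\<phi> (a, b))" "\<phi> (a, b) \<in> arr (B \<otimes> A)" "src (B \<otimes> A) (\<phi> (a, b)) = fob \<beta> (AB.Ho a b)"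
        "tgt (B \<otimes> A) (\<phi> (a, b)) = BA.Ho b a"
      using BA.D.is_iso_split_mono that by (auto simp: hom_set_def)
  qed
  have natural: "\<phi> (tgt A f, tgt B g) \<odot>\<^bsub>B \<otimes> A\<^esub> farr \<beta> (AB.Ha f g) = BA.Ha g f \<odot>\<^bsub>B \<otimes> A\<^esub> \<phi> (src A f, src B g)"
    if "f \<in> arr A" "g \<in> arr B" for f g
  proof -
    have "(f, g) \<in> arr (prod_cat A B)" using that by (simp add: prod_cat_def)
    then have "\<phi> (tgt (prod_cat A B) (f, g)) \<odot>\<^bsub>B \<otimes> A\<^esub> farr ?F (f, g) =
       farr (comp_fctr (prod_cat A B) (tmap t B A) (swap_fctr A B)) (f, g) \<odot>\<^bsub>B \<otimes> A\<^esub> \<phi> (src (prod_cat A B) (f, g))"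
      using nat unfolding natural_iso_def by blast
    then show ?thesis using that by (simp add: prod_cat_def swap_fctr_def)
  qed
  have sq: "\<exists>k. qsq (B \<otimes> A) (\<phi> (a, b)) k \<and> tl B A b a \<odot>\<^bsub>B \<otimes> A\<^esub> k = \<phi> (a, ft B b) \<odot>\<^bsub>B \<otimes> A\<^esub> farr \<beta> (tt A B a b) \<and>
         tt B A b a \<odot>\<^bsub>B \<otimes> A\<^esub> k = \<phi> (ft A a, b) \<odot>\<^bsub>B \<otimes> A\<^esub> farr \<beta> (tl A B a b)"
    if ab: "a \<in> ob A" "b \<in> ob B" "1 \<le> len A a" "1 \<le> len B b" for a b
  proof -
    note ba = ab(2,1,4,3)
    let ?u = "\<phi> (a, ft B b) \<odot>\<^bsub>B \<otimes> A\<^esub> farr \<beta> (tt A B a b)" and ?v = "\<phi> (ft A a, b) \<odot>\<^bsub>B \<otimes> A\<^esub> farr \<beta> (tl A B a b)"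
    have "\<forall>a\<in>ob A. \<forall>b\<in>ob B. 1 \<le> len A a \<longrightarrow> 1 \<le> len B b \<longrightarrow>
        (let P' = bi_pullback A B (B \<otimes> A) ?F a b; P = bi_pullback B A (B \<otimes> A) (tmap t B A) b a
         in distinguished (B \<otimes> A)
              \<lparr>top_side = \<phi> (a, b),
               left_side = bi_gap A B (B \<otimes> A) ?F a b, right_side = bi_gap B A (B \<otimes> A) (tmap t B A) b a,
               bottom_side = pullback_map (B \<otimes> A) P
                 (\<phi> (a, ft B b) \<odot>\<^bsub>B \<otimes> A\<^esub> top_side P')
                 (\<phi> (ft A a, b) \<odot>\<^bsub>B \<otimes> A\<^esub> left_side P')\<rparr>)"
      using sw unfolding is_swapped_bimorphism_def by blast
    from this[rule_format, OF ab]
    have ds: "dsq (B \<otimes> A) (\<phi> (a, b)) (pr (B \<otimes> A) (F.Ho a b)) (pr (B \<otimes> A) (BA.Ho b a))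
       (pullback_map (B \<otimes> A) (bi_pullback B A (B \<otimes> A) (tmap t B A) b a) ?u ?v)"
      unfolding Let_def F.cone_pullback[OF ab] square.select_convs F.cone_gap[OF ab] BA.cone_gap[OF ba] .
    \<comment> \<open>The image of the commuting cone of \<open>A \<otimes> B\<close>, transported
      by naturality of \<phi> on either side, shows that \<open>?u\<close> and \<open>?v\<close>
      form a cone, so that the bottom map denotes an arrow.\<close>
    have "BA.Ha (idm B (ft B b)) (pr A a) \<odot>\<^bsub>B \<otimes> A\<^esub> ?u = (BA.Ha (idm B (ft B b)) (pr A a) \<odot>\<^bsub>B \<otimes> A\<^esub> \<phi> (a, ft B b)) \<odot>\<^bsub>B \<otimes> A\<^esub> farr \<beta> (tt A B a b)"
      using ab \<phi> by simp
    also have "\<dots> = (\<phi> (ft A a, ft B b) \<odot>\<^bsub>B \<otimes> A\<^esub> farr \<beta> (AB.Ha (pr A a) (idm B (ft B b)))) \<odot>\<^bsub>B \<otimes> A\<^esub> farr \<beta> (tt A B a b)"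
      using natural[of "pr A a" "idm B (ft B b)"] ab by simp
    also have "\<dots> = \<phi> (ft A a, ft B b) \<odot>\<^bsub>B \<otimes> A\<^esub> farr \<beta> (AB.Ha (pr A a) (idm B (ft B b)) \<odot>\<^bsub>A \<otimes> B\<^esub> tt A B a b)"
      using ab \<phi> by simp
    also have "\<dots> = (\<phi> (ft A a, ft B b) \<odot>\<^bsub>B \<otimes> A\<^esub> farr \<beta> (AB.Ha (idm A (ft A a)) (pr B b))) \<odot>\<^bsub>B \<otimes> A\<^esub> farr \<beta> (tl A B a b)"
      unfolding AB.D.dsq_comm[OF AB.cone[OF ab]] using ab \<phi> by simp
    also have "\<dots> = (BA.Ha (pr B b) (idm A (ft A a)) \<odot>\<^bsub>B \<otimes> A\<^esub> \<phi> (ft A a, b)) \<odot>\<^bsub>B \<otimes> A\<^esub> farr \<beta> (tl A B a b)"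
      using natural[of "idm A (ft A a)" "pr B b"] ab by simp
    also have "\<dots> = BA.Ha (pr B b) (idm A (ft A a)) \<odot>\<^bsub>B \<otimes> A\<^esub> ?v"
      using ab \<phi> by simp
    finally have c: "BA.Ha (idm B (ft B b)) (pr A a) \<odot>\<^bsub>B \<otimes> A\<^esub> ?u = BA.Ha (pr B b) (idm A (ft A a)) \<odot>\<^bsub>B \<otimes> A\<^esub> ?v" .
    obtain m where m: "m \<in> arr (B \<otimes> A)" "tgt (B \<otimes> A) m = src (B \<otimes> A) (tt B A b a)"
       "tl B A b a \<odot>\<^bsub>B \<otimes> A\<^esub> m = ?u" "tt B A b a \<odot>\<^bsub>B \<otimes> A\<^esub> m = ?v"
      by (rule BA.D.dsq_univ[OF BA.cone[OF ba] _ _ _ _ _ c]) (use ab \<phi> in auto)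
    have "dsq (B \<otimes> A) (\<phi> (a, b)) (pr (B \<otimes> A) (F.Ho a b)) (pr (B \<otimes> A) (BA.Ho b a)) m"
      using ds unfolding BA.cone_pullback[OF ba] BA.D.pullback_map_eqI[OF BA.cone[OF ba] m] .
    from BA.D.dsq_qsq(1)[OF this] have "qsq (B \<otimes> A) (\<phi> (a, b)) m" using BA.len_Ho[OF ba] ab by simp
    then show ?thesis using m by blast
  qed
  show ?thesis
    unfolding symmetry_iso_def by (intro exI[of _ "\<lambda>a b. \<phi> (a, b)"] conjI ballI impI natural sq \<phi>)
qed

lemma tensor_fctr_ob:
  assumes "contextual_fun A A' F" "contextual_fun B B' G" "a \<in> ob A" "b \<in> ob B"
  shows "fob (tensor_fctr t A B A' B' F G) (fob (tmap t A B) (a, b)) = fob (tmap t A' B') (fob F a, fob G b)"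
proof -
  interpret F: contextual_fun A A' F by fact
  interpret G: contextual_fun B B' G by fact
  interpret S: universal_cones A B "A \<otimes> B" "tmap t A B" "tt A B" "tl A B"
    using universal_cones F.D.contextual G.D.contextual .
  interpret T: universal_cones A' B' "A' \<otimes> B'" "tmap t A' B'" "tt A' B'" "tl A' B'"
    using universal_cones F.E.contextual G.E.contextual .
  interpret N: contextual_fun "A \<otimes> B" "A' \<otimes> B'" "tensor_fctr t A B A' B' F G"
    using tensor_fctr(1)[OF assms(1,2)] by unfold_locales
  have "farr (tensor_fctr t A B A' B' F G) (S.Ha (idm A a) (idm B b)) = T.Ha (idm A' (fob F a)) (idm B' (fob G b))"
    using tensor_fctr(2)[OF assms(1,2), of "idm A a" "idm B b"] assms(3,4) by simp
  from arg_cong[OF this, of "src (A' \<otimes> B')"] show ?thesis using assms(3,4) by simp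
qed

text \<open>The image of the cone and the cone at the image objects have the same right and bottom
  sides, so uniqueness of distinguished squares applies.\<close>

lemma tensor_fctr_cones:
  assumes "contextual_fun A A' F" "contextual_fun B B' G"
    and ab: "a \<in> ob A" "b \<in> ob B" "1 \<le> len A a" "1 \<le> len B b"
  shows "farr (tensor_fctr t A B A' B' F G) (tt A B a b) = tt A' B' (fob F a) (fob G b)"
    "farr (tensor_fctr t A B A' B' F G) (tl A B a b) = tl A' B' (fob F a) (fob G b)"
proof -
  interpret F: contextual_fun A A' F by fact
  interpret G: contextual_fun B B' G by fact
  interpret S: universal_cones A B "A \<otimes> B" "tmap t A B" "tt A B" "tl A B"
    using universal_cones F.D.contextual G.D.contextual .
  interpret T: universal_cones A' B' "A' \<otimes> B'" "tmap t A' B'" "tt A' B'" "tl A' B'"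
    using universal_cones F.E.contextual G.E.contextual .
  interpret N: contextual_fun "A \<otimes> B" "A' \<otimes> B'" "tensor_fctr t A B A' B' F G"
    using tensor_fctr(1)[OF assms(1,2)] by unfold_locales
  have c: "dsq (A' \<otimes> B') (tt A' B' (fob F a) (fob G b)) (tl A' B' (fob F a) (fob G b))
     (T.Ha (pr A' (fob F a)) (idm B' (ft B' (fob G b)))) (T.Ha (idm A' (ft A' (fob F a))) (pr B' (fob G b)))"
    using ab by (intro T.cone) simp_all
  have "dsq (A' \<otimes> B') (farr (tensor_fctr t A B A' B' F G) (tt A B a b)) (farr (tensor_fctr t A B A' B' F G) (tl A B a b))
     (T.Ha (pr A' (fob F a)) (idm B' (ft B' (fob G b)))) (T.Ha (idm A' (ft A' (fob F a))) (pr B' (fob G b)))"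
    using N.dsq_map[OF S.cone[OF ab]] tensor_fctr(2)[OF assms(1,2)] ab
    by (simp add: F.map_ft F.map_pr G.map_ft G.map_pr)
  from T.D.dsq_unique[OF c this]
  show "farr (tensor_fctr t A B A' B' F G) (tt A B a b) = tt A' B' (fob F a) (fob G b)"
    "farr (tensor_fctr t A B A' B' F G) (tl A B a b) = tl A' B' (fob F a) (fob G b)" .
qed

lemma associator_ob:
  assumes "contextual_category A" "contextual_category B" "contextual_category C" "is_associator t A B C \<alpha>"
    and "a \<in> ob A" "b \<in> ob B" "c \<in> ob C"
  shows "fob \<alpha> (fob (tmap t A (B \<otimes> C)) (a, fob (tmap t B C) (b, c))) =
    fob (tmap t (A \<otimes> B) C) (fob (tmap t A B) (a, b), c)"
proof -
  interpret BC: universal_cones B C "B \<otimes> C" "tmap t B C" "tt B C" "tl B C"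
    using universal_cones assms by blast
  interpret AU: universal_cones A "B \<otimes> C" "A \<otimes> (B \<otimes> C)" "tmap t A (B \<otimes> C)" "tt A (B \<otimes> C)" "tl A (B \<otimes> C)"
    using universal_cones contextual_tensor assms by blast
  interpret AB: universal_cones A B "A \<otimes> B" "tmap t A B" "tt A B" "tl A B"
    using universal_cones assms by blast
  interpret UC: universal_cones "A \<otimes> B" C "(A \<otimes> B) \<otimes> C" "tmap t (A \<otimes> B) C" "tt (A \<otimes> B) C" "tl (A \<otimes> B) C"
    using universal_cones contextual_tensor assms by blast
  have "contextual_functor (A \<otimes> (B \<otimes> C)) ((A \<otimes> B) \<otimes> C) \<alpha>"
    using assms(4) by (simp add: is_associator_def)
  then interpret \<alpha>: contextual_fun "A \<otimes> (B \<otimes> C)" "(A \<otimes> B) \<otimes> C" \<alpha>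
    by unfold_locales
  have "farr \<alpha> (AU.Ha (idm A a) (BC.Ha (idm B b) (idm C c))) = UC.Ha (AB.Ha (idm A a) (idm B b)) (idm C c)"
    using assms(4-7) unfolding is_associator_def by blast
  from arg_cong[OF this, of "src ((A \<otimes> B) \<otimes> C)"] show ?thesis using assms(5-7) by simp
qed

lemma associator_functor: "is_associator t A B C \<alpha> \<Longrightarrow> contextual_functor (A \<otimes> (B \<otimes> C)) ((A \<otimes> B) \<otimes> C) \<alpha>"
  by (simp only: is_associator_def)

lemma associator_arr: "is_associator t A B C \<alpha> \<Longrightarrow> f \<in> arr A \<Longrightarrow> g \<in> arr B \<Longrightarrow> h \<in> arr C \<Longrightarrow>
    farr \<alpha> (tensor_arr t A (B \<otimes> C) f (tensor_arr t B C g h)) = tensor_arr t (A \<otimes> B) C (tensor_arr t A B f g) h"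
  by (simp only: is_associator_def)

lemma symmetry_functor: "is_symmetry t A B \<beta> \<Longrightarrow> contextual_functor (A \<otimes> B) (B \<otimes> A) \<beta>"
  by (simp only: is_symmetry_def)

end

section \<open>The hexagon\<close>

locale hexagon = tensor t for t :: "'u tensor" (structure) +
  fixes A B C :: "'u contextual"
  assumes ABC: "contextual_category A" "contextual_category B" "contextual_category C"
begin

sublocale BC: universal_cones B C "B \<otimes> C" "tmap t B C" "tt B C" "tl B C"
  by (intro universal_cones contextual_tensor ABC)
sublocale A_BC: universal_cones A "B \<otimes> C" "A \<otimes> (B \<otimes> C)" "tmap t A (B \<otimes> C)" "tt A (B \<otimes> C)" "tl A (B \<otimes> C)"
  by (intro universal_cones contextual_tensor ABC)
sublocale AB: universal_cones A B "A \<otimes> B" "tmap t A B" "tt A B" "tl A B"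
  by (intro universal_cones contextual_tensor ABC)
sublocale AB_C: universal_cones "A \<otimes> B" C "(A \<otimes> B) \<otimes> C" "tmap t (A \<otimes> B) C" "tt (A \<otimes> B) C" "tl (A \<otimes> B) C"
  by (intro universal_cones contextual_tensor ABC)
sublocale C_AB: universal_cones C "A \<otimes> B" "C \<otimes> (A \<otimes> B)" "tmap t C (A \<otimes> B)" "tt C (A \<otimes> B)" "tl C (A \<otimes> B)"
  by (intro universal_cones contextual_tensor ABC)
sublocale CA: universal_cones C A "C \<otimes> A" "tmap t C A" "tt C A" "tl C A"
  by (intro universal_cones contextual_tensor ABC)
sublocale CA_B: universal_cones "C \<otimes> A" B "(C \<otimes> A) \<otimes> B" "tmap t (C \<otimes> A) B" "tt (C \<otimes> A) B" "tl (C \<otimes> A) B"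
  by (intro universal_cones contextual_tensor ABC)
sublocale AC: universal_cones A C "A \<otimes> C" "tmap t A C" "tt A C" "tl A C"
  by (intro universal_cones contextual_tensor ABC)
sublocale AC_B: universal_cones "A \<otimes> C" B "(A \<otimes> C) \<otimes> B" "tmap t (A \<otimes> C) B" "tt (A \<otimes> C) B" "tl (A \<otimes> C) B"
  by (intro universal_cones contextual_tensor ABC)
sublocale CB: universal_cones C B "C \<otimes> B" "tmap t C B" "tt C B" "tl C B"
  by (intro universal_cones contextual_tensor ABC)
sublocale A_CB: universal_cones A "C \<otimes> B" "A \<otimes> (C \<otimes> B)" "tmap t A (C \<otimes> B)" "tt A (C \<otimes> B)" "tl A (C \<otimes> B)"
  by (intro universal_cones contextual_tensor ABC)

abbreviation V where "V \<equiv> A \<otimes> (B \<otimes> C)"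
abbreviation V' where "V' \<equiv> A \<otimes> (C \<otimes> B)"
abbreviation W where "W \<equiv> (A \<otimes> B) \<otimes> C"
abbreviation W' where "W' \<equiv> (A \<otimes> C) \<otimes> B"
abbreviation E where "E \<equiv> C \<otimes> (A \<otimes> B)"
abbreviation D where "D \<equiv> (C \<otimes> A) \<otimes> B"
abbreviation G where "G f g h \<equiv> CA_B.Ha (CA.Ha h f) g"
abbreviation Go where "Go a b c \<equiv> CA_B.Ho (CA.Ho c a) b"
text \<open>The index names the variable \<open>a\<close>, \<open>b\<close> or \<open>c\<close> that
  is lowered; in the cube cone of \<open>(c \<otimes> a) \<otimes> b\<close> these projections occur
  in the order \<open>q3\<close>, \<open>q1\<close>, \<open>q2\<close>.\<close>

abbreviation q1 where "q1 a b c \<equiv> CA_B.Ha (tt C A c a) (idm B b) \<odot>\<^bsub>D\<^esub> tl (C \<otimes> A) B (CA.Ho c a) b"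
abbreviation q2 where "q2 a b c \<equiv> tt (C \<otimes> A) B (CA.Ho c a) b"
abbreviation q3 where "q3 a b c \<equiv> CA_B.Ha (tl C A c a) (idm B b) \<odot>\<^bsub>D\<^esub> tl (C \<otimes> A) B (CA.Ho c a) b"

lemma q_mono:
  assumes "a \<in> ob A" "b \<in> ob B" "c \<in> ob C" "1 \<le> len A a" "1 \<le> len B b" "1 \<le> len C c"
    "m \<in> arr D" "m' \<in> arr D"
    "tgt D m = ft D (Go a b c)" "tgt D m' = ft D (Go a b c)"
    "src D m = src D m'"
    "q1 a b c \<odot>\<^bsub>D\<^esub> m = q1 a b c \<odot>\<^bsub>D\<^esub> m'"
    "q2 a b c \<odot>\<^bsub>D\<^esub> m = q2 a b c \<odot>\<^bsub>D\<^esub> m'"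
    "q3 a b c \<odot>\<^bsub>D\<^esub> m = q3 a b c \<odot>\<^bsub>D\<^esub> m'"
  shows "m = m'"
proof -
  interpret L: bimorphism_left C A B "C \<otimes> A" D "tmap t C A" "tt C A" "tl C A"
     "tmap t (C \<otimes> A) B" "tt (C \<otimes> A) B" "tl (C \<otimes> A) B" by unfold_locales
  have "src D (q2 a b c) = ft D (Go a b c)"
    using assms(1-6) CA.len_Ho[of c a] by simp
  then show ?thesis
    using assms(9,10)
    by (intro CA_B.D.cube_cone_mono[OF L.cube_cone[OF assms(3,1,2,6,4,5)] assms(7,8) _ _ assms(11,14,12,13)]) simp_all
qed

lemma Go_one:
  "a \<in> ob A \<Longrightarrow> b \<in> ob B \<Longrightarrow> c \<in> ob C \<Longrightarrow> len A a = 0 \<or> len B b = 0 \<or> len C c = 0 \<Longrightarrow> Go a b c = one_ob D"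
proof -
  assume abc: "a \<in> ob A" "b \<in> ob B" "c \<in> ob C" and z: "len A a = 0 \<or> len B b = 0 \<or> len C c = 0"
  have "len (C \<otimes> A) (CA.Ho c a) = 0 \<or> len B b = 0"
  proof (cases "len B b = 0")
    case False
    then have "CA.Ho c a = one_ob (C \<otimes> A)" using z abc by (intro CA.Ho_one) auto
    then show ?thesis by simp
  qed simp
  then show ?thesis using abc by (intro CA_B.Ho_one) simp_all
qed

text \<open>\<psi> is the image under \<alpha>' of the symmetry component at
  \<open>a \<otimes> b\<close> and \<open>c\<close>. Of the two projections of its bottom map one
  yields \<open>q3\<close>; the other ends over the father of \<open>a \<otimes> b\<close> and
  splits into \<open>q1\<close> and \<open>q2\<close> by the cone of
  \<open>A \<otimes> B\<close>.\<close>

lemma cube_lift_right: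
  assumes "is_associator t A B C \<alpha>" "is_associator t C A B \<alpha>'" "is_symmetry t (A \<otimes> B) C \<beta>"
  defines "P \<equiv> \<lambda>u. farr \<alpha>' (farr \<beta> u)"
  shows "\<exists>\<psi>. cube_lift A B C D (\<lambda>f g h. P (AB_C.Ha (AB.Ha f g) h)) G
     (\<lambda>a b c. fob \<alpha>' (fob \<beta> (AB_C.Ho (AB.Ho a b) c))) Go \<psi>
     (\<lambda>a b c. P (AB_C.Ha (tl A B a b) (idm C c) \<odot>\<^bsub>W\<^esub> tl (A \<otimes> B) C (AB.Ho a b) c))
     (\<lambda>a b c. P (AB_C.Ha (tt A B a b) (idm C c) \<odot>\<^bsub>W\<^esub> tl (A \<otimes> B) C (AB.Ho a b) c))
     (\<lambda>a b c. P (tt (A \<otimes> B) C (AB.Ho a b) c)) q1 q2 q3"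
proof -
  have cf: "contextual_functor E D \<alpha>'" "contextual_functor W E \<beta>"
    by (fact associator_functor[OF assms(2)] symmetry_functor[OF assms(3)])+
  interpret \<alpha>': contextual_fun E D \<alpha>'
    by (intro contextual_fun.intro contextual_fun_axioms.intro C_AB.D.contextual_cat_axioms CA_B.D.contextual_cat_axioms cf)
  interpret \<beta>: contextual_fun W E \<beta>
    by (intro contextual_fun.intro contextual_fun_axioms.intro AB_C.D.contextual_cat_axioms C_AB.D.contextual_cat_axioms cf)
  obtain \<phi> where \<phi>: "symmetry_iso (A \<otimes> B) C \<beta> \<phi>"
    using symmetry_iso_ex[OF contextual_tensor[OF ABC(1,2)] ABC(3) assms(3)] by blast
  note \<phi>_arr [simp] = symmetry_iso_arr(2-4)[OF \<phi>] and nat = symmetry_iso_natural[OF \<phi>]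
  have \<alpha>': "farr \<alpha>' (C_AB.Ha h (AB.Ha f g)) = G f g h" if "f \<in> arr A" "g \<in> arr B" "h \<in> arr C" for f g h
    by (rule associator_arr[OF assms(2) that(3,1,2)])
  note ob = associator_ob[OF ABC(3,1,2) assms(2)]
  interpret L: bimorphism_left A B C "A \<otimes> B" W "tmap t A B" "tt A B" "tl A B"
     "tmap t (A \<otimes> B) C" "tt (A \<otimes> B) C" "tl (A \<otimes> B) C"
    by (intro bimorphism_left.intro AB.bimorphism_cones_axioms AB_C.bimorphism_cones_axioms)
  have "cube_lift A B C D (\<lambda>f g h. P (AB_C.Ha (AB.Ha f g) h)) G
     (\<lambda>a b c. fob \<alpha>' (fob \<beta> (AB_C.Ho (AB.Ho a b) c))) Go (\<lambda>a b c. farr \<alpha>' (\<phi> (AB.Ho a b) c))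
     (\<lambda>a b c. P (AB_C.Ha (tl A B a b) (idm C c) \<odot>\<^bsub>W\<^esub> tl (A \<otimes> B) C (AB.Ho a b) c))
     (\<lambda>a b c. P (AB_C.Ha (tt A B a b) (idm C c) \<odot>\<^bsub>W\<^esub> tl (A \<otimes> B) C (AB.Ho a b) c))
     (\<lambda>a b c. P (tt (A \<otimes> B) C (AB.Ho a b) c)) q1 q2 q3"
  proof (intro cube_lift.intro cube_lift_axioms.intro contextual_cat.intro ABC CA_B.D.contextual)
    fix f g h assume fgh: "f \<in> arr A" "g \<in> arr B" "h \<in> arr C"
    then show "P (AB_C.Ha (AB.Ha f g) h) \<in> arr D \<and>
       src D (P (AB_C.Ha (AB.Ha f g) h)) = fob \<alpha>' (fob \<beta> (AB_C.Ho (AB.Ho (src A f) (src B g)) (src C h))) \<and>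
       tgt D (P (AB_C.Ha (AB.Ha f g) h)) = fob \<alpha>' (fob \<beta> (AB_C.Ho (AB.Ho (tgt A f) (tgt B g)) (tgt C h)))"
      by (simp add: P_def)
    show "farr \<alpha>' (\<phi> (AB.Ho (tgt A f) (tgt B g)) (tgt C h)) \<odot>\<^bsub>D\<^esub> P (AB_C.Ha (AB.Ha f g) h) =
       G f g h \<odot>\<^bsub>D\<^esub> farr \<alpha>' (\<phi> (AB.Ho (src A f) (src B g)) (src C h))"
      using arg_cong[OF nat[of "AB.Ha f g" h], of "farr \<alpha>'"] fgh by (simp add: P_def \<alpha>')
  next
    fix a b c assume abc: "a \<in> ob A" "b \<in> ob B" "c \<in> ob C"
    then show "split_mono D (farr \<alpha>' (\<phi> (AB.Ho a b) c)) \<and>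
       src D (farr \<alpha>' (\<phi> (AB.Ho a b) c)) = fob \<alpha>' (fob \<beta> (AB_C.Ho (AB.Ho a b) c)) \<and>
       tgt D (farr \<alpha>' (\<phi> (AB.Ho a b) c)) = Go a b c"
      using symmetry_iso_arr(1)[OF \<phi>, of "AB.Ho a b" c] by (simp add: \<alpha>'.split_mono_map ob)
    assume z: "len A a = 0 \<or> len B b = 0 \<or> len C c = 0"
    have "len (A \<otimes> B) (AB.Ho a b) = 0 \<or> len C c = 0"
    proof (cases "len C c = 0")
      case False
      then have "AB.Ho a b = one_ob (A \<otimes> B)" using z abc by (intro AB.Ho_one) auto
      then show ?thesis by simp
    qed simp
    then have "AB_C.Ho (AB.Ho a b) c = one_ob W"
      using abc by (intro AB_C.Ho_one) simp_all
    then show "fob \<alpha>' (fob \<beta> (AB_C.Ho (AB.Ho a b) c)) = one_ob D \<and> Go a b c = one_ob D"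
      using Go_one[OF abc z] by simp
  next
    fix a b c assume abc: "a \<in> ob A" "b \<in> ob B" "c \<in> ob C" "1 \<le> len A a" "1 \<le> len B b" "1 \<le> len C c"
    let ?y = "AB.Ho a b"
    have y: "?y \<in> ob (A \<otimes> B)" "1 \<le> len (A \<otimes> B) ?y" using AB.len_Ho[of a b] abc by simp_all
    show "cube_cone A B C D (\<lambda>f g h. P (AB_C.Ha (AB.Ha f g) h)) a b c
        (P (AB_C.Ha (tl A B a b) (idm C c) \<odot>\<^bsub>W\<^esub> tl (A \<otimes> B) C ?y c))
        (P (AB_C.Ha (tt A B a b) (idm C c) \<odot>\<^bsub>W\<^esub> tl (A \<otimes> B) C ?y c)) (P (tt (A \<otimes> B) C ?y c)) \<and>
        src D (P (tt (A \<otimes> B) C ?y c)) = ft D (fob \<alpha>' (fob \<beta> (AB_C.Ho ?y c)))"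
      using \<alpha>'.cube_cone_map[OF \<beta>.cube_cone_map[OF L.cube_cone[OF abc]]] abc y
      by (simp add: P_def \<alpha>'.map_ft \<beta>.map_ft)
    obtain k where k: "qsq E (\<phi> ?y c) k"
      "tl C (A \<otimes> B) c ?y \<odot>\<^bsub>E\<^esub> k = \<phi> ?y (ft C c) \<odot>\<^bsub>E\<^esub> farr \<beta> (tt (A \<otimes> B) C ?y c)"
      "tt C (A \<otimes> B) c ?y \<odot>\<^bsub>E\<^esub> k = \<phi> (ft (A \<otimes> B) ?y) c \<odot>\<^bsub>E\<^esub> farr \<beta> (tl (A \<otimes> B) C ?y c)"
      by (rule symmetry_iso_qsq[OF \<phi> y(1) abc(3) y(2) abc(6)])
    note k' = C_AB.D.qsqD[OF k(1)]
    have tk: "tgt E k = ft E (C_AB.Ho c ?y)" using k'(6) y abc by simp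
    \<comment> \<open>Rewrites \<open>q3\<close>, \<open>q1\<close>, \<open>q2\<close>, in this
      order, as images under \<alpha>' of projections in
      \<open>C \<otimes> (A \<otimes> B)\<close>.\<close>
    note q = associator_cones[OF ABC(3,1,2) assms(2) abc(3,1,2,6,4,5), symmetric]
    \<comment> \<open>Naturality of \<phi> at a projection \<open>r\<close> out of the father of
      \<open>a \<otimes> b\<close>; \<open>r\<close> will be \<open>tl A B a b\<close> and
      \<open>tt A B a b\<close>.\<close>
    have s: "C_AB.Ha (idm C c) r \<odot>\<^bsub>E\<^esub> (tt C (A \<otimes> B) c ?y \<odot>\<^bsub>E\<^esub> k) =
        \<phi> (tgt (A \<otimes> B) r) c \<odot>\<^bsub>E\<^esub> farr \<beta> (AB_C.Ha r (idm C c) \<odot>\<^bsub>W\<^esub> tl (A \<otimes> B) C ?y c)"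
      if r: "r \<in> arr (A \<otimes> B)" "src (A \<otimes> B) r = ft (A \<otimes> B) ?y" for r
    proof -
      have "C_AB.Ha (idm C c) r \<odot>\<^bsub>E\<^esub> (tt C (A \<otimes> B) c ?y \<odot>\<^bsub>E\<^esub> k) =
         (C_AB.Ha (idm C c) r \<odot>\<^bsub>E\<^esub> \<phi> (ft (A \<otimes> B) ?y) c) \<odot>\<^bsub>E\<^esub> farr \<beta> (tl (A \<otimes> B) C ?y c)"
        unfolding k(3) using r y abc by simp
      also have "\<dots> = (\<phi> (tgt (A \<otimes> B) r) c \<odot>\<^bsub>E\<^esub> farr \<beta> (AB_C.Ha r (idm C c))) \<odot>\<^bsub>E\<^esub> farr \<beta> (tl (A \<otimes> B) C ?y c)"
        using nat[OF r(1), of "idm C c"] r abc by simp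
      also have "\<dots> = \<phi> (tgt (A \<otimes> B) r) c \<odot>\<^bsub>E\<^esub> farr \<beta> (AB_C.Ha r (idm C c) \<odot>\<^bsub>W\<^esub> tl (A \<otimes> B) C ?y c)"
        using r y abc by simp
      finally show ?thesis .
    qed
    have q3: "q3 a b c \<odot>\<^bsub>D\<^esub> farr \<alpha>' k = farr \<alpha>' (\<phi> ?y (ft C c)) \<odot>\<^bsub>D\<^esub> P (tt (A \<otimes> B) C ?y c)"
      unfolding q(1) P_def using arg_cong[OF k(2), of "farr \<alpha>'"] y abc k'(2) tk by simp
    have q1: "q1 a b c \<odot>\<^bsub>D\<^esub> farr \<alpha>' k = farr \<alpha>' (\<phi> (AB.Ho (ft A a) b) c) \<odot>\<^bsub>D\<^esub>
        P (AB_C.Ha (tl A B a b) (idm C c) \<odot>\<^bsub>W\<^esub> tl (A \<otimes> B) C ?y c)"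
      unfolding q(2) P_def using arg_cong[OF s[of "tl A B a b"], of "farr \<alpha>'"] y abc k'(2) tk by simp
    have q2: "q2 a b c \<odot>\<^bsub>D\<^esub> farr \<alpha>' k = farr \<alpha>' (\<phi> (AB.Ho a (ft B b)) c) \<odot>\<^bsub>D\<^esub>
        P (AB_C.Ha (tt A B a b) (idm C c) \<odot>\<^bsub>W\<^esub> tl (A \<otimes> B) C ?y c)"
      unfolding q(3) P_def using arg_cong[OF s[of "tt A B a b"], of "farr \<alpha>'"] y abc k'(2) tk by simp
    show "\<exists>k. qsq D (farr \<alpha>' (\<phi> ?y c)) k \<and>
        q1 a b c \<odot>\<^bsub>D\<^esub> k = farr \<alpha>' (\<phi> (AB.Ho (ft A a) b) c) \<odot>\<^bsub>D\<^esub>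
          P (AB_C.Ha (tl A B a b) (idm C c) \<odot>\<^bsub>W\<^esub> tl (A \<otimes> B) C ?y c) \<and>
        q2 a b c \<odot>\<^bsub>D\<^esub> k = farr \<alpha>' (\<phi> (AB.Ho a (ft B b)) c) \<odot>\<^bsub>D\<^esub>
          P (AB_C.Ha (tt A B a b) (idm C c) \<odot>\<^bsub>W\<^esub> tl (A \<otimes> B) C ?y c) \<and>
        q3 a b c \<odot>\<^bsub>D\<^esub> k = farr \<alpha>' (\<phi> ?y (ft C c)) \<odot>\<^bsub>D\<^esub> P (tt (A \<otimes> B) C ?y c)"
      using \<alpha>'.qsq_map[OF k(1)] q1 q2 q3 by blast
  qed (rule q_mono)
  then show ?thesis by blast
qed

text \<open>\<psi> is the image of \<open>\<omega>\<close> followed by \<open>\<chi>\<close>, where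
  \<open>\<omega>\<close> exchanges \<open>b\<close> with \<open>c\<close> and \<open>\<chi>\<close>
  then exchanges \<open>a\<close> with \<open>c\<close>. Accordingly its bottom map is a composite
  of two, each induced through a tensor map by the bottom map of a symmetry component.\<close>

lemma cube_lift_left:
  assumes "is_associator t A C B \<alpha>" "is_symmetry t A C \<beta>" "is_symmetry t B C \<beta>'"
  defines "\<tau> \<equiv> tensor_fctr t (A \<otimes> C) B (C \<otimes> A) B \<beta> (id_fctr B)"
    and "\<tau>' \<equiv> tensor_fctr t A (B \<otimes> C) A (C \<otimes> B) (id_fctr A) \<beta>'"
  defines "P \<equiv> \<lambda>u. farr \<tau> (farr \<alpha> (farr \<tau>' u))"
  shows "\<exists>\<psi>. cube_lift A B C D (\<lambda>f g h. P (A_BC.Ha f (BC.Ha g h))) G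
     (\<lambda>a b c. fob \<tau> (fob \<alpha> (fob \<tau>' (A_BC.Ho a (BC.Ho b c))))) Go \<psi>
     (\<lambda>a b c. P (tl A (B \<otimes> C) a (BC.Ho b c)))
     (\<lambda>a b c. P (A_BC.Ha (idm A a) (tl B C b c) \<odot>\<^bsub>V\<^esub> tt A (B \<otimes> C) a (BC.Ho b c)))
     (\<lambda>a b c. P (A_BC.Ha (idm A a) (tt B C b c) \<odot>\<^bsub>V\<^esub> tt A (B \<otimes> C) a (BC.Ho b c))) q1 q2 q3"
proof -
  note cc = BC.D.contextual_cat_axioms CB.D.contextual_cat_axioms AC.D.contextual_cat_axioms CA.D.contextual_cat_axioms
    contextual_cat.intro[OF ABC(1)] contextual_cat.intro[OF ABC(2)]
  have \<beta>: "contextual_fun (A \<otimes> C) (C \<otimes> A) \<beta>"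
    by (intro contextual_fun.intro contextual_fun_axioms.intro cc symmetry_functor[OF assms(2)])
  have \<beta>': "contextual_fun (B \<otimes> C) (C \<otimes> B) \<beta>'"
    by (intro contextual_fun.intro contextual_fun_axioms.intro cc symmetry_functor[OF assms(3)])
  have iA: "contextual_fun A A (id_fctr A)" and iB: "contextual_fun B B (id_fctr B)"
    by (intro contextual_fun.intro contextual_fun_axioms.intro cc contextual_functor_id)+
  interpret \<beta>: contextual_fun "A \<otimes> C" "C \<otimes> A" \<beta> by (fact \<beta>)
  interpret \<beta>': contextual_fun "B \<otimes> C" "C \<otimes> B" \<beta>' by (fact \<beta>')
  interpret \<alpha>: contextual_fun V' W' \<alpha>
    by (intro contextual_fun.intro contextual_fun_axioms.intro A_CB.D.contextual_cat_axioms AC_B.D.contextual_cat_axioms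
      associator_functor[OF assms(1)])
  interpret \<tau>: contextual_fun W' D \<tau>
    unfolding \<tau>_def
    by (intro contextual_fun.intro contextual_fun_axioms.intro AC_B.D.contextual_cat_axioms CA_B.D.contextual_cat_axioms
      tensor_fctr(1)[OF \<beta> iB])
  interpret \<tau>': contextual_fun V V' \<tau>'
    unfolding \<tau>'_def
    by (intro contextual_fun.intro contextual_fun_axioms.intro A_BC.D.contextual_cat_axioms A_CB.D.contextual_cat_axioms
      tensor_fctr(1)[OF iA \<beta>'])
  have id [simp]: "f \<in> arr A \<Longrightarrow> farr (id_fctr A) f = f" "a \<in> ob A \<Longrightarrow> fob (id_fctr A) a = a"
     "g \<in> arr B \<Longrightarrow> farr (id_fctr B) g = g" "b \<in> ob B \<Longrightarrow> fob (id_fctr B) b = b" for f a g b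
    by (simp_all add: id_fctr_def)
  have \<tau> [simp]: "farr \<tau> (AC_B.Ha f g) = CA_B.Ha (farr \<beta> f) g" if "f \<in> arr (A \<otimes> C)" "g \<in> arr B" for f g
    unfolding \<tau>_def using tensor_fctr(2)[OF \<beta> iB that] that by simp
  have \<tau>_ob [simp]: "fob \<tau> (AC_B.Ho v b) = CA_B.Ho (fob \<beta> v) b" if "v \<in> ob (A \<otimes> C)" "b \<in> ob B" for v b
    unfolding \<tau>_def using tensor_fctr_ob[OF \<beta> iB that] that by simp
  have \<tau>_cones: "farr \<tau> (tt (A \<otimes> C) B v b) = tt (C \<otimes> A) B (fob \<beta> v) b" "farr \<tau> (tl (A \<otimes> C) B v b) = tl (C \<otimes> A) B (fob \<beta> v) b"
    if "v \<in> ob (A \<otimes> C)" "b \<in> ob B" "1 \<le> len (A \<otimes> C) v" "1 \<le> len B b" for v b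
    unfolding \<tau>_def using tensor_fctr_cones[OF \<beta> iB that] that by simp_all
  have \<tau>' [simp]: "farr \<tau>' (A_BC.Ha f g) = A_CB.Ha f (farr \<beta>' g)" if "f \<in> arr A" "g \<in> arr (B \<otimes> C)" for f g
    unfolding \<tau>'_def using tensor_fctr(2)[OF iA \<beta>' that] that by simp
  have \<tau>'_ob [simp]: "fob \<tau>' (A_BC.Ho a x) = A_CB.Ho a (fob \<beta>' x)" if "a \<in> ob A" "x \<in> ob (B \<otimes> C)" for a x
    unfolding \<tau>'_def using tensor_fctr_ob[OF iA \<beta>' that] that by simp
  have \<tau>'_cones: "farr \<tau>' (tt A (B \<otimes> C) a x) = tt A (C \<otimes> B) a (fob \<beta>' x)" "farr \<tau>' (tl A (B \<otimes> C) a x) = tl A (C \<otimes> B) a (fob \<beta>' x)"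
    if "a \<in> ob A" "x \<in> ob (B \<otimes> C)" "1 \<le> len A a" "1 \<le> len (B \<otimes> C) x" for a x
    unfolding \<tau>'_def using tensor_fctr_cones[OF iA \<beta>' that] that by simp_all
  have \<alpha> [simp]: "farr \<alpha> (A_CB.Ha f (CB.Ha h g)) = AC_B.Ha (AC.Ha f h) g" if "f \<in> arr A" "g \<in> arr B" "h \<in> arr C" for f g h
    by (rule associator_arr[OF assms(1) that(1,3,2)])
  note \<alpha>_ob [simp] = associator_ob[OF ABC(1,3,2) assms(1)]
  obtain \<phi> where \<phi>: "symmetry_iso A C \<beta> \<phi>" using symmetry_iso_ex[OF ABC(1,3) assms(2)] by blast
  obtain \<phi>' where \<phi>': "symmetry_iso B C \<beta>' \<phi>'" using symmetry_iso_ex[OF ABC(2,3) assms(3)] by blast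
  note [simp] = symmetry_iso_arr(2-4)[OF \<phi>] symmetry_iso_arr(2-4)[OF \<phi>']
  define \<chi> where "\<chi> = (\<lambda>a b c. CA_B.Ha (\<phi> a c) (idm B b))"
  define \<omega> where "\<omega> = (\<lambda>a b c. A_CB.Ha (idm A a) (\<phi>' b c))"
  have \<chi> [simp]: "\<chi> a b c \<in> arr D" "src D (\<chi> a b c) = CA_B.Ho (fob \<beta> (AC.Ho a c)) b"
    "tgt D (\<chi> a b c) = Go a b c" if "a \<in> ob A" "b \<in> ob B" "c \<in> ob C" for a b c
    using that by (simp_all add: \<chi>_def)
  have \<omega> [simp]: "\<omega> a b c \<in> arr V'" "src V' (\<omega> a b c) = A_CB.Ho a (fob \<beta>' (BC.Ho b c))"
    "tgt V' (\<omega> a b c) = A_CB.Ho a (CB.Ho c b)" if "a \<in> ob A" "b \<in> ob B" "c \<in> ob C" for a b c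
    using that by (simp_all add: \<omega>_def)
  have src_P: "src D (P u) = fob \<tau> (fob \<alpha> (fob \<tau>' (src V u)))" if "u \<in> arr V" for u
    using that by (simp add: P_def)
  let ?\<psi> = "\<lambda>a b c. \<chi> a b c \<odot>\<^bsub>D\<^esub> farr \<tau> (farr \<alpha> (\<omega> a b c))"
  interpret R: bimorphism_right A B C "B \<otimes> C" V "tmap t B C" "tt B C" "tl B C"
     "tmap t A (B \<otimes> C)" "tt A (B \<otimes> C)" "tl A (B \<otimes> C)"
    by (intro bimorphism_right.intro BC.bimorphism_cones_axioms A_BC.bimorphism_cones_axioms)
  have "cube_lift A B C D (\<lambda>f g h. P (A_BC.Ha f (BC.Ha g h))) G
     (\<lambda>a b c. fob \<tau> (fob \<alpha> (fob \<tau>' (A_BC.Ho a (BC.Ho b c))))) Go ?\<psi>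
     (\<lambda>a b c. P (tl A (B \<otimes> C) a (BC.Ho b c)))
     (\<lambda>a b c. P (A_BC.Ha (idm A a) (tl B C b c) \<odot>\<^bsub>V\<^esub> tt A (B \<otimes> C) a (BC.Ho b c)))
     (\<lambda>a b c. P (A_BC.Ha (idm A a) (tt B C b c) \<odot>\<^bsub>V\<^esub> tt A (B \<otimes> C) a (BC.Ho b c))) q1 q2 q3"
  proof (intro cube_lift.intro cube_lift_axioms.intro contextual_cat.intro ABC CA_B.D.contextual)
    fix f g h assume fgh: "f \<in> arr A" "g \<in> arr B" "h \<in> arr C"
    then show "P (A_BC.Ha f (BC.Ha g h)) \<in> arr D \<and>
       src D (P (A_BC.Ha f (BC.Ha g h))) = fob \<tau> (fob \<alpha> (fob \<tau>' (A_BC.Ho (src A f) (BC.Ho (src B g) (src C h))))) \<and>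
       tgt D (P (A_BC.Ha f (BC.Ha g h))) = fob \<tau> (fob \<alpha> (fob \<tau>' (A_BC.Ho (tgt A f) (BC.Ho (tgt B g) (tgt C h)))))"
      by (simp add: P_def)
    let ?K = "\<lambda>u. farr \<tau> (farr \<alpha> u)"
    have 1: "\<omega> (tgt A f) (tgt B g) (tgt C h) \<odot>\<^bsub>V'\<^esub> A_CB.Ha f (farr \<beta>' (BC.Ha g h)) =
        A_CB.Ha f (CB.Ha h g) \<odot>\<^bsub>V'\<^esub> \<omega> (src A f) (src B g) (src C h)"
      using symmetry_iso_natural[OF \<phi>' fgh(2,3)] fgh by (simp add: \<omega>_def)
    have 2: "\<chi> (tgt A f) (tgt B g) (tgt C h) \<odot>\<^bsub>D\<^esub> CA_B.Ha (farr \<beta> (AC.Ha f h)) g =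
        G f g h \<odot>\<^bsub>D\<^esub> \<chi> (src A f) (src B g) (src C h)"
      using symmetry_iso_natural[OF \<phi> fgh(1,3)] fgh by (simp add: \<chi>_def)
    have "?\<psi> (tgt A f) (tgt B g) (tgt C h) \<odot>\<^bsub>D\<^esub> P (A_BC.Ha f (BC.Ha g h)) =
       \<chi> (tgt A f) (tgt B g) (tgt C h) \<odot>\<^bsub>D\<^esub>
         ?K (\<omega> (tgt A f) (tgt B g) (tgt C h) \<odot>\<^bsub>V'\<^esub> A_CB.Ha f (farr \<beta>' (BC.Ha g h)))"
      using fgh by (simp add: P_def)
    also have "\<dots> = (\<chi> (tgt A f) (tgt B g) (tgt C h) \<odot>\<^bsub>D\<^esub> CA_B.Ha (farr \<beta> (AC.Ha f h)) g) \<odot>\<^bsub>D\<^esub>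
        ?K (\<omega> (src A f) (src B g) (src C h))"
      unfolding 1 using fgh by simp
    also have "\<dots> = G f g h \<odot>\<^bsub>D\<^esub> ?\<psi> (src A f) (src B g) (src C h)"
      unfolding 2 using fgh by simp
    finally show "?\<psi> (tgt A f) (tgt B g) (tgt C h) \<odot>\<^bsub>D\<^esub> P (A_BC.Ha f (BC.Ha g h)) =
       G f g h \<odot>\<^bsub>D\<^esub> ?\<psi> (src A f) (src B g) (src C h)" .
  next
    fix a b c assume abc: "a \<in> ob A" "b \<in> ob B" "c \<in> ob C"
    have "split_mono D (\<chi> a b c)"
      using abc symmetry_iso_arr(1)[OF \<phi>, of a c] unfolding \<chi>_def
      by (intro CA_B.split_mono_Ha BC.A.split_mono_idm) simp_all
    moreover have "split_mono V' (\<omega> a b c)"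
      using abc symmetry_iso_arr(1)[OF \<phi>', of b c] unfolding \<omega>_def
      by (intro A_CB.split_mono_Ha A_BC.A.split_mono_idm) simp_all
    ultimately show "split_mono D (?\<psi> a b c) \<and>
       src D (?\<psi> a b c) = fob \<tau> (fob \<alpha> (fob \<tau>' (A_BC.Ho a (BC.Ho b c)))) \<and>
       tgt D (?\<psi> a b c) = Go a b c"
      using abc by (auto intro!: CA_B.D.split_mono_comp \<tau>.split_mono_map \<alpha>.split_mono_map)
    assume z: "len A a = 0 \<or> len B b = 0 \<or> len C c = 0"
    have "len A a = 0 \<or> len (B \<otimes> C) (BC.Ho b c) = 0"
    proof (cases "len A a = 0")
      case False
      then have "BC.Ho b c = one_ob (B \<otimes> C)" using z abc by (intro BC.Ho_one) auto
      then show ?thesis by simp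
    qed simp
    then have "A_BC.Ho a (BC.Ho b c) = one_ob V"
      using abc by (intro A_BC.Ho_one) simp_all
    then show "fob \<tau> (fob \<alpha> (fob \<tau>' (A_BC.Ho a (BC.Ho b c)))) = one_ob D \<and> Go a b c = one_ob D"
      using Go_one[OF abc z] by (simp del: \<tau>'_ob)
  next
    fix a b c assume abc: "a \<in> ob A" "b \<in> ob B" "c \<in> ob C" "1 \<le> len A a" "1 \<le> len B b" "1 \<le> len C c"
    let ?x = "BC.Ho b c" and ?x' = "CB.Ho c b" and ?v = "AC.Ho a c" and ?w = "CA.Ho c a"
    let ?K = "\<lambda>u. farr \<tau> (farr \<alpha> u)"
    have x: "?x \<in> ob (B \<otimes> C)" "1 \<le> len (B \<otimes> C) ?x" using BC.len_Ho[of b c] abc by simp_all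
    have x': "?x' \<in> ob (C \<otimes> B)" "1 \<le> len (C \<otimes> B) ?x'" using CB.len_Ho[of c b] abc by simp_all
    have v: "?v \<in> ob (A \<otimes> C)" "1 \<le> len (A \<otimes> C) ?v" using AC.len_Ho[of a c] abc by simp_all
    have w: "?w \<in> ob (C \<otimes> A)" "1 \<le> len (C \<otimes> A) ?w" using CA.len_Ho[of c a] abc by simp_all
    show "cube_cone A B C D (\<lambda>f g h. P (A_BC.Ha f (BC.Ha g h))) a b c
        (P (tl A (B \<otimes> C) a ?x)) (P (A_BC.Ha (idm A a) (tl B C b c) \<odot>\<^bsub>V\<^esub> tt A (B \<otimes> C) a ?x))
        (P (A_BC.Ha (idm A a) (tt B C b c) \<odot>\<^bsub>V\<^esub> tt A (B \<otimes> C) a ?x)) \<and>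
        src D (P (A_BC.Ha (idm A a) (tt B C b c) \<odot>\<^bsub>V\<^esub> tt A (B \<otimes> C) a ?x)) =
          ft D (fob \<tau> (fob \<alpha> (fob \<tau>' (A_BC.Ho a ?x))))"
    proof
      show "cube_cone A B C D (\<lambda>f g h. P (A_BC.Ha f (BC.Ha g h))) a b c
        (P (tl A (B \<otimes> C) a ?x)) (P (A_BC.Ha (idm A a) (tl B C b c) \<odot>\<^bsub>V\<^esub> tt A (B \<otimes> C) a ?x))
        (P (A_BC.Ha (idm A a) (tt B C b c) \<odot>\<^bsub>V\<^esub> tt A (B \<otimes> C) a ?x))"
        unfolding P_def by (rule \<tau>.cube_cone_map[OF \<alpha>.cube_cone_map[OF \<tau>'.cube_cone_map[OF R.cube_cone[OF abc]]]])
      have u: "src V (A_BC.Ha (idm A a) (tt B C b c) \<odot>\<^bsub>V\<^esub> tt A (B \<otimes> C) a ?x) = ft V (A_BC.Ho a ?x)"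
        "A_BC.Ha (idm A a) (tt B C b c) \<odot>\<^bsub>V\<^esub> tt A (B \<otimes> C) a ?x \<in> arr V"
        using abc x by simp_all
      show "src D (P (A_BC.Ha (idm A a) (tt B C b c) \<odot>\<^bsub>V\<^esub> tt A (B \<otimes> C) a ?x)) =
          ft D (fob \<tau> (fob \<alpha> (fob \<tau>' (A_BC.Ho a ?x))))"
        unfolding src_P[OF u(2)] u(1) using abc x by (simp add: \<tau>.map_ft \<alpha>.map_ft \<tau>'.map_ft)
    qed
    obtain k0 where k0: "qsq (C \<otimes> B) (\<phi>' b c) k0" "tl C B c b \<odot>\<^bsub>C \<otimes> B\<^esub> k0 = \<phi>' b (ft C c) \<odot>\<^bsub>C \<otimes> B\<^esub> farr \<beta>' (tt B C b c)"
      "tt C B c b \<odot>\<^bsub>C \<otimes> B\<^esub> k0 = \<phi>' (ft B b) c \<odot>\<^bsub>C \<otimes> B\<^esub> farr \<beta>' (tl B C b c)"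
      by (rule symmetry_iso_qsq[OF \<phi>' abc(2,3,5,6)])
    \<comment> \<open>The symmetry square for \<open>b\<close> and \<open>c\<close>, tensored with
      \<open>a\<close> on the left; this is the gap-square condition in the second variable.\<close>
    obtain k1 where k1: "qsq V' (\<omega> a b c) k1"
      "tl A (C \<otimes> B) a ?x' \<odot>\<^bsub>V'\<^esub> k1 = \<omega> (ft A a) b c \<odot>\<^bsub>V'\<^esub> tl A (C \<otimes> B) a (fob \<beta>' ?x)"
      "tt A (C \<otimes> B) a ?x' \<odot>\<^bsub>V'\<^esub> k1 = A_CB.Ha (idm A a) k0 \<odot>\<^bsub>V'\<^esub> tt A (C \<otimes> B) a (fob \<beta>' ?x)"
      using A_CB.qsq_right[OF abc(1,4) k0(1)] abc unfolding \<omega>_def by auto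
    obtain k2 where k2: "qsq (C \<otimes> A) (\<phi> a c) k2" "tl C A c a \<odot>\<^bsub>C \<otimes> A\<^esub> k2 = \<phi> a (ft C c) \<odot>\<^bsub>C \<otimes> A\<^esub> farr \<beta> (tt A C a c)"
      "tt C A c a \<odot>\<^bsub>C \<otimes> A\<^esub> k2 = \<phi> (ft A a) c \<odot>\<^bsub>C \<otimes> A\<^esub> farr \<beta> (tl A C a c)"
      by (rule symmetry_iso_qsq[OF \<phi> abc(1,3,4,6)])
    \<comment> \<open>The symmetry square for \<open>a\<close> and \<open>c\<close>, tensored with
      \<open>b\<close> on the right; this is the gap-square condition in the first variable.\<close>
    obtain k3 where k3: "qsq D (\<chi> a b c) k3"
      "tl (C \<otimes> A) B ?w b \<odot>\<^bsub>D\<^esub> k3 = CA_B.Ha k2 (idm B b) \<odot>\<^bsub>D\<^esub> tl (C \<otimes> A) B (fob \<beta> ?v) b"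
      "tt (C \<otimes> A) B ?w b \<odot>\<^bsub>D\<^esub> k3 = \<chi> a (ft B b) c \<odot>\<^bsub>D\<^esub> tt (C \<otimes> A) B (fob \<beta> ?v) b"
      using CA_B.qsq_left[OF abc(2,5) k2(1)] abc unfolding \<chi>_def by auto
    have s0: "k0 \<in> arr (C \<otimes> B)" "src (C \<otimes> B) k0 = ft (C \<otimes> B) (fob \<beta>' ?x)" "tgt (C \<otimes> B) k0 = ft (C \<otimes> B) ?x'"
      using CB.D.qsqD[OF k0(1)] abc by simp_all
    have s1: "k1 \<in> arr V'" "src V' k1 = ft V' (A_CB.Ho a (fob \<beta>' ?x))"
      "tgt V' k1 = ft V' (A_CB.Ho a ?x')"
      using A_CB.D.qsqD[OF k1(1)] abc by simp_all
    have s2: "k2 \<in> arr (C \<otimes> A)" "src (C \<otimes> A) k2 = ft (C \<otimes> A) (fob \<beta> ?v)" "tgt (C \<otimes> A) k2 = ft (C \<otimes> A) ?w"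
      using CA.D.qsqD[OF k2(1)] abc by simp_all
    have s3: "k3 \<in> arr D" "src D k3 = ft D (CA_B.Ho (fob \<beta> ?v) b)"
      "tgt D k3 = ft D (Go a b c)"
      using CA_B.D.qsqD[OF k3(1)] abc by simp_all
    have \<beta>v: "fob \<beta> ?v \<in> ob (C \<otimes> A)" "1 \<le> len (C \<otimes> A) (fob \<beta> ?v)" using v by simp_all
    have \<beta>x: "fob \<beta>' ?x \<in> ob (C \<otimes> B)" "1 \<le> len (C \<otimes> B) (fob \<beta>' ?x)" using x by simp_all
    have Kob: "fob \<tau> (fob \<alpha> (ft V' (A_CB.Ho a ?x'))) = ft D (CA_B.Ho (fob \<beta> ?v) b)"
      using abc x' v by (simp add: \<tau>.map_ft \<alpha>.map_ft)
    \<comment> \<open>Matches the projections of \<open>a \<otimes> (c \<otimes> b)\<close> with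
      those of \<open>(a \<otimes> c) \<otimes> b\<close>, where the two squares meet.\<close>
    note ac = associator_cones[OF ABC(1,3,2) assms(1) abc(1,3,2,4,6,5), symmetric]
    note \<tau>c = \<tau>_cones[OF v(1) abc(2) v(2) abc(5), symmetric]
    note \<tau>'c = \<tau>'_cones[OF abc(1) x(1) abc(4) x(2)]
    \<comment> \<open>\<open>r\<close> stands for a projection of the cone of
      \<open>C \<otimes> A\<close>, \<open>r'\<close> for the matching one of
      \<open>A \<otimes> C\<close>, and \<open>s\<close> for the symmetry component at the lowered
      pair.\<close>
    have left: "CA_B.Ha r (idm B b) \<odot>\<^bsub>D\<^esub> (tl (C \<otimes> A) B ?w b \<odot>\<^bsub>D\<^esub> k3) =
        CA_B.Ha s (idm B b) \<odot>\<^bsub>D\<^esub> farr \<tau> (AC_B.Ha r' (idm B b) \<odot>\<^bsub>W'\<^esub> tl (A \<otimes> C) B ?v b)"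
      if r: "r \<odot>\<^bsub>C \<otimes> A\<^esub> k2 = s \<odot>\<^bsub>C \<otimes> A\<^esub> farr \<beta> r'" and rs: "r \<in> arr (C \<otimes> A)" "s \<in> arr (C \<otimes> A)" "r' \<in> arr (A \<otimes> C)"
        "src (C \<otimes> A) r = ft (C \<otimes> A) ?w" "src (C \<otimes> A) s = fob \<beta> (tgt (A \<otimes> C) r')" "src (A \<otimes> C) r' = ft (A \<otimes> C) ?v" for r s r'
    proof -
      have "CA_B.Ha r (idm B b) \<odot>\<^bsub>D\<^esub> (tl (C \<otimes> A) B ?w b \<odot>\<^bsub>D\<^esub> k3) =
         CA_B.Ha (r \<odot>\<^bsub>C \<otimes> A\<^esub> k2) (idm B b) \<odot>\<^bsub>D\<^esub> tl (C \<otimes> A) B (fob \<beta> ?v) b"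
        unfolding k3(2) using rs s2 \<beta>v abc by simp
      also have "\<dots> = CA_B.Ha s (idm B b) \<odot>\<^bsub>D\<^esub> (farr \<tau> (AC_B.Ha r' (idm B b)) \<odot>\<^bsub>D\<^esub> tl (C \<otimes> A) B (fob \<beta> ?v) b)"
        unfolding r using rs \<beta>v abc v by (simp add: \<beta>.map_ft)
      also have "farr \<tau> (AC_B.Ha r' (idm B b)) \<odot>\<^bsub>D\<^esub> tl (C \<otimes> A) B (fob \<beta> ?v) b =
         farr \<tau> (AC_B.Ha r' (idm B b) \<odot>\<^bsub>W'\<^esub> tl (A \<otimes> C) B ?v b)"
        unfolding \<tau>c using rs abc v by (simp del: \<tau>)
      finally show ?thesis .
    qed
    have right: "A_CB.Ha (idm A a) r \<odot>\<^bsub>V'\<^esub> (tt A (C \<otimes> B) a ?x' \<odot>\<^bsub>V'\<^esub> k1) =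
        A_CB.Ha (idm A a) s \<odot>\<^bsub>V'\<^esub> farr \<tau>' (A_BC.Ha (idm A a) r' \<odot>\<^bsub>V\<^esub> tt A (B \<otimes> C) a ?x)"
      if r: "r \<odot>\<^bsub>C \<otimes> B\<^esub> k0 = s \<odot>\<^bsub>C \<otimes> B\<^esub> farr \<beta>' r'" and rs: "r \<in> arr (C \<otimes> B)" "s \<in> arr (C \<otimes> B)" "r' \<in> arr (B \<otimes> C)"
        "src (C \<otimes> B) r = ft (C \<otimes> B) ?x'" "src (C \<otimes> B) s = fob \<beta>' (tgt (B \<otimes> C) r')" "src (B \<otimes> C) r' = ft (B \<otimes> C) ?x" for r s r'
    proof -
      have "A_CB.Ha (idm A a) r \<odot>\<^bsub>V'\<^esub> (tt A (C \<otimes> B) a ?x' \<odot>\<^bsub>V'\<^esub> k1) =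
         A_CB.Ha (idm A a) (r \<odot>\<^bsub>C \<otimes> B\<^esub> k0) \<odot>\<^bsub>V'\<^esub> tt A (C \<otimes> B) a (fob \<beta>' ?x)"
        unfolding k1(3) using rs s0 \<beta>x abc by simp
      also have "\<dots> = A_CB.Ha (idm A a) s \<odot>\<^bsub>V'\<^esub> (farr \<tau>' (A_BC.Ha (idm A a) r') \<odot>\<^bsub>V'\<^esub> tt A (C \<otimes> B) a (fob \<beta>' ?x))"
        unfolding r using rs \<beta>x abc x by (simp add: \<beta>'.map_ft)
      also have "farr \<tau>' (A_BC.Ha (idm A a) r') \<odot>\<^bsub>V'\<^esub> tt A (C \<otimes> B) a (fob \<beta>' ?x) =
         farr \<tau>' (A_BC.Ha (idm A a) r' \<odot>\<^bsub>V\<^esub> tt A (B \<otimes> C) a ?x)"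
        unfolding \<tau>'c[symmetric] using rs abc x by (simp del: \<tau>')
      finally show ?thesis .
    qed
    \<comment> \<open>A projection \<open>q\<close> is pushed through \<open>k3\<close> and then
      through the image of \<open>k1\<close>; \<open>r\<close> is the projection of
      \<open>a \<otimes> (c \<otimes> b)\<close> met in between.\<close>
    have combine: "q \<odot>\<^bsub>D\<^esub> (k3 \<odot>\<^bsub>D\<^esub> ?K k1) = (s \<odot>\<^bsub>D\<^esub> ?K s') \<odot>\<^bsub>D\<^esub> P p"
      if h: "q \<odot>\<^bsub>D\<^esub> k3 = s \<odot>\<^bsub>D\<^esub> ?K r" "r \<odot>\<^bsub>V'\<^esub> k1 = s' \<odot>\<^bsub>V'\<^esub> farr \<tau>' p"
        and a: "q \<in> arr D" "src D q = ft D (Go a b c)" "s \<in> arr D"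
        "r \<in> arr V'" "src V' r = ft V' (A_CB.Ho a ?x')"
        "src D s = fob \<tau> (fob \<alpha> (tgt V' r))" "s' \<in> arr V'" "p \<in> arr V"
        "src V' s' = fob \<tau>' (tgt V p)" "tgt V' s' = tgt V' r"
      for q s r s' p
    proof -
      have "q \<odot>\<^bsub>D\<^esub> (k3 \<odot>\<^bsub>D\<^esub> ?K k1) = (q \<odot>\<^bsub>D\<^esub> k3) \<odot>\<^bsub>D\<^esub> ?K k1"
        using a(1,2) s1 s3 Kob by simp
      also have "\<dots> = s \<odot>\<^bsub>D\<^esub> ?K (r \<odot>\<^bsub>V'\<^esub> k1)"
        unfolding h(1) using a s1 by simp
      also have "\<dots> = (s \<odot>\<^bsub>D\<^esub> ?K s') \<odot>\<^bsub>D\<^esub> P p"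
        unfolding h(2) P_def using a by simp
      finally show ?thesis .
    qed
    \<comment> \<open>For \<open>a\<close> the symmetry equation used is that of \<open>k2\<close>;
      \<open>k1\<close> contributes its equation for \<open>tl\<close>.\<close>
    have "q1 a b c \<odot>\<^bsub>D\<^esub> (k3 \<odot>\<^bsub>D\<^esub> ?K k1) = ?\<psi> (ft A a) b c \<odot>\<^bsub>D\<^esub> P (tl A (B \<otimes> C) a ?x)"
    proof (rule combine)
      show "q1 a b c \<odot>\<^bsub>D\<^esub> k3 = \<chi> (ft A a) b c \<odot>\<^bsub>D\<^esub> ?K (tl A (C \<otimes> B) a ?x')"
        using left[OF k2(3)] abc v w s3 unfolding \<chi>_def ac(1)[symmetric] by simp
      show "tl A (C \<otimes> B) a ?x' \<odot>\<^bsub>V'\<^esub> k1 = \<omega> (ft A a) b c \<odot>\<^bsub>V'\<^esub> farr \<tau>' (tl A (B \<otimes> C) a ?x)"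
        unfolding \<tau>'c by (rule k1(2))
    qed (use abc x x' v w in simp_all)
    \<comment> \<open>For \<open>b\<close> the symmetry equation used is that of \<open>k0\<close>;
      \<open>k3\<close> contributes its equation for \<open>tt\<close>.\<close>
    moreover have "q2 a b c \<odot>\<^bsub>D\<^esub> (k3 \<odot>\<^bsub>D\<^esub> ?K k1) = ?\<psi> a (ft B b) c \<odot>\<^bsub>D\<^esub>
        P (A_BC.Ha (idm A a) (tl B C b c) \<odot>\<^bsub>V\<^esub> tt A (B \<otimes> C) a ?x)"
    proof (rule combine)
      show "q2 a b c \<odot>\<^bsub>D\<^esub> k3 = \<chi> a (ft B b) c \<odot>\<^bsub>D\<^esub>
          ?K (A_CB.Ha (idm A a) (tt C B c b) \<odot>\<^bsub>V'\<^esub> tt A (C \<otimes> B) a ?x')"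
        unfolding ac(3)[symmetric] using k3(3) \<tau>c(1) by simp
      show "(A_CB.Ha (idm A a) (tt C B c b) \<odot>\<^bsub>V'\<^esub> tt A (C \<otimes> B) a ?x') \<odot>\<^bsub>V'\<^esub> k1 =
          \<omega> a (ft B b) c \<odot>\<^bsub>V'\<^esub> farr \<tau>' (A_BC.Ha (idm A a) (tl B C b c) \<odot>\<^bsub>V\<^esub> tt A (B \<otimes> C) a ?x)"
        using right[OF k0(3)] abc x x' s1 unfolding \<omega>_def by simp
    qed (use abc x x' v w in simp_all)
    \<comment> \<open>For \<open>c\<close>, which is exchanged with both other variables, the
      equations of \<open>k2\<close> and \<open>k0\<close> are combined.\<close>
    moreover have "q3 a b c \<odot>\<^bsub>D\<^esub> (k3 \<odot>\<^bsub>D\<^esub> ?K k1) = ?\<psi> a b (ft C c) \<odot>\<^bsub>D\<^esub>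
        P (A_BC.Ha (idm A a) (tt B C b c) \<odot>\<^bsub>V\<^esub> tt A (B \<otimes> C) a ?x)"
    proof (rule combine)
      show "q3 a b c \<odot>\<^bsub>D\<^esub> k3 = \<chi> a b (ft C c) \<odot>\<^bsub>D\<^esub>
          ?K (A_CB.Ha (idm A a) (tl C B c b) \<odot>\<^bsub>V'\<^esub> tt A (C \<otimes> B) a ?x')"
        using left[OF k2(2)] abc v w s3 unfolding \<chi>_def ac(2)[symmetric] by simp
      show "(A_CB.Ha (idm A a) (tl C B c b) \<odot>\<^bsub>V'\<^esub> tt A (C \<otimes> B) a ?x') \<odot>\<^bsub>V'\<^esub> k1 =
          \<omega> a b (ft C c) \<odot>\<^bsub>V'\<^esub> farr \<tau>' (A_BC.Ha (idm A a) (tt B C b c) \<odot>\<^bsub>V\<^esub> tt A (B \<otimes> C) a ?x)"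
        using right[OF k0(2)] abc x x' s1 unfolding \<omega>_def by simp
    qed (use abc x x' v w in simp_all)
    moreover have "qsq D (?\<psi> a b c) (k3 \<odot>\<^bsub>D\<^esub> ?K k1)"
      using abc by (intro CA_B.D.qsq_comp[OF \<tau>.qsq_map[OF \<alpha>.qsq_map[OF k1(1)]] k3(1)]) simp
    ultimately show "\<exists>k. qsq D (?\<psi> a b c) k \<and>
        q1 a b c \<odot>\<^bsub>D\<^esub> k = ?\<psi> (ft A a) b c \<odot>\<^bsub>D\<^esub> P (tl A (B \<otimes> C) a ?x) \<and>
        q2 a b c \<odot>\<^bsub>D\<^esub> k = ?\<psi> a (ft B b) c \<odot>\<^bsub>D\<^esub>
          P (A_BC.Ha (idm A a) (tl B C b c) \<odot>\<^bsub>V\<^esub> tt A (B \<otimes> C) a ?x) \<and>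
        q3 a b c \<odot>\<^bsub>D\<^esub> k = ?\<psi> a b (ft C c) \<odot>\<^bsub>D\<^esub>
          P (A_BC.Ha (idm A a) (tt B C b c) \<odot>\<^bsub>V\<^esub> tt A (B \<otimes> C) a ?x)"
      by blast
  qed (rule q_mono)
  then show ?thesis by blast
qed

end

theorem proposition7p15:
  fixes t :: "'u tensor" (structure)
    and A B C :: "'u contextual"
    and \<alpha>\<^sub>A\<^sub>B\<^sub>C \<alpha>\<^sub>A\<^sub>C\<^sub>B \<alpha>\<^sub>C\<^sub>A\<^sub>B \<beta>\<^sub>A\<^sub>C \<beta>\<^sub>B\<^sub>C \<beta>\<^sub>A\<^sub>B\<^sub>_\<^sub>C :: "('u, 'u, 'u, 'u) fctr"
  assumes "tensor_choice t"
    and "contextual_category A" and "contextual_category B" and "contextual_category C"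
    and "is_associator t A B C \<alpha>\<^sub>A\<^sub>B\<^sub>C"
    and "is_associator t A C B \<alpha>\<^sub>A\<^sub>C\<^sub>B"
    and "is_associator t C A B \<alpha>\<^sub>C\<^sub>A\<^sub>B"
    and "is_symmetry t A C \<beta>\<^sub>A\<^sub>C"
    and "is_symmetry t B C \<beta>\<^sub>B\<^sub>C"
    and "is_symmetry t (A \<otimes> B) C \<beta>\<^sub>A\<^sub>B\<^sub>_\<^sub>C"
  shows
    "comp_fctr (A \<otimes> (B \<otimes> C))
       (tensor_fctr t (A \<otimes> C) B (C \<otimes> A) B \<beta>\<^sub>A\<^sub>C (id_fctr B))
       (comp_fctr (A \<otimes> (B \<otimes> C)) \<alpha>\<^sub>A\<^sub>C\<^sub>B
          (tensor_fctr t A (B \<otimes> C) A (C \<otimes> B) (id_fctr A) \<beta>\<^sub>B\<^sub>C))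
     = comp_fctr (A \<otimes> (B \<otimes> C)) \<alpha>\<^sub>C\<^sub>A\<^sub>B
         (comp_fctr (A \<otimes> (B \<otimes> C)) \<beta>\<^sub>A\<^sub>B\<^sub>_\<^sub>C \<alpha>\<^sub>A\<^sub>B\<^sub>C)"
proof -
  interpret hexagon t A B C
    by (intro hexagon.intro tensor.intro hexagon_axioms.intro assms(1-4))
  let ?V = "A \<otimes> (B \<otimes> C)" and ?D = "(C \<otimes> A) \<otimes> B"
  let ?\<tau> = "tensor_fctr t (A \<otimes> C) B (C \<otimes> A) B \<beta>\<^sub>A\<^sub>C (id_fctr B)"
  let ?\<tau>' = "tensor_fctr t A (B \<otimes> C) A (C \<otimes> B) (id_fctr A) \<beta>\<^sub>B\<^sub>C"
  let ?M = "comp_fctr ?V ?\<tau> (comp_fctr ?V \<alpha>\<^sub>A\<^sub>C\<^sub>B ?\<tau>')"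
  let ?N = "comp_fctr ?V \<alpha>\<^sub>C\<^sub>A\<^sub>B (comp_fctr ?V \<beta>\<^sub>A\<^sub>B\<^sub>_\<^sub>C \<alpha>\<^sub>A\<^sub>B\<^sub>C)"
  note cc = A_BC.D.contextual_cat_axioms A_CB.D.contextual_cat_axioms AC_B.D.contextual_cat_axioms
    AB_C.D.contextual_cat_axioms C_AB.D.contextual_cat_axioms CA_B.D.contextual_cat_axioms
    BC.D.contextual_cat_axioms CB.D.contextual_cat_axioms AC.D.contextual_cat_axioms CA.D.contextual_cat_axioms
    contextual_cat.intro[OF ABC(1)] contextual_cat.intro[OF ABC(2)]
  have "contextual_fun (A \<otimes> C) (C \<otimes> A) \<beta>\<^sub>A\<^sub>C" "contextual_fun (B \<otimes> C) (C \<otimes> B) \<beta>\<^sub>B\<^sub>C"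
    "contextual_fun A A (id_fctr A)" "contextual_fun B B (id_fctr B)"
    by (intro contextual_fun.intro contextual_fun_axioms.intro cc symmetry_functor[OF assms(8)]
      symmetry_functor[OF assms(9)] contextual_functor_id)+
  note \<tau> = tensor_fctr(1)[OF this(1,4)] and \<tau>' = tensor_fctr(1)[OF this(3,2)]
  have M: "contextual_functor ?V ?D ?M"
    by (rule contextual_functor_comp[OF cc(1,3,6) contextual_functor_comp[OF cc(1,2,3) \<tau>' associator_functor[OF assms(6)]] \<tau>])
  have N: "contextual_functor ?V ?D ?N"
    by (rule contextual_functor_comp[OF cc(1,5,6) contextual_functor_comp[OF cc(1,4,5) associator_functor[OF assms(5)]
          symmetry_functor[OF assms(10)]] associator_functor[OF assms(7)]])
  have "contextual_fun ?V ?D ?M" "contextual_fun ?V ?D ?N"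
    by (intro contextual_fun.intro contextual_fun_axioms.intro cc M N)+
  \<comment> \<open>Composed with the tensor map of \<open>A\<close> and
    \<open>B \<otimes> C\<close>, both sides become bimorphisms.\<close>
  note KL = this[THEN bimorphism_cones_postcomp[OF A_BC.bimorphism_cones_axioms]]
  have KL_arr: "farr (comp_fctr (prod_cat A (B \<otimes> C)) L (tmap t A (B \<otimes> C))) (f, k) = farr L (A_BC.Ha f k)"
    if "f \<in> arr A" "k \<in> arr (B \<otimes> C)" for f k L
    using that by (simp add: prod_cat_def)
  obtain \<psi> \<psi>' where "cube_lift A B C ?D (\<lambda>f g h. farr ?\<tau> (farr \<alpha>\<^sub>A\<^sub>C\<^sub>B (farr ?\<tau>' (A_BC.Ha f (BC.Ha g h))))) G
     (\<lambda>a b c. fob ?\<tau> (fob \<alpha>\<^sub>A\<^sub>C\<^sub>B (fob ?\<tau>' (A_BC.Ho a (BC.Ho b c))))) Go \<psi>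
     (\<lambda>a b c. farr ?\<tau> (farr \<alpha>\<^sub>A\<^sub>C\<^sub>B (farr ?\<tau>' (tl A (B \<otimes> C) a (BC.Ho b c)))))
     (\<lambda>a b c. farr ?\<tau> (farr \<alpha>\<^sub>A\<^sub>C\<^sub>B (farr ?\<tau>' (A_BC.Ha (idm A a) (tl B C b c) \<odot>\<^bsub>?V\<^esub> tt A (B \<otimes> C) a (BC.Ho b c)))))
     (\<lambda>a b c. farr ?\<tau> (farr \<alpha>\<^sub>A\<^sub>C\<^sub>B (farr ?\<tau>' (A_BC.Ha (idm A a) (tt B C b c) \<odot>\<^bsub>?V\<^esub> tt A (B \<otimes> C) a (BC.Ho b c))))) q1 q2 q3"
    and "cube_lift A B C ?D (\<lambda>f g h. farr \<alpha>\<^sub>C\<^sub>A\<^sub>B (farr \<beta>\<^sub>A\<^sub>B\<^sub>_\<^sub>C (AB_C.Ha (AB.Ha f g) h))) G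
     (\<lambda>a b c. fob \<alpha>\<^sub>C\<^sub>A\<^sub>B (fob \<beta>\<^sub>A\<^sub>B\<^sub>_\<^sub>C (AB_C.Ho (AB.Ho a b) c))) Go \<psi>'
     (\<lambda>a b c. farr \<alpha>\<^sub>C\<^sub>A\<^sub>B (farr \<beta>\<^sub>A\<^sub>B\<^sub>_\<^sub>C (AB_C.Ha (tl A B a b) (idm C c) \<odot>\<^bsub>(A \<otimes> B) \<otimes> C\<^esub> tl (A \<otimes> B) C (AB.Ho a b) c)))
     (\<lambda>a b c. farr \<alpha>\<^sub>C\<^sub>A\<^sub>B (farr \<beta>\<^sub>A\<^sub>B\<^sub>_\<^sub>C (AB_C.Ha (tt A B a b) (idm C c) \<odot>\<^bsub>(A \<otimes> B) \<otimes> C\<^esub> tl (A \<otimes> B) C (AB.Ho a b) c)))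
     (\<lambda>a b c. farr \<alpha>\<^sub>C\<^sub>A\<^sub>B (farr \<beta>\<^sub>A\<^sub>B\<^sub>_\<^sub>C (tt (A \<otimes> B) C (AB.Ho a b) c))) q1 q2 q3"
    using cube_lift_left[OF assms(6,8,9)] cube_lift_right[OF assms(5,7,10)] by (elim exE)
  \<comment> \<open>The two lifts have the same target functor and the same projections
    \<open>q1\<close>, \<open>q2\<close>, \<open>q3\<close>, as the uniqueness statement
    demands.\<close>
  note lift = cube_lift_unique[OF this]
  have pure: "farr ?M (A_BC.Ha f (BC.Ha g h)) = farr ?N (A_BC.Ha f (BC.Ha g h))"
    if "f \<in> arr A" "g \<in> arr B" "h \<in> arr C" for f g h
    using lift[OF that] associator_arr[OF assms(5) that] that by simp
  \<comment> \<open>Two rounds of generation: from pure tensors \<open>g \<otimes> h\<close> to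
    every arrow \<open>k\<close> of \<open>B \<otimes> C\<close>, and then from the arrows
    \<open>f \<otimes> k\<close> to the whole domain.\<close>
  have "farr ?M (A_BC.Ha f k) = farr ?N (A_BC.Ha f k)" if "f \<in> arr A" "k \<in> arr (B \<otimes> C)" for f k
    using bimorphisms_agree[OF BC.universal_cones_axioms KL _ that] pure that by (simp add: KL_arr del: comp_fctr_arr)
  then show ?thesis by (rule A_BC.functor_unique[OF cc(6) M N])
qed

end
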